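(* Let $M$ be a phase space (a smooth manifold with Poisson bracket $\{\cdot,\cdot\}$), and let $(X,Y)$ be a classical Leonard pair of smooth real-valued observables on $M$: with $Z=\{X,Y\}$, there are real constants $\alpha_{ij}$ ($0\le i,j\le 2$) and a polynomial $\Phi(x,y)=\sum_{i,j=0}^{2}\alpha_{ij}x^iy^j$ such that $$\{X,Z\}=\tfrac12\,\Phi_Y(X,Y),\qquad \{Z,Y\}=\tfrac12\,\Phi_X(X,Y),\qquad Z^2=\Phi(X,Y).$$ Let $\tau_0,\tau_1,\tau_2,\tau_3,\tau_4$ be real constants and let $$W=\tau_1XY+\tau_2Z+\tau_3X+\tau_4Y+\tau_0$$ be the associated classical Heun observable, taken as Hamiltonian, so that $\dot F=\{F,W\}$ for every observable $F$ along trajectories. Then for every energy value $w\in\mathbb{R}$ there exist polynomials $\mathcal P_4$ and $\widetilde{\mathcal P}_4$ in one variable, of degree at most four and with constant (time-independent) real coefficients, such that along every trajectory lying on the energy surface $W=w$ the functions $X(t)$ and $Y(t)$ satisfy $$\dot X^2=\mathcal P_4(X),\qquad \dot Y^2=\widetilde{\mathcal P}_4(Y).$$ Moreover, in the generic non-degenerate case, both $X(t)$ and $Y(t)$ are elliptic functions of second order: whenever these equations hold along a trajectory (defined on an open time interval) with polynomials $\mathcal P_4$ and $\widetilde{\mathcal P}_4$ each of degree exactly four with four distinct complex roots, and $X(t)$ and $Y(t)$ are non-constant, each of $X(t)$ and $Y(t)$ is the restriction to that real time interval of an elliptic function of order two of complex $t$.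
   Context: Conventions. $\Phi_X$ and $\Phi_Y$ denote the partial derivatives of $\Phi(x,y)$ with respect to its first and second argument, respectively, evaluated at $(X,Y)$. In the one-dimensional case the phase space has canonical coordinates $(q,p)$ and $\{F,G\}=F_qG_p-F_pG_q$. Classical Leonard pair: a pair of observables $(X,Y)$ satisfying, with $Z=\{X,Y\}$, the relations $\{X,Z\}=\tfrac12\Phi_Y(X,Y)$ and $\{Z,Y\}=\tfrac12\Phi_X(X,Y)$, where $\Phi$ is a polynomial of degree at most two in each variable. For such a pair the observable $Q=Z^2-\Phi(X,Y)$ Poisson-commutes with $X$ and $Y$. The standing convention is that $Q$ is treated as a constant and absorbed into the free term $\alpha_{00}$ of $\Phi$, so that $Z^2=\Phi(X,Y)$. Trajectory: an integral curve of the Hamiltonian vector field of $W$, i.e. a smooth curve in $M$ along which $\frac{d}{dt}F=\{F,W\}$ for all smooth functions $F$. $X(t)$ and $Y(t)$ denote the values of $X$ and $Y$ along it. The value of $W$ is constant along each trajectory; an energy surface is a level set $W=w$. Elliptic function of second order (order two): a meromorphic function on $\mathbb{C}$, doubly periodic with respect to a lattice, having exactly two poles counted with multiplicity in a fundamental period parallelogram. *)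

theory Defs
  imports
    "HOL-Analysis.Analysis"
    "HOL-Complex_Analysis.Complex_Analysis"
    "HOL-Computational_Algebra.Computational_Algebra"
begin

section \<open>Smooth manifolds\<close>

text \<open>\<open>Ck_on k f S\<close> and \<open>smooth_on S f\<close> are meant for open sets \<open>S\<close>; all partial (directional)
  derivatives up to order \<open>k\<close> are required to exist and to be continuous.\<close>

primrec Ck_on ::
  "nat \<Rightarrow> ('a::real_normed_vector \<Rightarrow> 'b::real_normed_vector) \<Rightarrow> 'a set \<Rightarrow> bool" where
  "Ck_on 0 f S \<longleftrightarrow> continuous_on S f"
| "Ck_on (Suc k) f S \<longleftrightarrow>
     (\<forall>x\<in>S. f differentiable (at x)) \<and>
     (\<forall>v. Ck_on k (\<lambda>x. frechet_derivative f (at x) v) S)"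

definition smooth_on ::
  "'a::real_normed_vector set \<Rightarrow> ('a \<Rightarrow> 'b::real_normed_vector) \<Rightarrow> bool" where
  "smooth_on S f \<longleftrightarrow> (\<forall>k. Ck_on k f S)"

text \<open>A chart is a pair \<open>(U, \<phi>)\<close>; only the values of \<open>\<phi>\<close> on \<open>U\<close> matter.\<close>

definition is_chart ::
  "'m topology \<Rightarrow> 'm set \<Rightarrow> ('m \<Rightarrow> 'e::euclidean_space) \<Rightarrow> bool" where
  "is_chart M U \<phi> \<longleftrightarrow>
     openin M U \<and> open (\<phi> ` U) \<and>
     homeomorphic_map (subtopology M U) (top_of_set (\<phi> ` U)) \<phi>"

definition smooth_manifold ::
  "'m topology \<Rightarrow> ('m set \<times> ('m \<Rightarrow> 'e::euclidean_space)) set \<Rightarrow> bool" where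
  "smooth_manifold M \<A> \<longleftrightarrow>
     Hausdorff_space M \<and> second_countable M \<and>
     (\<forall>(U, \<phi>)\<in>\<A>. is_chart M U \<phi>) \<and>
     (\<Union>(U, \<phi>)\<in>\<A>. U) = topspace M \<and>
     (\<forall>(U, \<phi>)\<in>\<A>. \<forall>(V, \<psi>)\<in>\<A>. smooth_on (\<phi> ` (U \<inter> V)) (\<psi> \<circ> inv_into U \<phi>))"

text \<open>A real function on the manifold is a total function of which only the values on
  \<open>topspace M\<close> matter.\<close>

definition smooth_function ::
  "('m set \<times> ('m \<Rightarrow> 'e::euclidean_space)) set \<Rightarrow> ('m \<Rightarrow> real) \<Rightarrow> bool" where
  "smooth_function \<A> F \<longleftrightarrow> (\<forall>(U, \<phi>)\<in>\<A>. smooth_on (\<phi> ` U) (F \<circ> inv_into U \<phi>))"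

definition smooth_curve ::
  "'m topology \<Rightarrow> ('m set \<times> ('m \<Rightarrow> 'e::euclidean_space)) set \<Rightarrow> real set \<Rightarrow> (real \<Rightarrow> 'm) \<Rightarrow> bool" where
  "smooth_curve M \<A> I \<gamma> \<longleftrightarrow>
     continuous_map (top_of_set I) M \<gamma> \<and>
     (\<forall>(U, \<phi>)\<in>\<A>. smooth_on {t\<in>I. \<gamma> t \<in> U} (\<phi> \<circ> \<gamma>))"

section \<open>Poisson brackets and trajectories\<close>

text \<open>The first clause says that the bracket is a well-defined operation on functions on
  \<open>topspace M\<close>, independently of the junk values outside.\<close>

definition poisson_bracket ::
  "'m topology \<Rightarrow> ('m set \<times> ('m \<Rightarrow> 'e::euclidean_space)) set \<Rightarrow>
   (('m \<Rightarrow> real) \<Rightarrow> ('m \<Rightarrow> real) \<Rightarrow> ('m \<Rightarrow> real)) \<Rightarrow> bool" where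
  "poisson_bracket M \<A> br \<longleftrightarrow>
     (\<forall>F F' G G'. smooth_function \<A> F \<longrightarrow> smooth_function \<A> F' \<longrightarrow>
        smooth_function \<A> G \<longrightarrow> smooth_function \<A> G' \<longrightarrow>
        (\<forall>m\<in>topspace M. F m = F' m \<and> G m = G' m) \<longrightarrow>
        (\<forall>m\<in>topspace M. br F G m = br F' G' m)) \<and>
     (\<forall>F G. smooth_function \<A> F \<longrightarrow> smooth_function \<A> G \<longrightarrow> smooth_function \<A> (br F G)) \<and>
     (\<forall>F G. smooth_function \<A> F \<longrightarrow> smooth_function \<A> G \<longrightarrow>
        (\<forall>m\<in>topspace M. br F G m = - br G F m)) \<and>
     (\<forall>F G H a b. smooth_function \<A> F \<longrightarrow> smooth_function \<A> G \<longrightarrow> smooth_function \<A> H \<longrightarrow>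
        (\<forall>m\<in>topspace M. br (\<lambda>x. a * F x + b * G x) H m = a * br F H m + b * br G H m)) \<and>
     (\<forall>F G H. smooth_function \<A> F \<longrightarrow> smooth_function \<A> G \<longrightarrow> smooth_function \<A> H \<longrightarrow>
        (\<forall>m\<in>topspace M. br (\<lambda>x. F x * G x) H m = F m * br G H m + br F H m * G m)) \<and>
     (\<forall>F G H. smooth_function \<A> F \<longrightarrow> smooth_function \<A> G \<longrightarrow> smooth_function \<A> H \<longrightarrow>
        (\<forall>m\<in>topspace M. br F (br G H) m + br G (br H F) m + br H (br F G) m = 0))"

definition phase_space ::
  "'m topology \<Rightarrow> ('m set \<times> ('m \<Rightarrow> 'e::euclidean_space)) set \<Rightarrow>
   (('m \<Rightarrow> real) \<Rightarrow> ('m \<Rightarrow> real) \<Rightarrow> ('m \<Rightarrow> real)) \<Rightarrow> bool" where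
  "phase_space M \<A> br \<longleftrightarrow> smooth_manifold M \<A> \<and> poisson_bracket M \<A> br"

definition trajectory ::
  "'m topology \<Rightarrow> ('m set \<times> ('m \<Rightarrow> 'e::euclidean_space)) set \<Rightarrow>
   (('m \<Rightarrow> real) \<Rightarrow> ('m \<Rightarrow> real) \<Rightarrow> ('m \<Rightarrow> real)) \<Rightarrow> ('m \<Rightarrow> real) \<Rightarrow>
   real set \<Rightarrow> (real \<Rightarrow> 'm) \<Rightarrow> bool" where
  "trajectory M \<A> br W I \<gamma> \<longleftrightarrow>
     open I \<and> is_interval I \<and> smooth_curve M \<A> I \<gamma> \<and>
     (\<forall>F. smooth_function \<A> F \<longrightarrow>
        (\<forall>t\<in>I. ((\<lambda>s. F (\<gamma> s)) has_real_derivative br F W (\<gamma> t)) (at t)))"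

section \<open>Classical Leonard pairs and Heun observables\<close>

definition Phi :: "(nat \<Rightarrow> nat \<Rightarrow> real) \<Rightarrow> real \<Rightarrow> real \<Rightarrow> real" where
  "Phi \<alpha> x y = (\<Sum>i\<le>2. \<Sum>j\<le>2. \<alpha> i j * x ^ i * y ^ j)"

definition Phi_X :: "(nat \<Rightarrow> nat \<Rightarrow> real) \<Rightarrow> real \<Rightarrow> real \<Rightarrow> real" where
  "Phi_X \<alpha> x y = deriv (\<lambda>u. Phi \<alpha> u y) x"

definition Phi_Y :: "(nat \<Rightarrow> nat \<Rightarrow> real) \<Rightarrow> real \<Rightarrow> real \<Rightarrow> real" where
  "Phi_Y \<alpha> x y = deriv (\<lambda>u. Phi \<alpha> x u) y"

text \<open>The last clause is the normalisation that absorbs the central observable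
  \<open>Q = Z\<^sup>2 - \<Phi>(X,Y)\<close> into the constant term of \<open>\<Phi>\<close>.\<close>

definition classical_leonard_pair ::
  "'m topology \<Rightarrow> ('m set \<times> ('m \<Rightarrow> 'e::euclidean_space)) set \<Rightarrow>
   (('m \<Rightarrow> real) \<Rightarrow> ('m \<Rightarrow> real) \<Rightarrow> ('m \<Rightarrow> real)) \<Rightarrow> (nat \<Rightarrow> nat \<Rightarrow> real) \<Rightarrow>
   ('m \<Rightarrow> real) \<Rightarrow> ('m \<Rightarrow> real) \<Rightarrow> bool" where
  "classical_leonard_pair M \<A> br \<alpha> X Y \<longleftrightarrow>
     smooth_function \<A> X \<and> smooth_function \<A> Y \<and>
     (let Z = br X Y in
       \<forall>m\<in>topspace M.
         br X Z m = 1 / 2 * Phi_Y \<alpha> (X m) (Y m) \<and>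
         br Z Y m = 1 / 2 * Phi_X \<alpha> (X m) (Y m) \<and>
         (Z m)\<^sup>2 = Phi \<alpha> (X m) (Y m))"

definition heun_observable ::
  "(('m \<Rightarrow> real) \<Rightarrow> ('m \<Rightarrow> real) \<Rightarrow> ('m \<Rightarrow> real)) \<Rightarrow> real \<Rightarrow> real \<Rightarrow> real \<Rightarrow> real \<Rightarrow> real \<Rightarrow>
   ('m \<Rightarrow> real) \<Rightarrow> ('m \<Rightarrow> real) \<Rightarrow> ('m \<Rightarrow> real)" where
  "heun_observable br \<tau>0 \<tau>1 \<tau>2 \<tau>3 \<tau>4 X Y =
     (\<lambda>m. \<tau>1 * (X m * Y m) + \<tau>2 * br X Y m + \<tau>3 * X m + \<tau>4 * Y m + \<tau>0)"

section \<open>Elliptic functions of order two\<close>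

definition period_parallelogram :: "complex \<Rightarrow> complex \<Rightarrow> complex set" where
  "period_parallelogram \<omega>1 \<omega>2 =
     {of_real s * \<omega>1 + of_real t * \<omega>2 | s t. s \<in> {0..<1} \<and> t \<in> {0..<1}}"

text \<open>Being nicely meromorphic excludes removable singularities and fixes the value \<open>0\<close> at poles,
  so the periodicity equations below carry no information at poles that depends on junk values.
  The order of a pole \<open>z\<close> is \<open>- zorder f z\<close>.\<close>

definition elliptic_order_two :: "(complex \<Rightarrow> complex) \<Rightarrow> bool" where
  "elliptic_order_two f \<longleftrightarrow>
     f nicely_meromorphic_on UNIV \<and>
     (\<exists>\<omega>1 \<omega>2. \<omega>1 \<noteq> 0 \<and> \<omega>2 / \<omega>1 \<notin> \<real> \<and>
        (\<forall>z. f (z + \<omega>1) = f z \<and> f (z + \<omega>2) = f z) \<and>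
        finite {z \<in> period_parallelogram \<omega>1 \<omega>2. is_pole f z} \<and>
        (\<Sum>z \<in> {z \<in> period_parallelogram \<omega>1 \<omega>2. is_pole f z}. - zorder f z) = 2)"

text \<open>Since \<open>f\<close> has the value \<open>0\<close> at its poles, their absence from \<open>I\<close> is required explicitly.\<close>

definition restriction_of_elliptic_order_two :: "real set \<Rightarrow> (real \<Rightarrow> real) \<Rightarrow> bool" where
  "restriction_of_elliptic_order_two I x \<longleftrightarrow>
     (\<exists>f. elliptic_order_two f \<and>
        (\<forall>t\<in>I. \<not> is_pole f (of_real t) \<and> f (of_real t) = of_real (x t)))"

definition nondegenerate_quartic :: "real poly \<Rightarrow> bool" where
  "nondegenerate_quartic P \<longleftrightarrow>
     degree P = 4 \<and> card {z::complex. poly (map_poly complex_of_real P) z = 0} = 4"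

end

theory Submission
  imports Defs
begin

text \<open>On a level set \<open>W = w\<close> one can eliminate \<open>Z\<close> and \<open>Y\<close> from
  \<open>{X, W} = (\<tau>1 X + \<tau>4) Z + \<tau>2 \<Phi>\<^sub>Y / 2\<close>: modulo \<open>Z\<^sup>2 = \<Phi>(X,Y)\<close>, its square depends only on
  \<open>X\<close> and the combination \<open>(\<tau>1 X + \<tau>4) Y + \<tau>2 Z = w - \<tau>0 - \<tau>3 X\<close>.

  For the second part no theta or Weierstrass functions are needed. A local solution of
  \<open>s'\<^sup>2 = (1 - s\<^sup>2)(1 - m s\<^sup>2)\<close> at \<open>s = 0\<close> extends meromorphically to the plane by the duplication
  formula, and a Moebius function of \<open>s\<^sup>2\<close> solves \<open>f'\<^sup>2 = P(f)\<close>. By Liouville's theorem and the open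
  mapping theorem two global solutions agree up to a translation and \<open>t \<mapsto> -t\<close>, so \<open>f\<close> attains
  three roots of \<open>P\<close>. Uniqueness makes \<open>f\<close> symmetric about each such point, and the products of
  these reflections yield a period lattice. Elliptic functions being surjective, \<open>f\<close> can be
  translated to match any real initial data.\<close>

section \<open>Uniqueness of solutions\<close>

text \<open>The equation f'^2 = P(f) lacks uniqueness exactly at the roots of P: each root is itself
  a constant solution. Yet the roots are the points about which one wants to reflect. Everything is
  therefore routed through f'' = P'(f)/2, whose right-hand side is locally Lipschitz; it results
  from differentiating and cancelling f', which nonconstancy permits. The sign of f' left open by
  the first-order equation is what the reversal of time accounts for. Monodromy never arises,
  because duplication is rational in s and s' and hence single valued. Comparison of global
  solutions replaces the computation of special values: an explicit expression in s and s' solving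
  the same equation is s up to a change of time, so s inherits its values and its poles. Two
  attained roots yield one period only; the third excludes a cyclic group by parity. Infinity is
  treated like a finite value: for degree four, 1/F solves an equation of the same type, so
  uniqueness also controls the poles.\<close>

lemma second_order_ode_unique_forward:
  fixes u v :: "real \<Rightarrow> complex"
  assumes u: "\<And>t. t \<in> {a..b} \<Longrightarrow> (u has_vector_derivative u' t) (at t)"
    and u': "\<And>t. t \<in> {a..b} \<Longrightarrow> (u' has_vector_derivative poly p (u t)) (at t)"
    and v: "\<And>t. t \<in> {a..b} \<Longrightarrow> (v has_vector_derivative v' t) (at t)"
    and v': "\<And>t. t \<in> {a..b} \<Longrightarrow> (v' has_vector_derivative poly p (v t)) (at t)"
    and eq: "u a = v a" "u' a = v' a" and t: "t \<in> {a..b}"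
  shows "u t = v t \<and> u' t = v' t"
proof -
  have cu: "continuous_on {a..b} u" and cv: "continuous_on {a..b} v"
    using u v has_vector_derivative_continuous by (blast intro: continuous_at_imp_continuous_on)+
  \<comment> \<open>A polynomial is only locally Lipschitz, so a ball containing both solutions is
    fixed. Its convexity turns the bound \<open>L\<close> on the derivative into a Lipschitz
    constant.\<close>
  have "bounded (u ` {a..b} \<union> v ` {a..b})"
    using compact_continuous_image[OF cu] compact_continuous_image[OF cv]
    by (simp add: compact_imp_bounded)
  then obtain R where R: "\<And>x. x \<in> u ` {a..b} \<union> v ` {a..b} \<Longrightarrow> norm x \<le> R"
    by (auto simp: bounded_iff)
  have "bounded (poly (pderiv p) ` cball 0 R)"
    by (intro compact_imp_bounded compact_continuous_image continuous_intros) auto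
  then obtain L where "\<forall>x\<in>poly (pderiv p) ` cball 0 R. norm x \<le> L"
    unfolding bounded_iff by blast
  hence L: "norm (poly (pderiv p) x) \<le> L" if "norm x \<le> R" for x
    using that by simp
  have lip: "norm (poly p x - poly p y) \<le> L * norm (x - y)" if "norm x \<le> R" "norm y \<le> R" for x y
    by (rule field_differentiable_bound[of "cball 0 R" "poly p" "poly (pderiv p)" L])
       (use that L in \<open>auto intro!: poly_DERIV DERIV_subset[OF poly_DERIV]\<close>)
  define K where "K = 1 + \<bar>L\<bar>"
  \<comment> \<open>Gronwall's argument for the squared distance \<open>E\<close> of the two phase
    points: \<open>D\<close> is its derivative, and 2xy <= x^2 + y^2 gives
    \<open>D t \<le> K * E t\<close>, so E exp(-Kt) cannot increase from its initial value
    0.\<close>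
  define E where "E t = (u t - v t) \<bullet> (u t - v t) + (u' t - v' t) \<bullet> (u' t - v' t)" for t
  define D where "D t = 2 * ((u t - v t) \<bullet> (u' t - v' t)) +
    2 * ((u' t - v' t) \<bullet> (poly p (u t) - poly p (v t)))" for t
  have E: "(E has_real_derivative D t) (at t)" if "t \<in> {a..b}" for t
  proof -
    have inner_id: "(x \<bullet> (h *\<^sub>R y) + (h *\<^sub>R y) \<bullet> x) + (y \<bullet> (h *\<^sub>R z) + (h *\<^sub>R z) \<bullet> y)
        = (2 * (x \<bullet> y) + 2 * (y \<bullet> z)) * h" for x y z :: complex and h :: real
      by (simp add: inner_commute[of y x] inner_commute[of z y] algebra_simps)
    have w: "((\<lambda>t. u t - v t) has_derivative (\<lambda>h. h *\<^sub>R (u' t - v' t))) (at t)"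
      using has_vector_derivative_diff[OF u[OF that] v[OF that]]
      by (simp add: has_vector_derivative_def)
    have w': "((\<lambda>t. u' t - v' t) has_derivative (\<lambda>h. h *\<^sub>R (poly p (u t) - poly p (v t)))) (at t)"
      using has_vector_derivative_diff[OF u'[OF that] v'[OF that]]
      by (simp add: has_vector_derivative_def)
    have "(E has_derivative (\<lambda>h. ((u t - v t) \<bullet> (h *\<^sub>R (u' t - v' t)) + (h *\<^sub>R (u' t - v' t)) \<bullet> (u t - v t))
       + ((u' t - v' t) \<bullet> (h *\<^sub>R (poly p (u t) - poly p (v t))) + (h *\<^sub>R (poly p (u t) - poly p (v t))) \<bullet> (u' t - v' t)))) (at t)"
      unfolding E_def[abs_def] by (intro has_derivative_add has_derivative_inner w w')
    moreover have "(\<lambda>h. ((u t - v t) \<bullet> (h *\<^sub>R (u' t - v' t)) + (h *\<^sub>R (u' t - v' t)) \<bullet> (u t - v t))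
       + ((u' t - v' t) \<bullet> (h *\<^sub>R (poly p (u t) - poly p (v t))) + (h *\<^sub>R (poly p (u t) - poly p (v t))) \<bullet> (u' t - v' t)))
       = (*) (D t)"
      unfolding D_def by (rule ext) (rule inner_id)
    ultimately show ?thesis
      by (simp add: has_field_derivative_def)
  qed
  have DE: "D t \<le> K * E t" if "t \<in> {a..b}" for t
  proof -
    define x y where "x = norm (u t - v t)" and "y = norm (u' t - v' t)"
    have l: "norm (poly p (u t) - poly p (v t)) \<le> \<bar>L\<bar> * x"
      unfolding x_def by (rule order.trans[OF lip]) (use R that in \<open>auto intro!: mult_right_mono\<close>)
    have "(u t - v t) \<bullet> (u' t - v' t) \<le> x * y"
      unfolding x_def y_def by (rule norm_cauchy_schwarz)
    moreover have "(u' t - v' t) \<bullet> (poly p (u t) - poly p (v t)) \<le> y * (\<bar>L\<bar> * x)"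
      by (rule order.trans[OF norm_cauchy_schwarz]) (use l in \<open>auto simp: y_def intro!: mult_left_mono\<close>)
    ultimately have "D t \<le> K * (2 * (x * y))"
      unfolding D_def K_def by (simp add: algebra_simps)
    also have "\<dots> \<le> K * (x\<^sup>2 + y\<^sup>2)"
      using sum_squares_bound[of x y] by (intro mult_left_mono) (auto simp: K_def)
    also have "x\<^sup>2 + y\<^sup>2 = E t"
      by (simp add: x_def y_def E_def power2_norm_eq_inner)
    finally show ?thesis .
  qed
  have "E t * exp (- K * t) \<le> E a * exp (- K * a)"
  proof (rule DERIV_nonpos_imp_nonincreasing[of a t "\<lambda>t. E t * exp (- K * t)"])
    show "a \<le> t" using t by simp
    fix s assume s: "a \<le> s" "s \<le> t"
    hence sab: "s \<in> {a..b}" using t by auto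
    have "((\<lambda>t. E t * exp (- K * t)) has_real_derivative (D s - K * E s) * exp (- K * s)) (at s)"
      by (rule derivative_eq_intros E[OF sab] refl)+ (simp add: algebra_simps)
    moreover have "(D s - K * E s) * exp (- K * s) \<le> 0"
      using DE[OF sab] by (simp add: mult_le_0_iff)
    ultimately show "\<exists>y. ((\<lambda>t. E t * exp (- K * t)) has_real_derivative y) (at s) \<and> y \<le> 0"
      by blast
  qed
  also have "E a = 0"
    using eq by (simp add: E_def)
  finally have "E t \<le> 0"
    by (simp add: mult_le_0_iff)
  moreover have "E t = (norm (u t - v t))\<^sup>2 + (norm (u' t - v' t))\<^sup>2"
    by (simp add: E_def power2_norm_eq_inner)
  ultimately show ?thesis
    by (simp add: sum_power2_le_zero_iff)
qed

text \<open>Times before \<open>c\<close> are reached by reversing time: t -> -t preserves u'' =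
  p(u) and changes the sign of the velocities.\<close>

lemma second_order_ode_unique:
  fixes u v :: "real \<Rightarrow> complex"
  assumes u: "\<And>t. t \<in> {a..b} \<Longrightarrow> (u has_vector_derivative u' t) (at t)"
    and u': "\<And>t. t \<in> {a..b} \<Longrightarrow> (u' has_vector_derivative poly p (u t)) (at t)"
    and v: "\<And>t. t \<in> {a..b} \<Longrightarrow> (v has_vector_derivative v' t) (at t)"
    and v': "\<And>t. t \<in> {a..b} \<Longrightarrow> (v' has_vector_derivative poly p (v t)) (at t)"
    and eq: "u c = v c" "u' c = v' c" and c: "c \<in> {a..b}" and t: "t \<in> {a..b}"
  shows "u t = v t \<and> u' t = v' t"
proof (cases "c \<le> t")
  case True
  show ?thesis
    by (rule second_order_ode_unique_forward[of c b u u' p v v' t]) (use assms True in auto)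
next
  case False
  have rev: "((\<lambda>s. f (- s)) has_vector_derivative - f') (at s)"
    if "(f has_vector_derivative f') (at (- s))" for f :: "real \<Rightarrow> complex" and f' s
    using vector_diff_chain_at[OF has_vector_derivative_minus[OF has_vector_derivative_id[of "at s"]] that]
    by (simp add: o_def)
  have neg: "((\<lambda>s. - f s) has_vector_derivative f') (at s)"
    if "(f has_vector_derivative - f') (at s)" for f :: "real \<Rightarrow> complex" and f' s
    using has_vector_derivative_minus[OF that] by simp
  have "u (- (- t)) = v (- (- t)) \<and> - u' (- (- t)) = - v' (- (- t))"
    by (rule second_order_ode_unique_forward[of "- c" "- a" "\<lambda>s. u (- s)" "\<lambda>s. - u' (- s)" p
          "\<lambda>s. v (- s)" "\<lambda>s. - v' (- s)"])
       (use assms False in \<open>auto intro!: rev neg\<close>)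
  thus ?thesis
    by simp
qed

text \<open>Along the segment t -> tz from the origin the equation becomes one in a real parameter,
  with right-hand side z^2 q; the case t = 1 is the claim.\<close>

lemma holomorphic_second_order_ode_unique:
  assumes f: "f holomorphic_on ball 0 r" "\<And>z. z \<in> ball 0 r \<Longrightarrow> deriv (deriv f) z = poly q (f z)"
    and g: "g holomorphic_on ball 0 r" "\<And>z. z \<in> ball 0 r \<Longrightarrow> deriv (deriv g) z = poly q (g z)"
    and eq: "f 0 = g 0" "deriv f 0 = deriv g 0" and z: "z \<in> ball 0 r"
  shows "f z = g z"
proof -
  have ball: "of_real t * z \<in> ball 0 r" if "t \<in> {0..1}" for t :: real
  proof -
    have "norm (of_real t * z) \<le> 1 * norm z"
      unfolding norm_mult using that by (intro mult_right_mono) auto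
    thus ?thesis using z by simp
  qed
  have d: "((\<lambda>t. h (of_real t * z)) has_vector_derivative z * deriv h (of_real t * z)) (at t)"
    if "h holomorphic_on ball 0 r" "t \<in> {0..1}" for h t
  proof -
    have "(h has_field_derivative deriv h (of_real t * z)) (at (of_real t * z))"
      using that ball by (intro holomorphic_derivI[of h "ball 0 r"]) auto
    hence "((\<lambda>w. h (w * z)) has_field_derivative deriv h (of_real t * z) * z) (at (of_real t))"
      by (rule DERIV_chain2) (auto intro!: derivative_eq_intros)
    from has_vector_derivative_real_field[OF this] show ?thesis
      by (simp add: mult.commute)
  qed
  have dd: "((\<lambda>t. z * deriv h (of_real t * z)) has_vector_derivative poly (smult (z\<^sup>2) q) (h (of_real t * z))) (at t)"
    if "h holomorphic_on ball 0 r" "t \<in> {0..1}"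
      "\<And>z. z \<in> ball 0 r \<Longrightarrow> deriv (deriv h) z = poly q (h z)" for h t
    using has_vector_derivative_mult_right[OF d[OF holomorphic_deriv[OF that(1)]], of t z]
      that(3)[OF ball[OF that(2)]] that(2)
    by (simp add: power2_eq_square mult.assoc)
  have "f (of_real 1 * z) = g (of_real 1 * z) \<and> z * deriv f (of_real 1 * z) = z * deriv g (of_real 1 * z)"
    by (rule second_order_ode_unique[of 0 1 "\<lambda>t. f (of_real t * z)" "\<lambda>t. z * deriv f (of_real t * z)"
        "smult (z\<^sup>2) q" "\<lambda>t. g (of_real t * z)" "\<lambda>t. z * deriv g (of_real t * z)" 0 1])
       (simp_all only: d[OF f(1)] d[OF g(1)] dd[OF f(1) _ f(2)] dd[OF g(1) _ g(2)] eq, simp_all add: eq)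
  thus ?thesis
    by simp
qed

section \<open>Identity principles and passage to the second-order equation\<close>

lemma nicely_meromorphic_eqI:
  assumes f: "f nicely_meromorphic_on A" and g: "g nicely_meromorphic_on A"
    and A: "open A" "connected A" and z0: "z0 \<in> A" "\<forall>\<^sub>F z in at z0. f z = g z" and z: "z \<in> A"
  shows "f z = g z"
proof -
  have mero: "(\<lambda>z. f z - g z) meromorphic_on A"
    using f g by (auto simp: nicely_meromorphic_on_def intro!: meromorphic_intros)
  have "\<not> (\<forall>\<^sub>\<approx>z\<in>A. f z - g z \<noteq> 0)"
  proof
    assume "\<forall>\<^sub>\<approx>z\<in>A. f z - g z \<noteq> 0"
    hence "\<forall>\<^sub>F z in at z0. f z - g z \<noteq> 0"
      using A z0 by (simp add: eventually_cosparse_open_eq)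
    with z0(2) have "\<forall>\<^sub>F z in at z0. False"
      by eventually_elim simp
    thus False by simp
  qed
  with meromorphic_imp_constant_or_avoid[OF mero A, of 0] have "\<forall>\<^sub>\<approx>z\<in>A. f z - g z = 0"
    by blast
  hence ev: "\<forall>\<^sub>F w in at z. f w = g w"
    using A z by (simp add: eventually_cosparse_open_eq)
  \<comment> \<open>So far the functions agree only in a punctured neighbourhood of
    \<open>z\<close>. Niceness fixes the value at \<open>z\<close> itself: 0 at a common pole, the
    common limit otherwise.\<close>
  have pole: "is_pole f z \<longleftrightarrow> is_pole g z"
    by (rule is_pole_cong[OF ev refl])
  show ?thesis
  proof (cases "is_pole f z")
    case True
    thus ?thesis using is_pole_zero_at_nicely_mero f g z pole by metis
  next
    case False
    hence "f \<midarrow>z\<rightarrow> f z" "g \<midarrow>z\<rightarrow> g z"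
      using f g z pole by (auto simp: nicely_meromorphic_on_def)
    moreover from this(1) have "g \<midarrow>z\<rightarrow> f z"
      using tendsto_cong[OF ev] by blast
    ultimately show ?thesis
      using LIM_unique by blast
  qed
qed

text \<open>Differentiation gives f' (2 f'' - P'(f)) = 0. The factor f' can be cancelled only near
  \<open>z0\<close>; analytic continuation over the connected set \<open>A\<close> then covers the
  zeros of f' too.\<close>

lemma second_order_from_first_order:
  assumes f: "f holomorphic_on A" and A: "open A" "connected A"
    and ode: "\<And>z. z \<in> A \<Longrightarrow> (deriv f z)\<^sup>2 = poly P (f z)"
    and z0: "z0 \<in> A" "deriv f z0 \<noteq> 0" and z: "z \<in> A"
  shows "2 * deriv (deriv f) z = poly (pderiv P) (f z)"
proof -
  define h where "h z = 2 * deriv (deriv f) z - poly (pderiv P) (f z)" for z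
  have f': "deriv f holomorphic_on A" and f'': "deriv (deriv f) holomorphic_on A"
    using f A by (auto intro!: holomorphic_deriv)
  have poly_hol: "(\<lambda>z. poly Q (f z)) holomorphic_on A" for Q
    by (intro holomorphic_intros f)
  have h: "h holomorphic_on A"
    unfolding h_def by (intro holomorphic_intros f'' poly_hol)
  have prod: "deriv f w * h w = 0" if w: "w \<in> A" for w
  proof -
    have D1: "((\<lambda>z. (deriv f z)\<^sup>2) has_field_derivative 2 * deriv f w * deriv (deriv f) w) (at w)"
      using holomorphic_derivI[OF f' A(1) w] by (auto intro!: derivative_eq_intros)
    have D2: "((\<lambda>z. poly P (f z)) has_field_derivative poly (pderiv P) (f w) * deriv f w) (at w)"
      by (rule DERIV_chain2[OF poly_DERIV holomorphic_derivI[OF f A(1) w]])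
    have "((\<lambda>z. (deriv f z)\<^sup>2) has_field_derivative poly (pderiv P) (f w) * deriv f w) (at w)"
      by (rule has_field_derivative_transform_within_open[OF D2 A(1) w]) (simp add: ode)
    from DERIV_unique[OF D1 this] show ?thesis
      by (simp add: h_def algebra_simps)
  qed
  have "isCont (deriv f) z0"
    using holomorphic_derivI[OF f' A(1) z0(1)] DERIV_isCont by blast
  hence "\<forall>\<^sub>F w in nhds z0. deriv f w \<noteq> 0"
    using z0(2) by (auto simp: isCont_def eventually_nhds_conv_at intro: tendsto_imp_eventually_ne)
  moreover have "\<forall>\<^sub>F w in nhds z0. w \<in> A"
    using A z0 by (simp add: eventually_nhds_in_open)
  ultimately have "\<forall>\<^sub>F w in nhds z0. w \<in> A \<and> h w = 0"
    by eventually_elim (use prod in force)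
  then obtain S where S: "open S" "z0 \<in> S" "\<And>w. w \<in> S \<Longrightarrow> w \<in> A \<and> h w = 0"
    by (auto simp: eventually_nhds)
  have "h z = (\<lambda>_. 0) z"
    by (rule analytic_continuation_open[of S A]) (use S A h z in auto)
  thus ?thesis
    by (simp add: h_def)
qed

section \<open>Global meromorphic solutions\<close>

definition autonomous_solution :: "complex poly \<Rightarrow> (complex \<Rightarrow> complex) \<Rightarrow> bool" where
  "autonomous_solution P f \<longleftrightarrow> f nicely_meromorphic_on UNIV \<and> \<not> f constant_on UNIV \<and>
     (\<forall>z. \<not> is_pole f z \<longrightarrow> (deriv f z)\<^sup>2 = poly P (f z))"

lemma nicely_meromorphic_regular_set:
  assumes "f nicely_meromorphic_on UNIV"
  shows "open {z. \<not> is_pole f z}" "connected {z. \<not> is_pole f z}" "f holomorphic_on {z. \<not> is_pole f z}"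
    "{z. \<not> is_pole f z} \<noteq> {}"
proof -
  have "{z. is_pole f z} sparse_in UNIV"
    using meromorphic_on_imp_not_pole_cosparse[of f UNIV] assms
    by (simp add: nicely_meromorphic_on_def eventually_cosparse)
  from open_diff_sparse_pts[OF _ this] sparse_imp_connected[OF _ _ _ this]
  show o: "open {z. \<not> is_pole f z}" and "connected {z. \<not> is_pole f z}"
    by (simp_all add: set_diff_eq connected_UNIV)
  show "f holomorphic_on {z. \<not> is_pole f z}"
    by (rule analytic_imp_holomorphic, subst analytic_on_analytic_at)
       (use nicely_meromorphic_on_imp_analytic_at[OF assms] in auto)
  have "\<forall>\<^sub>F z in at 0. \<not> is_pole f z"
    using meromorphic_on_imp_not_pole_cosparse[of f UNIV] assms
    by (simp add: nicely_meromorphic_on_def eventually_cosparse_open_eq)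
  thus "{z. \<not> is_pole f z} \<noteq> {}"
    using eventually_happens by force
qed

text \<open>Supplies the base point at which f' may be cancelled.\<close>

lemma nonconstant_nicely_meromorphic_deriv_nonzero:
  assumes f: "f nicely_meromorphic_on UNIV" "\<not> f constant_on UNIV"
  obtains z where "\<not> is_pole f z" "deriv f z \<noteq> 0"
proof -
  note A = nicely_meromorphic_regular_set[OF f(1)]
  have "\<exists>z. \<not> is_pole f z \<and> deriv f z \<noteq> 0"
  proof (rule ccontr)
    assume *: "\<not> ?thesis"
    have "f constant_on {z. \<not> is_pole f z}"
    proof (rule has_field_derivative_0_imp_constant_on)
      fix z assume "z \<in> {z. \<not> is_pole f z}"
      thus "(f has_field_derivative 0) (at z)"
        using holomorphic_derivI[OF A(3) A(1), of z] * by force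
    qed (use A in auto)
    then obtain c where c: "\<And>z. \<not> is_pole f z \<Longrightarrow> f z = c"
      by (auto simp: constant_on_def)
    have "\<forall>\<^sub>F z in at 0. \<not> is_pole f z"
      using meromorphic_on_imp_not_pole_cosparse[of f UNIV] f(1)
      by (simp add: nicely_meromorphic_on_def eventually_cosparse_open_eq)
    hence "\<forall>\<^sub>F z in at 0. f z = c"
      by eventually_elim (rule c)
    hence "frequently (\<lambda>z. f z = c) (at 0)"
      by (simp add: eventually_frequently)
    from frequently_eq_meromorphic_imp_constant[OF this f(1)] have "f constant_on UNIV"
      by (auto simp: constant_on_def)
    with f(2) show False ..
  qed
  thus ?thesis
    using that by blast
qed

text \<open>The poles are sparse, so the regular set is open and connected and one base point serves
  for all of it. Nonconstancy excludes the equilibria: a constant equal to a simple root of P solves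
  the first-order equation but not this one.\<close>

lemma autonomous_solution_second_order:
  assumes "autonomous_solution P f" "\<not> is_pole f z"
  shows "2 * deriv (deriv f) z = poly (pderiv P) (f z)"
proof -
  have f: "f nicely_meromorphic_on UNIV" "\<not> f constant_on UNIV"
    using assms by (auto simp: autonomous_solution_def)
  obtain z0 where "\<not> is_pole f z0" "deriv f z0 \<noteq> 0"
    using nonconstant_nicely_meromorphic_deriv_nonzero[OF f] .
  with nicely_meromorphic_regular_set[OF f(1)] assms show ?thesis
    by (intro second_order_from_first_order[of f "{z. \<not> is_pole f z}" P z0])
       (auto simp: autonomous_solution_def)
qed

text \<open>The values c = 1 and c = -1 keep P and provide translations and reflections of time; a
  general \<open>c\<close> adjusts the leading coefficient.\<close>

lemma autonomous_solution_affine: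
  assumes f: "autonomous_solution P f" and c: "c \<noteq> 0"
  shows "autonomous_solution (smult (c\<^sup>2) P) (\<lambda>z. f (c * z + b))"
    "is_pole (\<lambda>z. f (c * z + b)) z \<longleftrightarrow> is_pole f (c * z + b)"
    "\<not> is_pole f (c * z + b) \<Longrightarrow> deriv (\<lambda>z. f (c * z + b)) z = c * deriv f (c * z + b)"
proof -
  have nice: "f nicely_meromorphic_on UNIV" and nc: "\<not> f constant_on UNIV"
    using f by (auto simp: autonomous_solution_def)
  have lim: "filterlim (\<lambda>z. c * z + b) (at (c * z + b)) (at z)" for z
    by (rule filterlim_atI)
       (use c in \<open>auto intro!: tendsto_eq_intros simp: eventually_at_filter\<close>)
  have lim': "filterlim (\<lambda>z. (z - b) / c) (at z) (at (c * z + b))" for z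
    by (rule filterlim_atI)
       (use c in \<open>auto intro!: tendsto_eq_intros simp: eventually_at_filter field_simps\<close>)
  have pole: "is_pole (\<lambda>z. f (c * z + b)) z \<longleftrightarrow> is_pole f (c * z + b)" for z
  proof
    assume "is_pole (\<lambda>z. f (c * z + b)) z"
    hence "filterlim (\<lambda>w. f (c * ((w - b) / c) + b)) at_infinity (at (c * z + b))"
      unfolding is_pole_def by (rule filterlim_compose[OF _ lim'])
    thus "is_pole f (c * z + b)"
      using c by (simp add: is_pole_def)
  next
    assume "is_pole f (c * z + b)"
    thus "is_pole (\<lambda>z. f (c * z + b)) z"
      unfolding is_pole_def by (rule filterlim_compose[OF _ lim])
  qed
  have tend: "(\<lambda>z. f (c * z + b)) \<midarrow>z\<rightarrow> f (c * z + b)" if "f \<midarrow>c * z + b\<rightarrow> f (c * z + b)" for z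
    by (rule filterlim_compose[OF that lim])
  have nice': "(\<lambda>z. f (c * z + b)) nicely_meromorphic_on UNIV"
    unfolding nicely_meromorphic_on_def
  proof (intro conjI ballI)
    show "(\<lambda>z. f (c * z + b)) meromorphic_on UNIV"
      by (rule meromorphic_on_compose[of f UNIV _ UNIV])
         (use nice in \<open>auto simp: nicely_meromorphic_on_def intro!: analytic_intros\<close>)
  qed (use nice pole tend in \<open>auto simp: nicely_meromorphic_on_def\<close>)
  have surj: "\<exists>z. w = c * z + b" for w
    by (rule exI[of _ "(w - b) / c"]) (use c in simp)
  have nc': "\<not> (\<lambda>z. f (c * z + b)) constant_on UNIV"
    using nc surj unfolding constant_on_def by (metis UNIV_I)
  have D: "deriv (\<lambda>z. f (c * z + b)) z = c * deriv f (c * z + b)" if "\<not> is_pole f (c * z + b)" for z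
  proof -
    have "f field_differentiable at (c * z + b)"
      using nicely_meromorphic_on_imp_analytic_at[OF nice UNIV_I that]
      by (rule analytic_on_imp_differentiable_at) auto
    hence "(f has_field_derivative deriv f (c * z + b)) (at (c * z + b))"
      by (rule field_differentiable_derivI)
    hence "((\<lambda>z. f (c * z + b)) has_field_derivative deriv f (c * z + b) * c) (at z)"
      by (rule DERIV_chain2) (auto intro!: derivative_eq_intros)
    thus ?thesis
      by (simp add: DERIV_imp_deriv mult.commute)
  qed
  show "autonomous_solution (smult (c\<^sup>2) P) (\<lambda>z. f (c * z + b))"
    using f nice' nc' D by (auto simp: autonomous_solution_def pole power_mult_distrib)
  show "is_pole (\<lambda>z. f (c * z + b)) z \<longleftrightarrow> is_pole f (c * z + b)"
    by (rule pole)
  show "\<not> is_pole f (c * z + b) \<Longrightarrow> deriv (\<lambda>z. f (c * z + b)) z = c * deriv f (c * z + b)"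
    by (rule D)
qed

text \<open>Value and derivative are initial data for the second-order equation, so
  \<open>f a\<close> may be a root of P. Agreement on a disc about the shifted origin spreads by the
  identity principle.\<close>

lemma autonomous_solution_unique:
  assumes f: "autonomous_solution P f" and g: "autonomous_solution P g"
    and "\<not> is_pole f a" "\<not> is_pole g b" "f a = g b" "deriv f a = deriv g b"
  shows "f (z + a) = g (z + b)"
proof -
  define F G where "F z = f (1 * z + a)" and "G z = g (1 * z + b)" for z
  have F: "autonomous_solution P F" "is_pole F z \<longleftrightarrow> is_pole f (z + a)" 
    "\<not> is_pole f (z + a) \<Longrightarrow> deriv F z = deriv f (z + a)" for z
    unfolding F_def[abs_def] using autonomous_solution_affine[OF f, of 1 a]
      autonomous_solution_affine(3)[OF f, of 1 z a] by auto
  have G: "autonomous_solution P G" "is_pole G z \<longleftrightarrow> is_pole g (z + b)" 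
    "\<not> is_pole g (z + b) \<Longrightarrow> deriv G z = deriv g (z + b)" for z
    unfolding G_def[abs_def] using autonomous_solution_affine[OF g, of 1 b]
      autonomous_solution_affine(3)[OF g, of 1 z b] by auto
  have nF: "F nicely_meromorphic_on UNIV" and nG: "G nicely_meromorphic_on UNIV"
    using F G by (auto simp: autonomous_solution_def)
  define A where "A = {z. \<not> is_pole F z} \<inter> {z. \<not> is_pole G z}"
  have "open A"
    unfolding A_def using nF nG by (intro open_Int nicely_meromorphic_regular_set)
  moreover have "0 \<in> A"
    using assms(3,4) F(2)[of 0] G(2)[of 0] by (simp add: A_def)
  ultimately obtain r where r: "r > 0" "ball 0 r \<subseteq> A"
    using openE by blast
  have "F z = G z" if "z \<in> ball 0 r" for z
  proof (rule holomorphic_second_order_ode_unique[of F r "smult (1/2) (pderiv P)" G])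
    show "F holomorphic_on ball 0 r" "G holomorphic_on ball 0 r"
      using nicely_meromorphic_regular_set(3)[OF nF] nicely_meromorphic_regular_set(3)[OF nG] r
      by (auto simp: A_def intro: holomorphic_on_subset)
    show "deriv (deriv F) z = poly (smult (1 / 2) (pderiv P)) (F z)" if "z \<in> ball 0 r" for z
      using autonomous_solution_second_order[OF F(1), of z] that r by (auto simp: A_def subset_iff mult.commute)
    show "deriv (deriv G) z = poly (smult (1 / 2) (pderiv P)) (G z)" if "z \<in> ball 0 r" for z
      using autonomous_solution_second_order[OF G(1), of z] that r by (auto simp: A_def subset_iff mult.commute)
    show "F 0 = G 0" "deriv F 0 = deriv G 0"
      using assms F(3)[of 0] G(3)[of 0] by (auto simp: F_def G_def)
  qed (use that in auto)
  hence "\<forall>\<^sub>F z in at 0. F z = G z"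
    using r(1) by (intro eventually_at_ball'[THEN eventually_mono]) auto
  from nicely_meromorphic_eqI[OF nF nG _ _ _ this, of z] show ?thesis
    by (simp add: F_def G_def connected_UNIV)
qed

text \<open>If all regular values kept distance \<open>e\<close> from \<open>c\<close>, then 1/(f -
  c), with its removable singularities filled, would be entire and bounded by 1/e, hence constant by
  Liouville.\<close>

lemma nicely_meromorphic_dense_range:
  assumes f: "f nicely_meromorphic_on UNIV" "\<not> f constant_on UNIV" and e: "e > 0"
  obtains z where "\<not> is_pole f z" "dist (f z) c < e"
proof -
  have "\<exists>z. \<not> is_pole f z \<and> dist (f z) c < e"
  proof (rule ccontr)
    assume *: "\<not> ?thesis"
    define h where "h z = inverse (f z - c)" for z
    have mero: "f meromorphic_on UNIV"
      using f by (simp add: nicely_meromorphic_on_def)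
    hence hm: "h meromorphic_on UNIV"
      unfolding h_def[abs_def] by (auto intro!: meromorphic_intros)
    define H where "H = remove_sings h"
    have H: "H nicely_meromorphic_on UNIV"
      unfolding H_def by (rule remove_sings_nicely_meromorphic[OF hm])
    have "\<forall>\<^sub>\<approx>z. \<not> is_pole f z"
      by (rule meromorphic_on_imp_not_pole_cosparse[OF mero])
    hence fin: "\<forall>\<^sub>\<approx>z. H z = inverse (f z - c) \<and> norm (H z) \<le> 1 / e"
      using eventually_remove_sings_eq[OF hm]
    proof eventually_elim
      case (elim z)
      have "norm (f z - c) \<ge> e"
        using * elim(1) by (force simp: dist_norm)
      hence "norm (h z) \<le> 1 / e"
        using e le_imp_inverse_le[of e "norm (f z - c)"] by (simp add: h_def norm_divide inverse_eq_divide)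
      thus ?case using elim by (simp add: H_def h_def)
    qed
    hence ev: "\<forall>\<^sub>F w in at z. H w = inverse (f w - c) \<and> norm (H w) \<le> 1 / e" for z
      by (simp add: eventually_cosparse_open_eq)
    have np: "\<not> is_pole H z" for z
    proof
      assume "is_pole H z"
      hence "\<forall>\<^sub>F w in at z. norm (H w) \<ge> 1 / e + 1"
        unfolding is_pole_def filterlim_at_infinity[OF order_refl] using e
        by (auto dest!: spec[of _ "1 / e + 1"] simp: add_pos_pos)
      with ev[of z] have "\<forall>\<^sub>F w in at z. False"
        by eventually_elim auto
      thus False by simp
    qed
    have lim: "H \<midarrow>z\<rightarrow> H z" for z
      using H np by (auto simp: nicely_meromorphic_on_def)
    have "norm (H z) \<le> 1 / e" for z
    proof (rule tendsto_upperbound[OF tendsto_norm[OF lim]])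
      show "\<forall>\<^sub>F w in at z. norm (H w) \<le> 1 / e"
        using ev[of z] by eventually_elim auto
    qed auto
    moreover have "H holomorphic_on UNIV"
      using nicely_meromorphic_without_singularities[OF H] np by (simp add: analytic_imp_holomorphic)
    moreover from calculation have "bounded (range H)"
      by (auto simp: bounded_iff)
    ultimately obtain k where k: "H z = k" for z
      using Liouville_theorem[of H] by (metis constant_on_def UNIV_I)
    have "\<forall>\<^sub>F z in at 0. f z = c + inverse k"
      using ev[of 0]
    proof eventually_elim
      case (elim z)
      hence "inverse k = f z - c"
        using k[of z] by (metis inverse_inverse_eq)
      thus ?case by simp
    qed
    hence "frequently (\<lambda>z. f z = c + inverse k) (at 0)"
      by (simp add: eventually_frequently)
    from frequently_eq_meromorphic_imp_constant[OF this f(1)] have "f constant_on UNIV"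
      by (auto simp: constant_on_def)
    with f(2) show False ..
  qed
  thus ?thesis
    using that by blast
qed

text \<open>The range of \<open>g\<close> contains a disc by the open mapping theorem and that of
  \<open>f\<close> is dense, so they share a value. There the squares of the derivatives coincide,
  and the two signs give the two alternatives.\<close>

lemma autonomous_solutions_related:
  assumes f: "autonomous_solution P f" and g: "autonomous_solution P g"
  obtains b where "(\<forall>z. f z = g (z + b)) \<or> (\<forall>z. f z = g (- z + b))"
proof -
  have nf: "f nicely_meromorphic_on UNIV" "\<not> f constant_on UNIV"
    and ng: "g nicely_meromorphic_on UNIV" "\<not> g constant_on UNIV"
    using f g by (auto simp: autonomous_solution_def)
  note A = nicely_meromorphic_regular_set[OF ng(1)]
  have "\<not> g constant_on {z. \<not> is_pole g z}"
  proof
    assume "g constant_on {z. \<not> is_pole g z}"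
    then obtain c where c: "\<And>z. \<not> is_pole g z \<Longrightarrow> g z = c"
      by (auto simp: constant_on_def)
    obtain z where z: "\<not> is_pole g z" "deriv g z \<noteq> 0"
      using nonconstant_nicely_meromorphic_deriv_nonzero[OF ng] .
    have "\<forall>\<^sub>F w in nhds z. g w = c"
      using eventually_nhds_in_open[OF A(1), of z] z(1) by (auto elim!: eventually_mono intro: c)
    hence "deriv g z = deriv (\<lambda>_. c) z"
      by (rule deriv_cong_ev) simp
    with z(2) show False by simp
  qed
  hence "open (g ` {z. \<not> is_pole g z})"
    using A by (intro open_mapping_thm[of g "{z. \<not> is_pole g z}" "{z. \<not> is_pole g z}"]) auto
  moreover obtain c where "c \<in> g ` {z. \<not> is_pole g z}"
    using A(4) by auto
  ultimately obtain e where e: "e > 0" "ball c e \<subseteq> g ` {z. \<not> is_pole g z}"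
    using openE by blast
  obtain a where a: "\<not> is_pole f a" "dist (f a) c < e"
    using nicely_meromorphic_dense_range[OF nf e(1)] .
  hence "f a \<in> ball c e"
    by (simp add: dist_commute)
  then obtain d where d: "\<not> is_pole g d" "f a = g d"
    using e(2) by blast
  have "(deriv f a)\<^sup>2 = (deriv g d)\<^sup>2"
    using f g a d by (simp add: autonomous_solution_def)
  hence "deriv f a = deriv g d \<or> deriv f a = - deriv g d"
    by (simp add: power2_eq_iff)
  thus ?thesis
  proof
    assume "deriv f a = deriv g d"
    hence "f (z + a) = g (z + d)" for z
      using a d by (intro autonomous_solution_unique[OF f g])
    from this[of "z - a" for z] have "f z = g (z + (d - a))" for z
      by (simp add: algebra_simps)
    thus ?thesis using that by blast
  next
    assume *: "deriv f a = - deriv g d"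
    define G where "G z = g (- 1 * z + 0)" for z
    have G: "autonomous_solution P G" "is_pole G z \<longleftrightarrow> is_pole g (- z)" 
      "\<not> is_pole g (- z) \<Longrightarrow> deriv G z = - deriv g (- z)" for z
      unfolding G_def[abs_def] using autonomous_solution_affine[OF g, of "- 1" 0]
        autonomous_solution_affine(3)[OF g, of "- 1" z 0] by auto
    have "f (z + a) = G (z + - d)" for z
      using a d G(2)[of "- d"] G(3)[of "- d"] *
      by (intro autonomous_solution_unique[OF f G(1)]) (auto simp: G_def)
    from this[of "z - a" for z] have "f z = g (- z + (d + a))" for z
      by (simp add: algebra_simps G_def)
    thus ?thesis using that by blast
  qed
qed

section \<open>Meromorphic continuation by duplication\<close>

text \<open>Separation of variables: the time T = integral of dx / sqrt(P(x)) has nonzero derivative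
  at \<open>x0\<close>, and the solution is its local inverse.\<close>

lemma local_ode_solution:
  assumes y0: "y0\<^sup>2 = poly P x0" "y0 \<noteq> 0"
  obtains r f where "r > 0" "f holomorphic_on ball 0 r" "f 0 = x0" "deriv f 0 = y0"
    "\<And>z. z \<in> ball 0 r \<Longrightarrow> (deriv f z)\<^sup>2 = poly P (f z)"
proof -
  have P0: "poly P x0 \<noteq> 0"
    using y0 by auto
  \<comment> \<open>Dividing by P(x0) puts the argument of the principal root at 1, away from the
    branch cut, and selects the branch with \<open>q x0 = y0\<close>.\<close>
  define q where "q x = y0 * csqrt (poly P x / poly P x0)" for x
  define S where "S = (\<lambda>x. poly P x / poly P x0) -` (- \<real>\<^sub>\<le>\<^sub>0)"
  have "open S"
    unfolding S_def by (intro open_vimage continuous_intros) (auto simp: P0)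
  moreover have "x0 \<in> S"
    using P0 by (simp add: S_def)
  ultimately obtain \<rho> where \<rho>: "\<rho> > 0" "ball x0 \<rho> \<subseteq> S"
    using openE by blast
  have q: "q holomorphic_on ball x0 \<rho>"
    unfolding q_def using \<rho> P0 by (intro holomorphic_intros) (auto simp: S_def)
  have q2: "(q x)\<^sup>2 = poly P x" for x
    using P0 by (simp add: q_def power_mult_distrib y0)
  have q0: "q x \<noteq> 0" if "x \<in> ball x0 \<rho>" for x
  proof
    assume "q x = 0"
    hence "poly P x = 0"
      using q2[of x] by simp
    with that \<rho> show False
      by (auto simp: S_def)
  qed
  have "(\<lambda>x. inverse (q x)) holomorphic_on ball x0 \<rho>"
    by (intro holomorphic_intros q q0)
  then obtain T0 where T0: "\<And>x. x \<in> ball x0 \<rho> \<Longrightarrow> (T0 has_field_derivative inverse (q x)) (at x within ball x0 \<rho>)"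
    using holomorphic_convex_primitive'[OF convex_ball open_ball] by metis
  define T where "T x = T0 x - T0 x0" for x
  have T: "(T has_field_derivative inverse (q x)) (at x)" if "x \<in> ball x0 \<rho>" for x
    unfolding T_def[abs_def] using T0[OF that] that
    by (auto simp: at_within_open[OF _ open_ball] intro!: derivative_eq_intros)
  have dT: "deriv T x = inverse (q x)" if "x \<in> ball x0 \<rho>" for x
    using T[OF that] by (rule DERIV_imp_deriv)
  have holT: "T holomorphic_on ball x0 \<rho>"
    unfolding holomorphic_on_open[OF open_ball] using T by blast
  obtain s where s: "s > 0" "ball x0 s \<subseteq> ball x0 \<rho>" "inj_on T (ball x0 s)"
    using has_complex_derivative_locally_injective[OF holT, of x0] \<rho> dT[of x0] q0[of x0] by auto
  have holT': "T holomorphic_on ball x0 s"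
    using holT s(2) by (rule holomorphic_on_subset)
  obtain f where f: "f holomorphic_on T ` ball x0 s"
    "\<And>x. x \<in> ball x0 s \<Longrightarrow> deriv T x * deriv f (T x) = 1"
    "\<And>x. x \<in> ball x0 s \<Longrightarrow> f (T x) = x"
    using holomorphic_has_inverse[OF holT' open_ball s(3)] by blast
  have "open (T ` ball x0 s)"
    by (rule open_mapping_thm3[OF holT' open_ball s(3)])
  moreover have x0s: "x0 \<in> ball x0 s"
    using s by simp
  moreover from this have "T x0 \<in> T ` ball x0 s"
    by blast
  moreover have Tx0: "T x0 = 0"
    by (simp add: T_def)
  ultimately obtain r where r: "r > 0" "ball 0 r \<subseteq> T ` ball x0 s"
    using openE by metis
  have df: "deriv f (T x) = q x" if "x \<in> ball x0 s" for x
  proof -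
    have x: "x \<in> ball x0 \<rho>" using that s(2) by blast
    show ?thesis
      using f(2)[OF that] q0[OF x] by (simp add: dT[OF x] field_simps)
  qed
  show ?thesis
  proof (rule that[OF r(1)])
    show "f holomorphic_on ball 0 r"
      using f(1) r(2) by (rule holomorphic_on_subset)
    show "f 0 = x0"
      using f(3)[OF x0s] Tx0 by simp
    show "deriv f 0 = y0"
      using df[OF x0s] Tx0 P0 by (simp add: q_def)
    show "(deriv f z)\<^sup>2 = poly P (f z)" if z: "z \<in> ball 0 r" for z
    proof -
      obtain x where x: "x \<in> ball x0 s" "z = T x"
        using z r by blast
      show ?thesis
        using df[OF x(1)] f(3)[OF x(1)] q2[of x] by (simp add: x(2))
    qed
  qed
qed

lemma meromorphic_on_poly:
  assumes "f meromorphic_on A"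
  shows "(\<lambda>z. poly P (f z)) meromorphic_on A"
  unfolding poly_altdef by (intro meromorphic_intros assms)

text \<open>The defect f'^2 - P(f) is meromorphic on the plane, so its vanishing near one point
  spreads everywhere. Explicit candidates thus need checking only where all denominators are
  nonzero.\<close>

lemma autonomous_solutionI:
  assumes f: "f nicely_meromorphic_on UNIV" "\<not> f constant_on UNIV"
    and ev: "\<forall>\<^sub>F z in at z0. (deriv f z)\<^sup>2 = poly P (f z)"
  shows "autonomous_solution P f"
  unfolding autonomous_solution_def
proof (intro conjI allI impI f)
  fix z assume z: "\<not> is_pole f z"
  define h where "h z = (deriv f z)\<^sup>2 - poly P (f z)" for z
  have "h meromorphic_on UNIV"
    unfolding h_def using f
    by (intro meromorphic_intros meromorphic_on_poly) (auto simp: nicely_meromorphic_on_def)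
  from meromorphic_imp_constant_or_avoid[OF this open_UNIV connected_UNIV, of 0]
  have "\<forall>\<^sub>\<approx>z. h z = 0"
  proof
    assume "\<forall>\<^sub>\<approx>z. h z \<noteq> 0"
    hence "\<forall>\<^sub>F z in at z0. h z \<noteq> 0"
      by (simp add: eventually_cosparse_open_eq)
    with ev have "\<forall>\<^sub>F z in at z0. False"
      by eventually_elim (simp add: h_def)
    thus ?thesis by simp
  qed
  hence ev0: "\<forall>\<^sub>F w in at z. h w = 0"
    by (simp add: eventually_cosparse_open_eq)
  have "f analytic_on {z}"
    using nicely_meromorphic_on_imp_analytic_at[OF f(1) UNIV_I z] .
  hence "h analytic_on {z}"
    unfolding h_def poly_altdef by (intro analytic_intros)
  hence "h \<midarrow>z\<rightarrow> h z"
    by (intro isContD analytic_at_imp_isCont)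
  moreover have "h \<midarrow>z\<rightarrow> 0"
    using ev0 by (rule tendsto_eventually)
  ultimately have "h z = 0"
    using LIM_unique by blast
  thus "(deriv f z)\<^sup>2 = poly P (f z)"
    by (simp add: h_def)
qed

lemma eventually_at_deriv_cong:
  assumes "\<forall>\<^sub>F z in at a. f z = g z"
  shows "\<forall>\<^sub>F z in at a. deriv f z = deriv g z"
proof -
  from assms obtain S where S: "open S" "a \<in> S" "\<And>z. z \<in> S - {a} \<Longrightarrow> f z = g z"
    by (auto simp: eventually_at_topological)
  have "\<forall>\<^sub>F z in at a. z \<in> S - {a}"
    using S by (intro eventually_at_in_open) auto
  thus ?thesis
  proof eventually_elim
    case (elim z)
    have "\<forall>\<^sub>F w in nhds z. w \<in> S - {a}"
      using S(1) elim by (intro eventually_nhds_in_open) auto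
    hence "\<forall>\<^sub>F w in nhds z. f w = g w"
      by eventually_elim (rule S(3))
    thus ?case
      by (rule deriv_cong_ev) simp
  qed
qed

text \<open>Expressions in a known solution take arbitrary values where their denominators vanish;
  filling the singularities makes them nice. The nonvanishing derivative certifies that the result
  is not constant.\<close>

lemma autonomous_solution_remove_sings:
  assumes f: "f meromorphic_on UNIV"
    and ev: "\<forall>\<^sub>F z in at z0. deriv f z \<noteq> 0 \<and> (deriv f z)\<^sup>2 = poly P (f z)"
  shows "autonomous_solution P (remove_sings f)"
proof (rule autonomous_solutionI)
  show "remove_sings f nicely_meromorphic_on UNIV"
    by (rule remove_sings_nicely_meromorphic[OF f(1)])
  have False if c: "\<forall>\<^sub>\<approx>z. f z = c" for c
  proof -
    from c have "\<forall>\<^sub>F z in at z0. f z = c"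
      by (simp add: eventually_cosparse_open_eq)
    from eventually_at_deriv_cong[OF this] ev have "\<forall>\<^sub>F z in at z0. False"
      by eventually_elim simp
    thus False by simp
  qed
  thus "\<not> remove_sings f constant_on UNIV"
    using f by (auto simp: remove_sings_constant_on_open_iff)
  have "\<forall>\<^sub>F z in at z0. f analytic_on {z}"
    using meromorphic_on_imp_analytic_cosparse[OF f(1)] by (simp add: eventually_cosparse_open_eq)
  with ev show "\<forall>\<^sub>F z in at z0. (deriv (remove_sings f) z)\<^sup>2 = poly P (remove_sings f z)"
    by eventually_elim simp
qed

section \<open>Legendre normal form and its solution sn\<close>

definition legendre_quartic :: "complex \<Rightarrow> complex poly" where
  "legendre_quartic m = [:1, 0, - (1 + m), 0, m:]"

lemma poly_legendre_quartic: "poly (legendre_quartic m) s = (1 - s\<^sup>2) * (1 - m * s\<^sup>2)"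
  by (simp add: legendre_quartic_def power2_eq_square algebra_simps)

lemma poly_pderiv_legendre_quartic:
  "poly (pderiv (legendre_quartic m)) s = - 2 * (1 + m) * s + 4 * m * s ^ 3"
  by (simp add: legendre_quartic_def pderiv_pCons power3_eq_cube algebra_simps)

text \<open>With s = sn and y = s' = cn dn, \<open>g\<close> is Jacobi's formula for sn(2z), and
  \<open>g'\<close> is its time derivative after inserting s'' = -(1+m)s + 2ms^3. The identity holds
  because 1 - g^2 and 1 - m g^2 are both squares, those of cn(2z) and dn(2z), and \<open>g'\<close>
  is twice the product of these two.\<close>

lemma legendre_duplication_identities:
  fixes s y m :: complex
  assumes y: "y\<^sup>2 = (1 - s\<^sup>2) * (1 - m * s\<^sup>2)" and N: "1 - m * s ^ 4 \<noteq> 0"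
  defines "g \<equiv> 2 * s * y / (1 - m * s ^ 4)"
    and "g' \<equiv> ((2 * y * y + 2 * s * (- (1 + m) * s + 2 * m * s ^ 3)) * (1 - m * s ^ 4) + 2 * s * y * (4 * m * s ^ 3 * y)) / (1 - m * s ^ 4)\<^sup>2"
  shows "g'\<^sup>2 = 4 * ((1 - g\<^sup>2) * (1 - m * g\<^sup>2))"
proof -
  define D where "D = 1 - m * s ^ 4"
  have D: "D \<noteq> 0" using N by (simp add: D_def)
  have g2: "g\<^sup>2 = 4 * s\<^sup>2 * ((1 - s\<^sup>2) * (1 - m * s\<^sup>2)) / D\<^sup>2"
    unfolding g_def y[symmetric] D_def by (simp add: power_mult_distrib power_divide)
  have 1: "1 - g\<^sup>2 = (1 - 2 * s\<^sup>2 + m * s ^ 4)\<^sup>2 / D\<^sup>2"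
    unfolding g2 using D by (simp add: divide_simps) (simp add: D_def power2_eq_square power4_eq_xxxx algebra_simps)
  have 2: "1 - m * g\<^sup>2 = (1 - 2 * m * s\<^sup>2 + m * s ^ 4)\<^sup>2 / D\<^sup>2"
    unfolding g2 using D by (simp add: divide_simps) (simp add: D_def power2_eq_square power4_eq_xxxx algebra_simps)
  have "(2 * y * y + 2 * s * (- (1 + m) * s + 2 * m * s ^ 3)) * D + 2 * s * y * (4 * m * s ^ 3 * y) =
      (2 * y\<^sup>2 + 2 * s * (- (1 + m) * s + 2 * m * s ^ 3)) * D + 8 * m * s ^ 4 * y\<^sup>2"
    by (simp add: power2_eq_square power4_eq_xxxx power3_eq_cube algebra_simps)
  also have "\<dots> = 2 * ((1 - 2 * s\<^sup>2 + m * s ^ 4) * (1 - 2 * m * s\<^sup>2 + m * s ^ 4))"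
    unfolding y D_def by (simp add: power2_eq_square power4_eq_xxxx power3_eq_cube algebra_simps)
  finally have "g' = 2 * ((1 - 2 * s\<^sup>2 + m * s ^ 4) * (1 - 2 * m * s\<^sup>2 + m * s ^ 4)) / D\<^sup>2"
    by (simp add: g'_def D_def)
  thus ?thesis
    unfolding 1 2 by (simp add: power_mult_distrib power_divide)
qed

text \<open>Both sides solve h'^2 = 4 P(h) with h(0) = 0 and h'(0) = 2. Since h'(0) is nonzero they
  obey the same second-order equation and coincide.\<close>

lemma legendre_duplication_local:
  assumes r: "r > 0" and f: "f holomorphic_on ball 0 r" "f 0 = 0" "deriv f 0 = 1"
    and ode: "\<And>z. z \<in> ball 0 r \<Longrightarrow> (deriv f z)\<^sup>2 = poly (legendre_quartic m) (f z)"
  shows "\<forall>\<^sub>F z in at 0. 2 * f z * deriv f z / (1 - m * f z ^ 4) = f (2 * z)"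
proof -
  have "isCont f 0"
    using holomorphic_on_imp_continuous_on[OF f(1)] r
    by (simp add: continuous_on_eq_continuous_at)
  hence "((\<lambda>z. 1 - m * f z ^ 4) \<longlongrightarrow> 1 - m * f 0 ^ 4) (nhds 0)"
    by (intro tendsto_intros) (simp add: isCont_def tendsto_at_iff_tendsto_nhds)
  hence "\<forall>\<^sub>F z in nhds 0. 1 - m * f z ^ 4 \<noteq> 0"
    by (rule tendsto_imp_eventually_ne) (simp add: f)
  then obtain d where d: "d > 0" "\<And>z. z \<in> ball 0 d \<Longrightarrow> 1 - m * f z ^ 4 \<noteq> 0"
    by (auto simp: eventually_nhds_metric dist_commute)
  \<comment> \<open>Below \<open>d\<close> the denominator does not vanish; r/2 keeps
    \<open>2 * z\<close> inside the domain of \<open>f\<close>.\<close>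
  define \<rho> where "\<rho> = min d (r / 2)"
  have \<rho>: "\<rho> > 0" "ball 0 \<rho> \<subseteq> ball 0 r" "ball 0 \<rho> \<subseteq> ball 0 d"
    using d r by (auto simp: \<rho>_def)
  have dbl: "2 * z \<in> ball 0 r" if "z \<in> ball 0 \<rho>" for z :: complex
    using that by (simp add: \<rho>_def norm_mult)
  define G where "G z = 2 * f z * deriv f z / (1 - m * f z ^ 4)" for z
  define H where "H z = f (2 * z)" for z
  have f': "deriv f holomorphic_on ball 0 r"
    using f(1) by (intro holomorphic_deriv) auto
  have G: "G holomorphic_on ball 0 \<rho>"
    unfolding G_def using d(2) \<rho>
    by (intro holomorphic_intros holomorphic_on_subset[OF f(1)] holomorphic_on_subset[OF f']) blast+
  have H: "H holomorphic_on ball 0 \<rho>"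
    unfolding H_def
    by (rule holomorphic_on_compose_gen[of "\<lambda>z. 2 * z" "ball 0 \<rho>" f "ball 0 r", unfolded o_def])
       (use f(1) dbl in \<open>auto intro!: holomorphic_intros\<close>)
  have f'': "deriv (deriv f) z = - (1 + m) * f z + 2 * m * f z ^ 3" if "z \<in> ball 0 r" for z
  proof -
    have "2 * deriv (deriv f) z = 2 * (- (1 + m) * f z + 2 * m * f z ^ 3)"
      using second_order_from_first_order[OF f(1) open_ball connected_ball ode, of 0 z] r f(3) that
      by (simp add: poly_pderiv_legendre_quartic algebra_simps)
    thus ?thesis by (subst (asm) mult_cancel_left) simp
  qed
  define DG where "DG z = ((2 * deriv f z * deriv f z + 2 * f z * (- (1 + m) * f z + 2 * m * f z ^ 3)) * (1 - m * f z ^ 4) + 2 * f z * deriv f z * (4 * m * f z ^ 3 * deriv f z)) / (1 - m * f z ^ 4)\<^sup>2" for z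
  have dG: "deriv G z = DG z" if z: "z \<in> ball 0 \<rho>" for z
  proof (rule DERIV_imp_deriv)
    have zr: "z \<in> ball 0 r" using z \<rho> by blast
    have D: "(f has_field_derivative deriv f z) (at z)"
      using holomorphic_derivI[OF f(1) open_ball zr] .
    have D': "(deriv f has_field_derivative (- (1 + m) * f z + 2 * m * f z ^ 3)) (at z)"
      using holomorphic_derivI[OF f' open_ball zr] f''[OF zr] by simp
    have N: "1 - m * f z ^ 4 \<noteq> 0"
      using d(2) z \<rho> by blast
    show "(G has_field_derivative DG z) (at z)"
      unfolding G_def[abs_def] DG_def
      by (rule derivative_eq_intros D D' N refl)+ (simp add: power2_eq_square algebra_simps)
  qed
  have dH: "deriv H z = 2 * deriv f (2 * z)" if z: "z \<in> ball 0 \<rho>" for z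
  proof (rule DERIV_imp_deriv)
    have "((\<lambda>z. f (2 * z)) has_field_derivative deriv f (2 * z) * 2) (at z)"
      by (rule DERIV_chain2[where f = f and g = "\<lambda>z. 2 * z"])
         (use holomorphic_derivI[OF f(1) open_ball dbl[OF z]] in \<open>auto intro!: derivative_eq_intros\<close>)
    thus "(H has_field_derivative 2 * deriv f (2 * z)) (at z)"
      by (simp add: H_def[abs_def] mult.commute)
  qed
  have odeG: "(deriv G z)\<^sup>2 = poly (smult 4 (legendre_quartic m)) (G z)" if z: "z \<in> ball 0 \<rho>" for z
    unfolding dG[OF z] G_def DG_def poly_smult poly_legendre_quartic
  proof (rule legendre_duplication_identities)
    show "(deriv f z)\<^sup>2 = (1 - (f z)\<^sup>2) * (1 - m * (f z)\<^sup>2)"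
      using ode[OF subsetD[OF \<rho>(2) z]] by (simp add: poly_legendre_quartic)
    show "1 - m * f z ^ 4 \<noteq> 0"
      using d(2)[of z] z \<rho>(3) by blast
  qed
  have odeH: "(deriv H z)\<^sup>2 = poly (smult 4 (legendre_quartic m)) (H z)" if z: "z \<in> ball 0 \<rho>" for z
    using ode[OF dbl[OF z]] by (simp add: dH[OF z] H_def power_mult_distrib)
  have 0: "0 \<in> ball 0 \<rho>" using \<rho> by simp
  have dG0: "deriv G 0 = 2" and dH0: "deriv H 0 = 2"
    using dG[OF 0] dH[OF 0] by (auto simp: DG_def f)
  have "G z = H z" if z: "z \<in> ball 0 \<rho>" for z
  proof (rule holomorphic_second_order_ode_unique[of G \<rho> "smult (1/2) (pderiv (smult 4 (legendre_quartic m)))" H])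
    show "deriv (deriv G) w = poly (smult (1/2) (pderiv (smult 4 (legendre_quartic m)))) (G w)" if "w \<in> ball 0 \<rho>" for w
      using second_order_from_first_order[OF G open_ball connected_ball odeG 0 _ that] dG0
      by (simp add: mult.commute)
    show "deriv (deriv H) w = poly (smult (1/2) (pderiv (smult 4 (legendre_quartic m)))) (H w)" if "w \<in> ball 0 \<rho>" for w
      using second_order_from_first_order[OF H open_ball connected_ball odeH 0 _ that] dH0
      by (simp add: mult.commute)
  qed (use G H z dG0 dH0 f in \<open>auto simp: G_def H_def\<close>)
  moreover have "\<forall>\<^sub>F z in at 0. z \<in> ball 0 \<rho>"
    using \<rho> by (intro eventually_at_in_open') auto
  ultimately show ?thesis
    by (auto simp: G_def H_def elim!: eventually_mono)
qed


lemma nicely_meromorphic_on_UNIV_local: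
  assumes "\<And>z. \<exists>S g. open S \<and> z \<in> S \<and> g nicely_meromorphic_on S \<and> (\<forall>w\<in>S. f w = g w)"
  shows "f nicely_meromorphic_on UNIV"
proof -
  have "f meromorphic_on {z} \<and> ((is_pole f z \<and> f z = 0) \<or> f \<midarrow>z\<rightarrow> f z)" for z
  proof -
    obtain S g where S: "open S" "z \<in> S" "g nicely_meromorphic_on S" "\<And>w. w \<in> S \<Longrightarrow> f w = g w"
      using assms[of z] by blast
    have ev: "\<forall>\<^sub>F w in at z. f w = g w"
      using eventually_at_in_open'[OF S(1,2)] by eventually_elim (rule S(4))
    have "g meromorphic_on {z}" "(is_pole g z \<and> g z = 0) \<or> g \<midarrow>z\<rightarrow> g z"
      using S(2,3) by (auto simp: nicely_meromorphic_on_def intro: meromorphic_on_subset)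
    moreover have "f meromorphic_on {z} \<longleftrightarrow> g meromorphic_on {z}"
      by (rule meromorphic_on_cong) (use ev in auto)
    moreover have "is_pole f z \<longleftrightarrow> is_pole g z"
      by (rule is_pole_cong[OF ev refl])
    moreover have "f \<midarrow>z\<rightarrow> f z \<longleftrightarrow> g \<midarrow>z\<rightarrow> g z"
      using tendsto_cong[OF ev] S by simp
    ultimately show ?thesis
      using S by simp
  qed
  thus ?thesis
    unfolding nicely_meromorphic_on_def by (subst meromorphic_on_meromorphic_at) blast
qed

text \<open>The duplication formula doubles the radius of a disc on which a meromorphic continuation of
  the local solution exists.\<close>

lemma legendre_solution_exists:
  obtains s where "autonomous_solution (legendre_quartic m) s" "\<not> is_pole s 0" "s 0 = 0" "deriv s 0 = 1"
proof -
  define P where "P = legendre_quartic m"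
  obtain r f where r: "r > 0" and f: "f holomorphic_on ball 0 r" "f 0 = 0" "deriv f 0 = 1"
    and ode: "\<And>z. z \<in> ball 0 r \<Longrightarrow> (deriv f z)\<^sup>2 = poly P (f z)"
    using local_ode_solution[of 1 P 0] by (auto simp: P_def poly_legendre_quartic)
  have half: "filterlim (\<lambda>z::complex. z / 2) (at 0) (at 0)"
    by (rule filterlim_atI) (auto intro!: tendsto_eq_intros simp: eventually_at_filter)
  have dup: "\<forall>\<^sub>F z in at 0. 2 * f (z / 2) * deriv f (z / 2) / (1 - m * f (z / 2) ^ 4) = f z"
    using eventually_compose_filterlim[OF legendre_duplication_local[OF r f ode[unfolded P_def]] half]
    by simp
  \<comment> \<open>An extension is only required to have the germ of \<open>f\<close> at 0. The
    differential equation is not carried along the induction but recovered at the end from that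
    germ.\<close>
  define ext where "ext R g \<longleftrightarrow> g nicely_meromorphic_on ball 0 R \<and> (\<forall>\<^sub>F z in at 0. g z = f z)" for R g
  have ext0: "ext r f"
    unfolding ext_def using f(1)
    by (auto intro!: analytic_on_imp_nicely_meromorphic_on simp: analytic_on_open)
  have double: "\<exists>h. ext (2 * R) h" if g: "ext R g" and R: "R > 0" for R g
  proof -
    \<comment> \<open>The formula at z uses \<open>g\<close> and its derivative only at z/2, so
      radius R yields radius 2R. Zeros of the denominator may create poles, which is why the
      continuation is meromorphic.\<close>
    define h0 where "h0 z = 2 * g (z / 2) * deriv g (z / 2) / (1 - m * g (z / 2) ^ 4)" for z
    have gm: "g meromorphic_on ball 0 R" and ge: "\<forall>\<^sub>F z in at 0. g z = f z"
      using g by (auto simp: ext_def nicely_meromorphic_on_def)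
    have m1: "(\<lambda>z. u (z / 2)) meromorphic_on ball 0 (2 * R)" if "u meromorphic_on ball 0 R" for u
      by (rule meromorphic_on_compose[OF that]) (auto intro!: analytic_intros simp: norm_divide)
    have h0: "h0 meromorphic_on ball 0 (2 * R)"
      unfolding h0_def by (intro meromorphic_intros m1 gm)
    have e1: "\<forall>\<^sub>F z in at 0. g (z / 2) = f (z / 2)"
      by (rule eventually_compose_filterlim[OF ge half])
    have e2: "\<forall>\<^sub>F z in at 0. deriv g (z / 2) = deriv f (z / 2)"
      by (rule eventually_compose_filterlim[OF eventually_at_deriv_cong[OF ge] half])
    have "ext (2 * R) (remove_sings h0)"
    proof -
      have "\<forall>\<^sub>F z in at 0. remove_sings h0 z = h0 z"
        using eventually_cosparse_imp_eventually_at[OF eventually_remove_sings_eq[OF h0], of 0] R by simp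
      with dup e1 e2 have "\<forall>\<^sub>F z in at 0. remove_sings h0 z = f z"
        by eventually_elim (simp add: h0_def)
      thus ?thesis
        using remove_sings_nicely_meromorphic[OF h0] by (simp add: ext_def)
    qed
    thus ?thesis by blast
  qed
  have "\<exists>g. ext (r * 2 ^ n) g" for n
  proof (induction n)
    case 0
    thus ?case using ext0 by auto
  next
    case (Suc n)
    then obtain g where "ext (r * 2 ^ n) g" by blast
    from double[OF this] r show ?case by (simp add: mult_ac)
  qed
  then obtain G where G: "\<And>n. ext (r * 2 ^ n) (G n)"
    by metis
  have agree: "G n z = G k z" if "norm z < r * 2 ^ n" "norm z < r * 2 ^ k" for n k z
  proof -
    define R where "R = min (r * 2 ^ n) (r * 2 ^ k)"
    have "\<forall>\<^sub>F z in at 0. G n z = G k z"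
      using G[of n] G[of k] by (auto simp: ext_def elim: eventually_elim2)
    moreover have "G n nicely_meromorphic_on ball 0 R" "G k nicely_meromorphic_on ball 0 R"
      using G[of n] G[of k] by (auto simp: ext_def R_def intro: nicely_meromorphic_on_subset)
    moreover have "R > 0"
      using r by (simp add: R_def)
    ultimately show ?thesis
      using nicely_meromorphic_eqI[of "G n" "ball 0 R" "G k" 0 z] that by (simp add: R_def)
  qed
  have big: "\<exists>n. norm z < r * 2 ^ n" for z :: complex
  proof -
    obtain n where "norm z / r < 2 ^ n"
      using real_arch_pow[of 2 "norm z / r"] by auto
    thus ?thesis using r by (auto simp: field_simps)
  qed
  \<comment> \<open>The choice of the index is immaterial by \<open>agree\<close>.\<close>
  define s where "s z = G (SOME n. norm z < r * 2 ^ n) z" for z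
  have s: "s z = G n z" if "norm z < r * 2 ^ n" for n z
    unfolding s_def by (rule agree[OF _ that]) (rule someI[of _ n], rule that)
  have nice: "s nicely_meromorphic_on UNIV"
  proof (rule nicely_meromorphic_on_UNIV_local)
    fix z :: complex
    obtain n where n: "norm z < r * 2 ^ n"
      using big by blast
    show "\<exists>S g. open S \<and> z \<in> S \<and> g nicely_meromorphic_on S \<and> (\<forall>w\<in>S. s w = g w)"
      by (rule exI[of _ "ball 0 (r * 2 ^ n)"], rule exI[of _ "G n"])
         (use n s G[of n] in \<open>auto simp: ext_def\<close>)
  qed
  have sf: "s z = f z" if "z \<in> ball 0 r" for z
  proof -
    have "s z = G 0 z"
      using s[of z 0] that by simp
    also have "\<dots> = f z"
      by (rule nicely_meromorphic_eqI[of "G 0" "ball 0 r" f 0])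
         (use G[of 0] ext0 that r in \<open>auto simp: ext_def\<close>)
    finally show ?thesis .
  qed
  have ds: "deriv s z = deriv f z" if "z \<in> ball 0 r" for z
  proof (rule deriv_cong_ev)
    have "\<forall>\<^sub>F w in nhds z. w \<in> ball 0 r"
      using that by (intro eventually_nhds_in_open) auto
    thus "\<forall>\<^sub>F w in nhds z. s w = f w"
      by eventually_elim (rule sf)
  qed simp
  have r0: "0 \<in> ball 0 r" using r by simp
  have "f analytic_on {0}"
    using f(1) r0 by (meson holomorphic_on_imp_analytic_at open_ball)
  hence "\<not> is_pole f 0"
    by (rule analytic_at_imp_no_pole)
  moreover have "is_pole s 0 \<longleftrightarrow> is_pole f 0"
    using eventually_at_in_open'[OF open_ball r0] by (intro is_pole_cong) (auto elim!: eventually_mono simp: sf)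
  ultimately have np: "\<not> is_pole s 0" by blast
  have s0: "s 0 = 0" "deriv s 0 = 1"
    using sf[OF r0] ds[OF r0] f by auto
  have nc: "\<not> s constant_on UNIV"
  proof
    assume "s constant_on UNIV"
    then obtain c where "s = (\<lambda>_. c)"
      by (auto simp: constant_on_def)
    with s0 show False by simp
  qed
  have "autonomous_solution P s"
  proof (rule autonomous_solutionI[OF nice nc, of _ 0])
    have "\<forall>\<^sub>F z in at 0. z \<in> ball 0 r"
      using r by (intro eventually_at_in_open') auto
    thus "\<forall>\<^sub>F z in at 0. (deriv s z)\<^sup>2 = poly P (s z)"
      by eventually_elim (simp only: ds sf ode)
  qed
  with np s0 show ?thesis
    using that by (simp add: P_def)
qed

lemma autonomous_solution_eventually_regular:
  assumes s: "autonomous_solution P s"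
  shows "\<forall>\<^sub>F z in at z0. s analytic_on {z}"
  using s meromorphic_on_imp_analytic_cosparse[of s UNIV]
  by (simp add: autonomous_solution_def nicely_meromorphic_on_def eventually_cosparse_open_eq)

lemma autonomous_solution_avoids:
  assumes s: "autonomous_solution P s"
  shows "\<forall>\<^sub>F z in at z0. s z \<noteq> c"
proof -
  have "s nicely_meromorphic_on UNIV" "\<not> s constant_on UNIV"
    using s by (auto simp: autonomous_solution_def)
  with nicely_meromorphic_imp_constant_or_avoid[of s UNIV c] show ?thesis
    by (auto simp: eventually_cosparse_open_eq constant_on_def connected_UNIV)
qed

text \<open>A polynomial has finitely many roots and each value is avoided near \<open>z0\<close>.
  With \<open>q\<close> the product of all relevant factors, one application makes every denominator
  nonzero at once.\<close>

lemma autonomous_solution_avoids_roots: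
  assumes s: "autonomous_solution P s" and q: "q \<noteq> 0"
  shows "\<forall>\<^sub>F z in at z0. poly q (s z) \<noteq> 0"
proof -
  have "\<forall>\<^sub>F z in at z0. \<forall>c\<in>{c. poly q c = 0}. s z \<noteq> c"
    using poly_roots_finite[OF q] autonomous_solution_avoids[OF s]
    by (intro eventually_ball_finite) auto
  thus ?thesis
    by eventually_elim auto
qed

lemma autonomous_solution_derivs:
  assumes s: "autonomous_solution P s" and z: "s analytic_on {z}"
  shows "(s has_field_derivative deriv s z) (at z)"
    "(deriv s has_field_derivative poly (pderiv P) (s z) / 2) (at z)"
    "(deriv s z)\<^sup>2 = poly P (s z)"
proof -
  have np: "\<not> is_pole s z"
    using z by (rule analytic_at_imp_no_pole)
  show "(s has_field_derivative deriv s z) (at z)"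
    using analytic_on_imp_differentiable_at[OF z, of z] by (simp add: field_differentiable_derivI)
  have "(deriv s has_field_derivative deriv (deriv s) z) (at z)"
    using analytic_on_imp_differentiable_at[OF analytic_deriv[OF z], of z]
    by (simp add: field_differentiable_derivI)
  moreover have "deriv (deriv s) z = poly (pderiv P) (s z) / 2"
    using autonomous_solution_second_order[OF s np] by (simp add: field_simps)
  ultimately show "(deriv s has_field_derivative poly (pderiv P) (s z) / 2) (at z)"
    by simp
  show "(deriv s z)\<^sup>2 = poly P (s z)"
    using s np by (simp add: autonomous_solution_def)
qed

text \<open>The solution equal to \<open>1\<close> at the origin (\<open>cd\<close> in Jacobi's notation) is \<open>s' / (1 - m s\<^sup>2)\<close>.\<close>

lemma legendre_solution_attains_one:
  assumes s: "autonomous_solution (legendre_quartic m) s" "\<not> is_pole s 0" "s 0 = 0" "deriv s 0 = 1"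
    and m: "m \<noteq> 1"
  obtains b where "\<not> is_pole s b" "s b = 1"
proof -
  \<comment> \<open>In Jacobi's notation s' = cn dn and 1 - m s^2 = dn^2, so the quotient is
    cn/dn.\<close>
  define C0 where "C0 z = deriv s z / (1 - m * (s z)\<^sup>2)" for z
  have sm: "s meromorphic_on UNIV" and sn: "s nicely_meromorphic_on UNIV"
    using s by (auto simp: autonomous_solution_def nicely_meromorphic_on_def)
  have C0m: "C0 meromorphic_on UNIV"
    unfolding C0_def by (intro meromorphic_intros sm)
  have an0: "s analytic_on {0}"
    using nicely_meromorphic_on_imp_analytic_at[OF sn UNIV_I s(2)] .
  have "[:0, 1:] * legendre_quartic m \<noteq> 0"
    by (simp add: legendre_quartic_def)
  from autonomous_solution_avoids_roots[OF s(1) this, of 0]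
  have "\<forall>\<^sub>F z in at 0. s z \<noteq> 0 \<and> 1 - (s z)\<^sup>2 \<noteq> 0 \<and> 1 - m * (s z)\<^sup>2 \<noteq> 0"
    by (simp add: poly_legendre_quartic)
  with autonomous_solution_eventually_regular[OF s(1), of 0]
  have ev: "\<forall>\<^sub>F z in at 0. deriv C0 z \<noteq> 0 \<and> (deriv C0 z)\<^sup>2 = poly (legendre_quartic m) (C0 z)"
  proof eventually_elim
    case (elim z)
    note D = autonomous_solution_derivs[OF s(1) elim(1)]
    define S Y where "S = s z" and "Y = deriv s z"
    have Y2: "Y\<^sup>2 = (1 - S\<^sup>2) * (1 - m * S\<^sup>2)"
      using D(3) by (simp add: Y_def S_def poly_legendre_quartic)
    have N: "1 - m * S\<^sup>2 \<noteq> 0" and S0: "S \<noteq> 0"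
      using elim by (auto simp: S_def)
    have "(C0 has_field_derivative (poly (pderiv (legendre_quartic m)) (s z) / 2 * (1 - m * (s z)\<^sup>2) -
        deriv s z * (- (m * (2 * s z * deriv s z)))) / (1 - m * (s z)\<^sup>2)\<^sup>2) (at z)"
      unfolding C0_def[abs_def] using N[unfolded S_def]
      by (auto intro!: derivative_eq_intros D(1) D(2) simp: power2_eq_square)
    hence "deriv C0 z = (poly (pderiv (legendre_quartic m)) S / 2 * (1 - m * S\<^sup>2) - Y * (- (m * (2 * S * Y)))) / (1 - m * S\<^sup>2)\<^sup>2"
      unfolding S_def Y_def by (rule DERIV_imp_deriv)
    also have "poly (pderiv (legendre_quartic m)) S / 2 = - (1 + m) * S + 2 * m * S ^ 3"
      by (simp add: poly_pderiv_legendre_quartic field_simps)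
    also have "(- (1 + m) * S + 2 * m * S ^ 3) * (1 - m * S\<^sup>2) - Y * (- (m * (2 * S * Y))) =
        (- (1 + m) * S + 2 * m * S ^ 3) * (1 - m * S\<^sup>2) + 2 * m * S * Y\<^sup>2"
      by (simp add: power2_eq_square algebra_simps)
    also have "(- (1 + m) * S + 2 * m * S ^ 3) * (1 - m * S\<^sup>2) + 2 * m * S * Y\<^sup>2 = (- (1 - m) * S) * (1 - m * S\<^sup>2)"
      unfolding Y2 by (simp add: power2_eq_square power3_eq_cube algebra_simps)
    also have "(- (1 - m) * S) * (1 - m * S\<^sup>2) / (1 - m * S\<^sup>2)\<^sup>2 = - (1 - m) * S / (1 - m * S\<^sup>2)"
      using N by (simp add: power2_eq_square)
    finally have dC: "deriv C0 z = - (1 - m) * S / (1 - m * S\<^sup>2)" .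
    have C2: "(C0 z)\<^sup>2 = (1 - S\<^sup>2) / (1 - m * S\<^sup>2)"
      using N by (simp add: C0_def S_def[symmetric] Y_def[symmetric] power_divide Y2) (simp add: power2_eq_square)
    have 1: "1 - (C0 z)\<^sup>2 = (1 - m) * S\<^sup>2 / (1 - m * S\<^sup>2)" and 2: "1 - m * (C0 z)\<^sup>2 = (1 - m) / (1 - m * S\<^sup>2)"
      unfolding C2 using N by (simp_all add: divide_simps) (simp_all add: algebra_simps)
    have "(deriv C0 z)\<^sup>2 = poly (legendre_quartic m) (C0 z)"
      unfolding poly_legendre_quartic 1 2 dC
      by (simp add: power_mult_distrib power_divide power2_eq_square) (simp add: algebra_simps)
    \<comment> \<open>This is where \<open>m \<noteq> 1\<close> enters: for m = 1 the solution is
      tanh and \<open>C0\<close> is the constant 1.\<close>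
    moreover have "deriv C0 z \<noteq> 0"
      unfolding dC using m S0 N by simp
    ultimately show ?case by blast
  qed
  define C where "C = remove_sings C0"
  have C: "autonomous_solution (legendre_quartic m) C"
    unfolding C_def by (rule autonomous_solution_remove_sings[OF C0m ev])
  have "C0 analytic_on {0}"
    unfolding C0_def using s by (intro analytic_intros an0 analytic_deriv) auto
  hence C0: "C 0 = 1"
    using s by (simp add: C_def C0_def)
  \<comment> \<open>A nice function is 0 at its poles, so a point with value 1 is automatically
    regular.\<close>
  have pole: "s z \<noteq> 1" if "is_pole s z" for z
    using is_pole_zero_at_nicely_mero[OF sn that] by simp
  obtain b where "(\<forall>z. s z = C (z + b)) \<or> (\<forall>z. s z = C (- z + b))"
    using autonomous_solutions_related[OF s(1) C] .
  hence "s (- b) = 1 \<or> s b = 1"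
    using C0 by (metis add.left_inverse)
  thus ?thesis
    using that pole by blast
qed

text \<open>With c^2 = m, the function 1/(c s) solves the same equation, as in sn(z + iK') = 1/(k sn
  z), and has a pole at 0. Comparing it with \<open>s\<close> transfers the pole. For m = 0 the
  solution is the entire function sin.\<close>

lemma legendre_solution_has_pole:
  assumes s: "autonomous_solution (legendre_quartic m) s" "\<not> is_pole s 0" "s 0 = 0"
    and m: "m \<noteq> 0"
  obtains b where "is_pole s b"
proof -
  define c where "c = csqrt m"
  have c: "c\<^sup>2 = m" "c \<noteq> 0"
    using m by (auto simp: c_def)
  define D where "D z = inverse (c * s z)" for z
  have sm: "s meromorphic_on UNIV" and sn: "s nicely_meromorphic_on UNIV"
    using s by (auto simp: autonomous_solution_def nicely_meromorphic_on_def)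
  have Dn: "D nicely_meromorphic_on UNIV"
    unfolding D_def by (intro nicely_meromorphic_on_inverse nicely_meromorphic_on_cmult_left sn)
  have Dnc: "\<not> D constant_on UNIV"
  proof
    assume "D constant_on UNIV"
    then obtain k where k: "\<And>z. D z = k"
      by (auto simp: constant_on_def)
    have "s z = inverse k / c" for z
      using k[of z] c(2) by (auto simp: D_def field_simps)
    hence "s constant_on UNIV"
      by (auto simp: constant_on_def)
    thus False using s by (simp add: autonomous_solution_def)
  qed
  have D: "autonomous_solution (legendre_quartic m) D"
  proof (rule autonomous_solutionI[OF Dn Dnc])
    show "\<forall>\<^sub>F z in at 0. (deriv D z)\<^sup>2 = poly (legendre_quartic m) (D z)"
      using autonomous_solution_eventually_regular[OF s(1), of 0] autonomous_solution_avoids[OF s(1), of 0 0]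
    proof eventually_elim
      case (elim z)
      note d = autonomous_solution_derivs[OF s(1) elim(1)]
      have "(D has_field_derivative - (c * deriv s z) / (c * s z)\<^sup>2) (at z)"
        unfolding D_def[abs_def] using elim c(2)
        by (auto intro!: derivative_eq_intros d(1) simp: power2_eq_square field_simps)
      hence "(deriv D z)\<^sup>2 = c\<^sup>2 * poly (legendre_quartic m) (s z) / ((c * s z)\<^sup>2)\<^sup>2"
        by (simp add: DERIV_imp_deriv power_divide power_mult_distrib d(3))
      also have "\<dots> = poly (legendre_quartic m) (D z)"
        using elim(2) m unfolding poly_legendre_quartic D_def
        by (simp add: power_mult_distrib c(1) power_inverse divide_simps) (simp add: power2_eq_square power4_eq_xxxx algebra_simps)
      finally show ?case .
    qed
  qed
  have "isolated_zero s 0"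
    using zero_or_pole[OF sn UNIV_I s(3) autonomous_solution_avoids[OF s(1)]] s(2) by blast
  hence "is_pole (\<lambda>z. inverse c * inverse (s z)) 0"
    using c(2) by (subst is_pole_cmult_iff) (auto simp: is_pole_inverse_iff)
  hence pD: "is_pole D 0"
    by (simp add: D_def[abs_def])
  obtain b where "(\<forall>z. s z = D (z + b)) \<or> (\<forall>z. s z = D (- z + b))"
    using autonomous_solutions_related[OF s(1) D] .
  hence "s = (\<lambda>z. D (1 * z + b)) \<or> s = (\<lambda>z. D (- 1 * z + b))"
    by auto
  hence "is_pole s (- b) \<or> is_pole s b"
    using autonomous_solution_affine(2)[OF D, of 1 b "- b"] autonomous_solution_affine(2)[OF D, of "- 1" b b] pD
    by auto
  thus ?thesis
    using that by blast
qed

text \<open>With \<open>s\<close> the Legendre solution, \<open>(F - e1) / (F - e4) = k s\<^sup>2\<close>: the branch points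
  \<open>0, 1, 1/m, \<infinity>\<close> of \<open>s\<^sup>2\<close> are sent to the four roots.\<close>

lemma quartic_solution_exists:
  fixes a e1 e2 e3 e4 :: complex
  assumes a: "a \<noteq> 0" and e: "distinct [e1, e2, e3, e4]"
  defines "P \<equiv> smult a ([:- e1, 1:] * [:- e2, 1:] * [:- e3, 1:] * [:- e4, 1:])"
  obtains F x1 x2 x4 where "autonomous_solution P F" "\<not> is_pole F x1" "F x1 = e1"
    "\<not> is_pole F x2" "F x2 = e2" "\<not> is_pole F x4" "F x4 = e4"
proof -
  \<comment> \<open>In (F - e1)/(F - e4) = k s^2 the requirement that s^2 = 1 correspond to F = e2
    determines \<open>k\<close>, and that s^2 = 1/m correspond to F = e3 determines
    \<open>m\<close>. The time scale \<open>l\<close> is fixed by comparing the constant factors of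
    F'^2 and P(F).\<close>
  define k where "k = (e2 - e1) / (e2 - e4)"
  define m where "m = (e3 - e4) * k / (e3 - e1)"
  define l where "l = csqrt (a * (e1 - e2) * (e1 - e3) / (4 * k))"
  have ne: "e1 \<noteq> e2" "e1 \<noteq> e3" "e1 \<noteq> e4" "e2 \<noteq> e3" "e2 \<noteq> e4" "e3 \<noteq> e4"
    using e by auto
  have k: "k \<noteq> 0" "k \<noteq> 1" and m: "m \<noteq> 0"
    using ne by (auto simp: k_def m_def)
  \<comment> \<open>\<open>m\<close> is a cross-ratio of the four roots; this identity shows that it
    differs from 1 when they are distinct.\<close>
  have "(e3 - e4) * (e2 - e1) - (e3 - e1) * (e2 - e4) = (e2 - e3) * (e1 - e4)"
    by (simp add: algebra_simps)
  hence "(e3 - e4) * (e2 - e1) \<noteq> (e3 - e1) * (e2 - e4)"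
    using ne by auto
  hence m1: "m \<noteq> 1"
    using ne by (auto simp: m_def k_def field_simps)
  have l2: "l\<^sup>2 = a * (e1 - e2) * (e1 - e3) / (4 * k)" and l: "l \<noteq> 0"
    using a ne k by (auto simp: l_def)
  obtain s where s: "autonomous_solution (legendre_quartic m) s" "\<not> is_pole s 0" "s 0 = 0" "deriv s 0 = 1"
    using legendre_solution_exists .
  obtain b where b: "\<not> is_pole s b" "s b = 1"
    using legendre_solution_attains_one[OF s m1] .
  obtain p where p: "is_pole s p"
    using legendre_solution_has_pole[OF s(1-3) m] .
  define S where "S z = s (l * z + 0)" for z
  have S: "autonomous_solution (smult (l\<^sup>2) (legendre_quartic m)) S" "is_pole S z \<longleftrightarrow> is_pole s (l * z)" for z
    unfolding S_def[abs_def] using autonomous_solution_affine[OF s(1) l, of 0] by auto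
  have Sm: "S meromorphic_on UNIV" and Sn: "S nicely_meromorphic_on UNIV"
    using S(1) by (auto simp: autonomous_solution_def nicely_meromorphic_on_def)
  \<comment> \<open>The relation (F - e1)/(F - e4) = k S^2 solved for F.\<close>
  define F0 where "F0 z = e4 + (e1 - e4) / (1 - k * (S z)\<^sup>2)" for z
  have F0m: "F0 meromorphic_on UNIV"
    unfolding F0_def by (intro meromorphic_intros Sm)
  have "[:0, 1:] * legendre_quartic m * [:1, 0, - k:] \<noteq> 0"
    by (simp add: legendre_quartic_def)
  from autonomous_solution_avoids_roots[OF S(1) this, of 0]
  have "\<forall>\<^sub>F z in at 0. S z \<noteq> 0 \<and> 1 - (S z)\<^sup>2 \<noteq> 0 \<and> 1 - m * (S z)\<^sup>2 \<noteq> 0 \<and> 1 - k * (S z)\<^sup>2 \<noteq> 0"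
  proof eventually_elim
    case (elim z)
    have "poly ([:0, 1:] * legendre_quartic m * [:1, 0, - k:]) x = x * ((1 - x\<^sup>2) * (1 - m * x\<^sup>2)) * (1 - k * x\<^sup>2)" for x
      by (simp add: poly_legendre_quartic power2_eq_square algebra_simps)
    from elim[unfolded this] show ?case by simp
  qed
  with autonomous_solution_eventually_regular[OF S(1), of 0]
  have ev: "\<forall>\<^sub>F z in at 0. deriv F0 z \<noteq> 0 \<and> (deriv F0 z)\<^sup>2 = poly P (F0 z)"
  proof eventually_elim
    case (elim z)
    note d = autonomous_solution_derivs[OF S(1) elim(1)]
    define U N where "U = (S z)\<^sup>2" and "N = 1 - k * U"
    have U: "U \<noteq> 0" "1 - U \<noteq> 0" "1 - m * U \<noteq> 0" and N: "N \<noteq> 0"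
      using elim by (auto simp: U_def N_def)
    have "(F0 has_field_derivative (e1 - e4) * (k * (2 * S z * deriv S z)) / (1 - k * (S z)\<^sup>2)\<^sup>2) (at z)"
      unfolding F0_def[abs_def] using elim
      by (auto intro!: derivative_eq_intros d(1) simp: power2_eq_square)
    hence "deriv F0 z = (e1 - e4) * (k * (2 * S z * deriv S z)) / N\<^sup>2"
      unfolding N_def U_def by (rule DERIV_imp_deriv)
    hence "(deriv F0 z)\<^sup>2 = 4 * (e1 - e4)\<^sup>2 * k\<^sup>2 * U * (deriv S z)\<^sup>2 / N ^ 4"
      by (simp add: power_mult_distrib power_divide U_def)
    also have "(deriv S z)\<^sup>2 = l\<^sup>2 * ((1 - U) * (1 - m * U))"
      by (simp add: d(3) poly_legendre_quartic U_def)
    finally have dF: "(deriv F0 z)\<^sup>2 = 4 * (e1 - e4)\<^sup>2 * k\<^sup>2 * U * (l\<^sup>2 * ((1 - U) * (1 - m * U))) / N ^ 4" .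
    have F0: "F0 z = e4 + (e1 - e4) / N"
      by (simp add: F0_def N_def U_def)
    \<comment> \<open>Over the common denominator \<open>N\<close>, the differences of
      \<open>F0 z\<close> from e1, e2, e3, e4 are constant multiples of U, 1 - U, 1 - mU and 1.
      Their product therefore has the shape of F0'^2, and only the constants remain to be
      matched.\<close>
    have 4: "F0 z - e4 = (e1 - e4) / N"
      by (simp add: F0)
    have 1: "F0 z - e1 = (e1 - e4) * k * U / N"
      unfolding F0 using N by (simp add: divide_simps) (simp add: N_def algebra_simps)
    have k2: "k * (e2 - e4) = e2 - e1" and m2: "m * (e3 - e1) = (e3 - e4) * k"
      using ne by (auto simp: k_def m_def)
    have "(e4 - e2) * N + (e1 - e4) = (e1 - e2) + k * (e2 - e4) * U"
      by (simp add: N_def algebra_simps)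
    also have "\<dots> = (e1 - e2) * (1 - U)"
      unfolding k2 by (simp add: algebra_simps)
    finally have 2: "F0 z - e2 = (e1 - e2) * (1 - U) / N"
      unfolding F0 using N by (simp add: field_simps)
    have "(e4 - e3) * N + (e1 - e4) = (e1 - e3) + (e3 - e4) * k * U"
      by (simp add: N_def algebra_simps)
    also have "\<dots> = (e1 - e3) * (1 - m * U)"
      unfolding m2[symmetric] by (simp add: algebra_simps)
    finally have 3: "F0 z - e3 = (e1 - e3) * (1 - m * U) / N"
      unfolding F0 using N by (simp add: field_simps)
    have "poly P (F0 z) = a * ((F0 z - e1) * (F0 z - e2) * (F0 z - e3) * (F0 z - e4))"
      by (simp add: P_def algebra_simps)
    also have "\<dots> = a * (e1 - e2) * (e1 - e3) * (e1 - e4)\<^sup>2 * k * U * ((1 - U) * (1 - m * U)) / N ^ 4"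
      unfolding 1 2 3 4 by (simp add: power2_eq_square power4_eq_xxxx)
    also have "a * (e1 - e2) * (e1 - e3) = 4 * k * l\<^sup>2"
      unfolding l2 using k by simp
    finally have PF: "poly P (F0 z) = 4 * k * l\<^sup>2 * (e1 - e4)\<^sup>2 * k * U * ((1 - U) * (1 - m * U)) / N ^ 4" .
    have eq: "(deriv F0 z)\<^sup>2 = poly P (F0 z)"
      unfolding dF PF by (simp add: power2_eq_square mult_ac)
    moreover have "(deriv F0 z)\<^sup>2 \<noteq> 0"
      unfolding dF using k l U N ne by simp
    ultimately show ?case by auto
  qed
  define F where "F = remove_sings F0"
  have F: "autonomous_solution P F"
    unfolding F_def by (rule autonomous_solution_remove_sings[OF F0m ev])
  have reg: "\<not> is_pole F z \<and> F z = F0 z" if "\<not> is_pole S z" "1 - k * (S z)\<^sup>2 \<noteq> 0" for z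
  proof -
    have "S analytic_on {z}"
      using nicely_meromorphic_on_imp_analytic_at[OF Sn UNIV_I that(1)] .
    hence an: "F0 analytic_on {z}"
      unfolding F0_def using that(2) by (intro analytic_intros) auto
    thus ?thesis
      unfolding F_def using remove_sings_analytic_on[OF an] by (auto dest: analytic_at_imp_no_pole)
  qed
  have 1: "\<not> is_pole F 0 \<and> F 0 = e1"
    using reg[of 0] S(2)[of 0] s by (simp add: S_def F0_def)
  have 2: "\<not> is_pole F (b / l) \<and> F (b / l) = e2"
  proof -
    have Sb: "S (b / l) = 1"
      using b l by (simp add: S_def)
    have "e4 + (e1 - e4) / (1 - k) = e2"
    proof -
      have "1 - k = (e1 - e4) / (e2 - e4)"
        using ne by (simp add: k_def field_simps)
      thus ?thesis using ne by simp
    qed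
    thus ?thesis
      using reg[of "b / l"] S(2)[of "b / l"] b l k Sb by (simp add: F0_def)
  qed
  have 4: "\<not> is_pole F (p / l) \<and> F (p / l) = e4"
  proof -
    \<comment> \<open>The root e4 belongs to S = infinity, where \<open>F0\<close> has no meaningful
      value; its limit there exists and is the value that \<open>remove_sings\<close>
      inserts.\<close>
    have "is_pole S (p / l)"
      using S(2)[of "p / l"] p l by simp
    hence "filterlim S at_infinity (at (p / l))"
      by (simp add: is_pole_def)
    hence "filterlim (\<lambda>z. (S z)\<^sup>2) at_infinity (at (p / l))"
      unfolding power2_eq_square by (intro filterlim_at_infinity_times)
    hence "filterlim (\<lambda>z. - k * (S z)\<^sup>2) at_infinity (at (p / l))"
      using k by (intro tendsto_mult_filterlim_at_infinity[OF tendsto_const]) auto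
    hence "filterlim (\<lambda>z. 1 + - k * (S z)\<^sup>2) at_infinity (at (p / l))"
      by (intro tendsto_add_filterlim_at_infinity[OF tendsto_const])
    hence "((\<lambda>z. (e1 - e4) / (1 + - k * (S z)\<^sup>2)) \<longlongrightarrow> 0) (at (p / l))"
      by (intro tendsto_divide_0[OF tendsto_const])
    hence lim: "F0 \<midarrow>p / l\<rightarrow> e4"
      unfolding F0_def[abs_def] using tendsto_add[OF tendsto_const[of e4]] by fastforce
    have "isolated_singularity_at F0 (p / l)"
      using meromorphic_on_isolated_singularity[OF meromorphic_on_subset[OF F0m]] by simp
    from remove_sings_analytic_at[OF this lim] have "F analytic_on {p / l}"
      by (simp add: F_def)
    thus ?thesis
      using remove_sings_eqI[OF lim] by (auto simp: F_def dest: analytic_at_imp_no_pole)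
  qed
  show ?thesis
    by (rule that[OF F, of 0 "b / l" "p / l"]) (use 1 2 4 in auto)
qed

section \<open>Lattices in the complex plane\<close>

lemma real_basis_repr:
  fixes w1 w2 z :: complex
  assumes w: "w1 \<noteq> 0" "w2 / w1 \<notin> \<real>"
  obtains s t where "z = of_real s * w1 + of_real t * w2"
proof -
  define \<tau> where "\<tau> = w2 / w1"
  have im: "Im \<tau> \<noteq> 0"
    using w(2) by (simp add: \<tau>_def complex_is_Real_iff)
  define t where "t = Im (z / w1) / Im \<tau>"
  define s where "s = Re (z / w1) - t * Re \<tau>"
  have "z / w1 = of_real s + of_real t * \<tau>"
    using im by (simp add: complex_eq_iff s_def t_def)
  hence "z = of_real s * w1 + of_real t * w2"
    using w(1) by (simp add: \<tau>_def field_simps)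
  thus ?thesis using that by blast
qed

lemma real_basis_unique:
  fixes w1 w2 :: complex
  assumes w: "w1 \<noteq> 0" "w2 / w1 \<notin> \<real>"
    and eq: "of_real s * w1 + of_real t * w2 = of_real s' * w1 + of_real t' * w2"
  shows "s = s' \<and> t = t'"
proof -
  define \<tau> where "\<tau> = w2 / w1"
  have im: "Im \<tau> \<noteq> 0"
    using w(2) by (simp add: \<tau>_def complex_is_Real_iff)
  have "of_real s + of_real t * \<tau> = of_real s' + of_real t' * \<tau>"
    using eq w(1) by (simp add: \<tau>_def field_simps)
  hence "Re (of_real s + of_real t * \<tau>) = Re (of_real s' + of_real t' * \<tau>)"
    "Im (of_real s + of_real t * \<tau>) = Im (of_real s' + of_real t' * \<tau>)"
    by simp_all
  thus ?thesis using im by simp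
qed

text \<open>A disc meets the group in a finite set: infinitely many points would accumulate, and the
  difference of two close ones would be a nonzero element shorter than \<open>d\<close>.\<close>

lemma discrete_subgroup_min_norm:
  fixes L S :: "complex set"
  assumes diff: "\<And>x y. x \<in> L \<Longrightarrow> y \<in> L \<Longrightarrow> x - y \<in> L"
    and d: "d > 0" "\<And>x. x \<in> L \<Longrightarrow> x \<noteq> 0 \<Longrightarrow> norm x \<ge> d"
    and S: "S \<subseteq> L" "S \<noteq> {}"
  obtains x where "x \<in> S" "\<And>y. y \<in> S \<Longrightarrow> norm x \<le> norm y"
proof -
  obtain x0 where x0: "x0 \<in> S" using S by blast
  define T where "T = S \<inter> cball 0 (norm x0)"
  have "finite T"
  proof (rule ccontr)
    assume "infinite T"
    moreover have "bounded T"
      unfolding T_def by (rule bounded_subset[OF bounded_cball]) auto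
    ultimately obtain l where "l islimpt T"
      using Bolzano_Weierstrass_imp_bounded bounded_infinite_imp_islimpt by blast
    then obtain x where x: "x \<in> T" "x \<noteq> l" "dist x l < d / 2"
      using d(1) unfolding islimpt_approachable by (meson half_gt_zero)
    then obtain y where y: "y \<in> T" "y \<noteq> l" "dist y l < dist x l"
      using \<open>l islimpt T\<close> unfolding islimpt_approachable by (metis zero_less_dist_iff)
    have "x - y \<in> L" using x y S by (auto simp: T_def intro: diff)
    moreover have "x \<noteq> y" using x y by auto
    ultimately have "dist x y \<ge> d" using d(2)[of "x - y"] by (simp add: dist_norm)
    moreover have "dist x y \<le> dist x l + dist y l" by (metis dist_commute dist_triangle)
    ultimately show False using x y by simp
  qed
  moreover have "T \<noteq> {}" using x0 by (auto simp: T_def)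
  ultimately obtain x where x: "x \<in> T" "\<And>y. y \<in> T \<Longrightarrow> norm x \<le> norm y"
    using ex_min_if_finite[of "norm ` T"] by (metis arg_min_if_finite(1) arg_min_least)
  have "norm x \<le> norm y" if "y \<in> S" for y
  proof (cases "y \<in> T")
    case False
    hence "norm x0 < norm y" using that by (auto simp: T_def)
    thus ?thesis using x(1) by (auto simp: T_def)
  qed (use x in auto)
  thus ?thesis using that[of x] x by (auto simp: T_def)
qed

text \<open>Lattice reduction: w1 is a shortest nonzero element and w2 a shortest one outside the
  multiples of w1. Rounding real coordinates leaves a remainder with coefficients at most 1/2 in
  modulus, too short to lie outside those multiples.\<close>

lemma discrete_subgroup_basis:
  fixes L :: "complex set"
  assumes diff: "\<And>x y. x \<in> L \<Longrightarrow> y \<in> L \<Longrightarrow> x - y \<in> L"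
    and d: "d > 0" "\<And>x. x \<in> L \<Longrightarrow> x \<noteq> 0 \<Longrightarrow> norm x \<ge> d"
    and L0: "0 \<in> L"
    and noncyclic: "\<And>w. w \<in> L \<Longrightarrow> \<exists>x\<in>L. \<forall>n::int. x \<noteq> of_int n * w"
  obtains w1 w2 where "w1 \<in> L" "w2 \<in> L" "w1 \<noteq> 0" "w2 / w1 \<notin> \<real>"
    "\<And>x. x \<in> L \<Longrightarrow> \<exists>m n::int. x = of_int m * w1 + of_int n * w2"
proof -
  have neg: "- x \<in> L" if "x \<in> L" for x
    using diff[OF L0 that] by simp
  have add: "x + y \<in> L" if "x \<in> L" "y \<in> L" for x y
    using diff[OF that(1) neg[OF that(2)]] by simp
  have mult_nat: "of_nat n * x \<in> L" if "x \<in> L" for x n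
    by (induction n) (use that L0 add in \<open>auto simp: ring_distribs\<close>)
  have mult: "of_int n * x \<in> L" if "x \<in> L" for x n
    by (cases n rule: int_cases2) (use mult_nat[OF that] neg[OF mult_nat[OF that]] in auto)
  note min = discrete_subgroup_min_norm[of L d, OF diff d]
  \<comment> \<open>The instance w = 0 of noncyclicity provides a nonzero element; the instance w =
    w1 below provides w2.\<close>
  obtain x0 where x0: "x0 \<in> L" "x0 \<noteq> 0"
    using noncyclic[OF L0] by (metis mult_zero_right)
  obtain w1 where w1: "w1 \<in> L - {0}" "\<And>y. y \<in> L - {0} \<Longrightarrow> norm w1 \<le> norm y"
    using min[of "L - {0}"] x0 by blast
  define Z where "Z = range (\<lambda>n::int. of_int n * w1)"
  have ZL: "Z \<subseteq> L"
    unfolding Z_def using mult w1 by auto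
  have "L - Z \<noteq> {}"
    using noncyclic[of w1] w1 by (auto simp: Z_def)
  then obtain w2 where w2: "w2 \<in> L - Z" "\<And>y. y \<in> L - Z \<Longrightarrow> norm w2 \<le> norm y"
    using min[of "L - Z"] by blast
  have w10: "w1 \<noteq> 0" and w1L: "w1 \<in> L" and w2L: "w2 \<in> L"
    using w1 w2 by auto
  have round: "\<bar>t - of_int (round t)\<bar> \<le> 1 / 2" for t :: real
    using of_int_round_abs_le[of t] by (simp add: abs_minus_commute)
  have small: "x \<in> Z" if "x \<in> L" "x = of_real s * w1" "\<bar>s\<bar> \<le> 1 / 2" for x s
  proof -
    have "norm x \<le> 1 / 2 * norm w1"
      using that(3) unfolding that(2) norm_mult by (intro mult_right_mono) auto
    also have "\<dots> < norm w1" using w10 by simp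
    finally have "x = 0"
      using w1(2)[of x] that(1) by force
    thus ?thesis by (auto simp: Z_def image_iff intro: exI[of _ 0])
  qed
  have Z_add: "x + of_int n * w1 \<in> Z" if "x \<in> Z" for x n
    using that by (auto simp: Z_def simp flip: of_int_add distrib_right)
  have indep: "w2 / w1 \<notin> \<real>"
  proof
    assume "w2 / w1 \<in> \<real>"
    then obtain t where t: "w2 / w1 = of_real t"
      by (auto elim: Reals_cases)
    hence w2t: "w2 = of_real t * w1" using w10 by (simp add: field_simps)
    have "w2 - of_int (round t) * w1 \<in> Z"
    proof (rule small)
      show "w2 - of_int (round t) * w1 \<in> L"
        by (intro diff w2L mult w1L)
      show "w2 - of_int (round t) * w1 = of_real (t - of_int (round t)) * w1"
        by (simp add: w2t algebra_simps)
    qed (rule round)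
    from Z_add[OF this, of "round t"] show False
      using w2 by simp
  qed
  have "\<exists>m n::int. x = of_int m * w1 + of_int n * w2" if x: "x \<in> L" for x
  proof -
    obtain s t where st: "x = of_real s * w1 + of_real t * w2"
      using real_basis_repr[OF w10 indep] by metis
    define s' t' where "s' = s - of_int (round s)" and "t' = t - of_int (round t)"
    define y where "y = x - of_int (round s) * w1 - of_int (round t) * w2"
    have yL: "y \<in> L"
      unfolding y_def by (intro diff x mult w1L w2L)
    have y: "y = of_real s' * w1 + of_real t' * w2"
      by (simp add: y_def st s'_def t'_def algebra_simps)
    have s': "\<bar>s'\<bar> \<le> 1 / 2" and t': "\<bar>t'\<bar> \<le> 1 / 2"
      unfolding s'_def t'_def by (rule round)+
    have w20: "w2 \<noteq> 0" using indep by auto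
    have w12: "norm w1 \<le> norm w2"
      using w1(2)[of w2] w2L w20 by simp
    have "y \<in> Z"
    proof (rule ccontr)
      assume yZ: "y \<notin> Z"
      hence le: "norm w2 \<le> norm y"
        using w2(2)[of y] yL by simp
      have t0: "t' \<noteq> 0"
        using small[OF yL, of s'] y s' yZ by auto
      have s0: "s' \<noteq> 0"
      proof
        assume "s' = 0"
        hence "norm y = \<bar>t'\<bar> * norm w2" by (simp add: y norm_mult)
        also have "\<dots> \<le> 1 / 2 * norm w2" using t' by (intro mult_right_mono) auto
        also have "\<dots> < norm w2" using w20 by simp
        finally show False using le by simp
      qed
      have "norm (of_real s' * w1) \<le> 1 / 2 * norm w2"
        unfolding norm_mult using s' w12 by (intro mult_mono) auto
      moreover have "norm (of_real t' * w2) \<le> 1 / 2 * norm w2"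
        unfolding norm_mult using t' by (intro mult_mono) auto
      moreover have "norm y \<le> norm (of_real s' * w1) + norm (of_real t' * w2)"
        unfolding y by (rule norm_triangle_ineq)
      \<comment> \<open>Both summands have norm at most half that of w2 while \<open>y\<close> is at
        least as long as w2, so the triangle inequality is an equality. The summands would then be
        parallel, contradicting independence of w1 and w2.\<close>
      ultimately have "norm (of_real s' * w1 + of_real t' * w2) = norm (of_real s' * w1) + norm (of_real t' * w2)"
        using le unfolding y by linarith
      hence "norm (of_real s' * w1) *\<^sub>R (of_real t' * w2) = norm (of_real t' * w2) *\<^sub>R (of_real s' * w1)"
        by (simp only: norm_triangle_eq)
      hence "of_real 0 * w1 + of_real (norm (of_real s' * w1) * t') * w2 = of_real (norm (of_real t' * w2) * s') * w1 + of_real 0 * w2"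
        by (simp add: scaleR_conv_of_real mult_ac)
      from real_basis_unique[OF w10 indep this] show False
        using s0 t0 w10 by simp
    qed
    then obtain m where "y = of_int m * w1"
      by (auto simp: Z_def)
    hence "x = of_int (m + round s) * w1 + of_int (round t) * w2"
      by (simp add: y_def algebra_simps)
    thus ?thesis by blast
  qed
  thus ?thesis
    using that[OF w1L w2L w10 indep] by blast
qed

lemma period_parallelogram_repr:
  assumes w: "w1 \<noteq> 0" "w2 / w1 \<notin> \<real>"
  obtains m n :: int where "z + of_int m * w1 + of_int n * w2 \<in> period_parallelogram w1 w2"
proof -
  obtain s t where st: "z = of_real s * w1 + of_real t * w2"
    using real_basis_repr[OF w] by metis
  have "z + of_int (- \<lfloor>s\<rfloor>) * w1 + of_int (- \<lfloor>t\<rfloor>) * w2 = of_real (frac s) * w1 + of_real (frac t) * w2"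
    by (simp add: st frac_def algebra_simps)
  also have "\<dots> \<in> period_parallelogram w1 w2"
    unfolding period_parallelogram_def using frac_lt_1 by (auto intro!: exI)
  finally show ?thesis using that by blast
qed

lemma period_parallelogram_unique:
  assumes w: "w1 \<noteq> 0" "w2 / w1 \<notin> \<real>"
    and x: "x \<in> period_parallelogram w1 w2" and y: "y \<in> period_parallelogram w1 w2"
    and eq: "x = y + of_int m * w1 + of_int n * w2"
  shows "x = y"
proof -
  obtain s t where st: "x = of_real s * w1 + of_real t * w2" "s \<in> {0..<1}" "t \<in> {0..<1}"
    using x by (auto simp: period_parallelogram_def)
  obtain s' t' where st': "y = of_real s' * w1 + of_real t' * w2" "s' \<in> {0..<1}" "t' \<in> {0..<1}"
    using y by (auto simp: period_parallelogram_def)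
  have "of_real s * w1 + of_real t * w2 = of_real (s' + of_int m) * w1 + of_real (t' + of_int n) * w2"
    using eq by (simp add: st st' algebra_simps)
  from real_basis_unique[OF w this] have "s = s' + of_int m" "t = t' + of_int n"
    by auto
  hence "\<bar>real_of_int m\<bar> < 1" "\<bar>real_of_int n\<bar> < 1"
    using st st' by auto
  hence "m = 0" "n = 0" by linarith+
  thus ?thesis using eq by simp
qed

section \<open>Ellipticity\<close>

text \<open>At a root the derivative vanishes, so reversing time about \<open>a\<close> leaves both
  initial data unchanged.\<close>

lemma autonomous_solution_reflection:
  assumes F: "autonomous_solution P F" and a: "\<not> is_pole F a" "poly P (F a) = 0"
  shows "F (2 * a - z) = F z"
proof -
  define G where "G z = F (- 1 * z + 2 * a)" for z
  have G: "autonomous_solution P G" "is_pole G z \<longleftrightarrow> is_pole F (2 * a - z)" for z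
    unfolding G_def[abs_def] using autonomous_solution_affine[OF F, of "- 1" "2 * a"] by (auto simp: algebra_simps)
  have Ga: "\<not> is_pole G a" "G a = F a"
    using G(2)[of a] a by (auto simp: G_def)
  have "(deriv F a)\<^sup>2 = 0" "(deriv G a)\<^sup>2 = 0"
    using F G(1) a Ga by (auto simp: autonomous_solution_def)
  hence "F (w + a) = G (w + a)" for w
    by (intro autonomous_solution_unique[OF F G(1) a(1) Ga(1)]) (use Ga in auto)
  from this[of "z - a"] show ?thesis
    by (simp add: G_def)
qed

section \<open>Periods and values of doubly periodic functions\<close>

definition period_group :: "(complex \<Rightarrow> complex) \<Rightarrow> complex set" where
  "period_group f = {w. \<forall>z. f (z + w) = f z}"

lemma period_group_diff: "x \<in> period_group f \<Longrightarrow> y \<in> period_group f \<Longrightarrow> x - y \<in> period_group f"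
  unfolding period_group_def by (simp add: algebra_simps) (metis add_diff_cancel_right' diff_add_eq)

lemma period_group_of_int:
  assumes "w \<in> period_group f"
  shows "f (z + of_int n * w) = f z"
proof -
  have nat: "f (z + of_nat k * w) = f z" for k z
  proof (induction k arbitrary: z)
    case (Suc k)
    have "f (z + of_nat (Suc k) * w) = f ((z + of_nat k * w) + w)"
      by (simp add: algebra_simps)
    also have "\<dots> = f z"
      using assms Suc by (simp add: period_group_def)
    finally show ?case .
  qed auto
  show ?thesis
  proof (cases n rule: int_cases2)
    case (nonpos k)
    thus ?thesis using nat[of "z + of_int n * w" k] by simp
  qed (use nat in auto)
qed

text \<open>A period \<open>w\<close> satisfies F(w) = F(0), while the value F(0) is not taken again
  near 0.\<close>

lemma period_group_discrete:
  assumes F: "autonomous_solution P F"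
  obtains d where "d > 0" "\<And>w. w \<in> period_group F \<Longrightarrow> w \<noteq> 0 \<Longrightarrow> norm w \<ge> d"
proof -
  obtain d where d: "d > 0" "\<And>z. z \<noteq> 0 \<Longrightarrow> dist z 0 < d \<Longrightarrow> F z \<noteq> F 0"
    using autonomous_solution_avoids[OF F, of "F 0" 0] by (auto simp: eventually_at)
  have "norm w \<ge> d" if "w \<in> period_group F" "w \<noteq> 0" for w
  proof (rule ccontr)
    assume "\<not> norm w \<ge> d"
    moreover have "F (0 + w) = F 0"
      using that(1) unfolding period_group_def by blast
    ultimately show False
      using d(2)[OF that(2)] by (simp add: dist_norm)
  qed
  thus ?thesis using that d(1) by blast
qed

text \<open>Reflections in two points where \<open>F\<close> attains roots compose to a translation by twice their
  difference, while the difference itself is not a period; three roots therefore exclude a cyclic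
  period group.\<close>

lemma autonomous_solution_period_basis:
  assumes F: "autonomous_solution P F"
    and x: "\<not> is_pole F x1" "\<not> is_pole F x2" "\<not> is_pole F x3"
    and r: "poly P (F x1) = 0" "poly P (F x2) = 0" "poly P (F x3) = 0"
    and ne: "F x1 \<noteq> F x2" "F x1 \<noteq> F x3" "F x2 \<noteq> F x3"
  obtains w1 w2 where "w1 \<in> period_group F" "w2 \<in> period_group F" "w1 \<noteq> 0" "w2 / w1 \<notin> \<real>"
    "\<And>x. x \<in> period_group F \<Longrightarrow> \<exists>m n::int. x = of_int m * w1 + of_int n * w2"
proof -
  have per: "2 * (b - a) \<in> period_group F"
    if "\<not> is_pole F a" "\<not> is_pole F b" "poly P (F a) = 0" "poly P (F b) = 0" for a b
  proof -
    have "F (z + 2 * (b - a)) = F z" for z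
    proof -
      have "F (z + 2 * (b - a)) = F (2 * b - (2 * a - z))"
        by (simp add: algebra_simps)
      also have "\<dots> = F (2 * a - z)"
        by (rule autonomous_solution_reflection[OF F that(2,4)])
      also have "\<dots> = F z"
        by (rule autonomous_solution_reflection[OF F that(1,3)])
      finally show ?thesis .
    qed
    thus ?thesis by (simp add: period_group_def)
  qed
  obtain d where d: "d > 0" "\<And>w. w \<in> period_group F \<Longrightarrow> w \<noteq> 0 \<Longrightarrow> norm w \<ge> d"
    using period_group_discrete[OF F] by blast
  have "\<exists>x\<in>period_group F. \<forall>n::int. x \<noteq> of_int n * w" if w: "w \<in> period_group F" for w
  proof (rule ccontr)
    assume "\<not> ?thesis"
    hence cyc: "\<exists>n::int. x = of_int n * w" if "x \<in> period_group F" for x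
      using that by blast
    \<comment> \<open>An even multiple would make b - a itself a period and force F a = F b. Thus m,
      n and n - m would all be odd, which is impossible.\<close>
    have odd: "odd n" if "2 * (b - a) = of_int n * w" "F a \<noteq> F b" for a b n
    proof
      assume "even n"
      then obtain k where "n = 2 * k" by (elim evenE)
      hence "2 * b = 2 * (a + of_int k * w)"
        using that(1) by (simp add: algebra_simps)
      hence "b = a + of_int k * w"
        by (subst (asm) mult_cancel_left) simp
      thus False
        using that(2) period_group_of_int[OF w] by simp
    qed
    obtain m where m: "2 * (x2 - x1) = of_int m * w"
      using cyc[OF per[OF x(1,2) r(1,2)]] by blast
    obtain n where n: "2 * (x3 - x1) = of_int n * w"
      using cyc[OF per[OF x(1,3) r(1,3)]] by blast
    have "2 * (x3 - x2) = of_int (n - m) * w"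
      using m n by (simp add: algebra_simps)
    from odd[OF this ne(3)] odd[OF m ne(1)] odd[OF n ne(2)] show False
      by simp
  qed
  from discrete_subgroup_basis[of "period_group F" d, OF period_group_diff d _ this]
  show ?thesis
    using that by (auto simp: period_group_def)
qed

lemma period_group_is_pole:
  assumes "w \<in> period_group f"
  shows "is_pole f (z + w) \<longleftrightarrow> is_pole f z"
proof -
  have "is_pole f (z + w) \<longleftrightarrow> is_pole (\<lambda>u. f (u + w)) z"
    using is_pole_shift_iff[of f w z] by (simp add: o_def add.commute)
  also have "(\<lambda>u. f (u + w)) = f"
    using assms by (auto simp: period_group_def)
  finally show ?thesis .
qed

text \<open>Dense range becomes surjectivity by compactness: points with values tending to
  \<open>c\<close> are moved by periods into the closed parallelogram and subconverge. The limit is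
  no pole because the values stay bounded, so continuity applies.\<close>

lemma doubly_periodic_attains:
  assumes f: "f nicely_meromorphic_on UNIV" "\<not> f constant_on UNIV"
    and w: "w1 \<in> period_group f" "w2 \<in> period_group f" "w1 \<noteq> 0" "w2 / w1 \<notin> \<real>"
  obtains z where "\<not> is_pole f z" "f z = c"
proof -
  define K where "K = (\<lambda>(s, t). complex_of_real s * w1 + complex_of_real t * w2) ` ({0..1} \<times> {0..1})"
  have "compact K"
    unfolding K_def by (intro compact_continuous_image compact_Times) (auto simp: case_prod_unfold intro!: continuous_intros)
  have shift: "\<exists>y\<in>K. f y = f z \<and> \<not> is_pole f y" if "\<not> is_pole f z" for z
  proof -
    obtain m n :: int where mn: "z + of_int m * w1 + of_int n * w2 \<in> period_parallelogram w1 w2"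
      using period_parallelogram_repr[OF w(3,4)] .
    define v where "v = of_int m * w1 + of_int n * w2"
    have v: "v \<in> period_group f"
      using period_group_of_int[OF w(1)] period_group_of_int[OF w(2)]
      by (simp add: v_def period_group_def add.assoc[symmetric])
    have "z + v \<in> K"
      using mn by (fastforce simp: K_def period_parallelogram_def v_def add.assoc)
    moreover have "f (z + v) = f z"
      using v by (simp add: period_group_def)
    moreover have "\<not> is_pole f (z + v)"
      using period_group_is_pole[OF v] that by simp
    ultimately show ?thesis by blast
  qed
  have "\<exists>y. y \<in> K \<and> \<not> is_pole f y \<and> dist (f y) c < inverse (real (Suc n))" for n
  proof -
    obtain z where "\<not> is_pole f z" "dist (f z) c < inverse (real (Suc n))"
      by (rule nicely_meromorphic_dense_range[OF f, of "inverse (real (Suc n))" c]) auto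
    with shift[of z] show ?thesis by auto
  qed
  then obtain y where y: "y n \<in> K" "\<not> is_pole f (y n)" "dist (f (y n)) c < inverse (real (Suc n))" for n
    by metis
  have fy: "(\<lambda>n. f (y n)) \<longlonglongrightarrow> c"
    unfolding tendsto_dist_iff[of _ c]
    by (rule tendsto_sandwich[of "\<lambda>_. 0" _ _ "\<lambda>n. inverse (real (Suc n))"])
       (use y(3) in \<open>auto intro!: always_eventually less_imp_le LIMSEQ_inverse_real_of_nat simp del: of_nat_Suc\<close>)
  obtain l \<sigma> where l: "strict_mono \<sigma>" "(y \<circ> \<sigma>) \<longlonglongrightarrow> l"
    using \<open>compact K\<close> y(1) unfolding compact_def by metis
  have fl: "(\<lambda>n. f ((y \<circ> \<sigma>) n)) \<longlonglongrightarrow> c"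
    using LIMSEQ_subseq_LIMSEQ[OF fy l(1)] by (simp add: o_def)
  have np: "\<not> is_pole f l"
  proof
    assume pole: "is_pole f l"
    have "filterlim (y \<circ> \<sigma>) (at l) sequentially"
      using l(2) y(2) pole by (auto intro!: filterlim_atI always_eventually)
    hence "filterlim (\<lambda>n. f ((y \<circ> \<sigma>) n)) at_infinity sequentially"
      using pole unfolding is_pole_def by (rule filterlim_compose[rotated])
    with fl show False
      using not_tendsto_and_filterlim_at_infinity[OF sequentially_bot] by blast
  qed
  have "isCont f l"
    using nicely_meromorphic_on_imp_analytic_at[OF f(1) UNIV_I np] by (rule analytic_at_imp_isCont)
  from isCont_tendsto_compose[OF this l(2)] fl have "f l = c"
    using LIMSEQ_unique by blast
  with np show ?thesis using that by blast
qed


text \<open>(1/F)'^2 = P(F)/F^4, and for degree four this is the polynomial with reversed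
  coefficients at 1/F. Poles of F thereby become regular points of another solution, open to the
  uniqueness argument.\<close>

lemma autonomous_solution_inverse:
  assumes F: "autonomous_solution P F" and deg: "degree P = 4"
  shows "autonomous_solution (reflect_poly P) (\<lambda>z. inverse (F z))"
proof (rule autonomous_solutionI)
  have nice: "F nicely_meromorphic_on UNIV" and nc: "\<not> F constant_on UNIV"
    using F by (auto simp: autonomous_solution_def)
  show "(\<lambda>z. inverse (F z)) nicely_meromorphic_on UNIV"
    by (rule nicely_meromorphic_on_inverse[OF nice])
  show "\<not> (\<lambda>z. inverse (F z)) constant_on UNIV"
    using nc unfolding constant_on_def by (metis inverse_inverse_eq)
  show "\<forall>\<^sub>F z in at 0. (deriv (\<lambda>z. inverse (F z)) z)\<^sup>2 = poly (reflect_poly P) (inverse (F z))"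
    using autonomous_solution_eventually_regular[OF F, of 0] autonomous_solution_avoids[OF F, of 0 0]
  proof eventually_elim
    case (elim z)
    note d = autonomous_solution_derivs[OF F elim(1)]
    have "((\<lambda>z. inverse (F z)) has_field_derivative - deriv F z / (F z)\<^sup>2) (at z)"
      using elim by (auto intro!: derivative_eq_intros d(1) simp: power2_eq_square field_simps)
    hence "(deriv (\<lambda>z. inverse (F z)) z)\<^sup>2 = poly P (F z) / F z ^ 4"
      by (simp add: DERIV_imp_deriv power_divide d(3))
    also have "\<dots> = poly (reflect_poly P) (inverse (F z))"
      using elim(2) by (simp add: poly_reflect_poly_nz deg field_simps)
    finally show ?case .
  qed
qed

text \<open>Poles of \<open>F\<close> are zeros of \<open>G = 1/F\<close>, where \<open>G'\<^sup>2\<close> is the leading coefficient of \<open>P\<close>.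
  By uniqueness the sign of \<open>G'\<close> determines the pole up to periods, and a reflection exchanges
  the two signs.\<close>

lemma quartic_solution_elliptic:
  assumes F: "autonomous_solution P F" and deg: "degree P = 4"
    and x: "\<not> is_pole F x1" "\<not> is_pole F x2" "\<not> is_pole F x3"
    and r: "poly P (F x1) = 0" "poly P (F x2) = 0" "poly P (F x3) = 0"
    and ne: "F x1 \<noteq> F x2" "F x1 \<noteq> F x3" "F x2 \<noteq> F x3"
  shows "elliptic_order_two F" "\<exists>z. \<not> is_pole F z \<and> F z = c"
proof -
  obtain w1 w2 where w: "w1 \<in> period_group F" "w2 \<in> period_group F" "w1 \<noteq> 0" "w2 / w1 \<notin> \<real>"
    "\<And>x. x \<in> period_group F \<Longrightarrow> \<exists>m n::int. x = of_int m * w1 + of_int n * w2"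
    using autonomous_solution_period_basis[OF F x r ne] by metis
  have nice: "F nicely_meromorphic_on UNIV" and nc: "\<not> F constant_on UNIV"
    using F by (auto simp: autonomous_solution_def)
  show "\<exists>z. \<not> is_pole F z \<and> F z = c"
    using doubly_periodic_attains[OF nice nc w(1-4)] by metis
  define G where "G z = inverse (F z)" for z
  have G: "autonomous_solution (reflect_poly P) G"
    unfolding G_def[abs_def] by (rule autonomous_solution_inverse[OF F deg])
  have FG: "F z = inverse (G z)" for z
    by (simp add: G_def)
  have niceG: "G nicely_meromorphic_on UNIV" and ncG: "\<not> G constant_on UNIV"
    using G by (auto simp: autonomous_solution_def)
  have perG: "period_group G = period_group F"
    by (simp add: period_group_def G_def)
  have R0: "poly (reflect_poly P) 0 \<noteq> 0"
    using deg by (metis poly_0_coeff_0 coeff_0_reflect_poly leading_coeff_neq_0 degree_0 zero_neq_numeral)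
  have at_pole: "\<not> is_pole G b" "G b = 0" "deriv G b \<noteq> 0" "(deriv G b)\<^sup>2 = poly (reflect_poly P) 0"
    "zorder F b = - 1" if b: "is_pole F b" for b
  proof -
    have iz: "isolated_zero G b"
      unfolding G_def[abs_def] using b by (simp add: isolated_zero_inverse_iff)
    hence "G \<midarrow>b\<rightarrow> 0"
      by (simp add: isolated_zero_def)
    thus np: "\<not> is_pole G b"
      unfolding is_pole_def using not_tendsto_and_filterlim_at_infinity[of "at b" G 0] by auto
    show G0: "G b = 0"
      using is_pole_zero_at_nicely_mero[OF nice b] by (simp add: G_def)
    show d2: "(deriv G b)\<^sup>2 = poly (reflect_poly P) 0"
      using G np G0 by (auto simp: autonomous_solution_def)
    thus d0: "deriv G b \<noteq> 0"
      using R0 by auto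
    have an: "G analytic_on {b}"
      by (rule nicely_meromorphic_on_imp_analytic_at[OF niceG UNIV_I np])
    have "zorder G b = 1"
      by (rule zorder_zero_eqI'[OF an]) (use G0 d0 in auto)
    moreover have "zorder (\<lambda>w. inverse (G w)) b = - zorder G b"
    proof (rule zorder_inverse)
      show "isolated_singularity_at G b" "not_essential G b"
        using an by (auto intro: isolated_singularity_at_analytic not_essential_analytic)
      show "\<exists>\<^sub>F w in at b. G w \<noteq> 0"
        using autonomous_solution_avoids[OF G, of 0 b] by (intro eventually_frequently) auto
    qed
    moreover have "(\<lambda>w. inverse (G w)) = F"
      by (simp add: G_def)
    ultimately show "zorder F b = - 1"
      by simp
  qed
  obtain a where a: "\<not> is_pole G a" "G a = 0"
    using doubly_periodic_attains[OF niceG ncG] w(1-4) unfolding perG by metis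
  \<comment> \<open>Since \<open>inverse 0 = 0\<close>, the equation \<open>G a = 0\<close> says
    only \<open>F a = 0\<close>, which holds at a pole by convention as well as at a zero. A genuine
    zero of F would be a pole of \<open>G\<close>.\<close>
  have pa: "is_pole F a"
  proof (rule ccontr)
    assume "\<not> is_pole F a"
    moreover have "F a = 0" using a by (simp add: G_def)
    ultimately have "isolated_zero F a"
      using zero_or_pole[OF nice UNIV_I _ autonomous_solution_avoids[OF F]] by blast
    hence "is_pole G a"
      unfolding G_def[abs_def] by (simp add: is_pole_inverse_iff)
    with a show False by simp
  qed
  define a' where "a' = 2 * x1 - a"
  have refl: "F (- 1 * z + 2 * x1) = F z" for z
    using autonomous_solution_reflection[OF F x(1) r(1), of z] by (simp add: algebra_simps)
  have pa': "is_pole F a'"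
    using autonomous_solution_affine(2)[OF F, of "- 1" "2 * x1" a] pa unfolding refl by (simp add: a'_def)
  have da': "deriv G a = - deriv G a'"
  proof -
    have "G (- 1 * z + 2 * x1) = G z" for z
      unfolding G_def refl ..
    thus ?thesis
      using autonomous_solution_affine(3)[OF G, of "- 1" a "2 * x1"] at_pole(1)[OF pa'] by (simp add: a'_def)
  qed
  have period: "b - a0 \<in> period_group F" if "is_pole F b" "is_pole F a0" "deriv G b = deriv G a0" for b a0
  proof -
    have "G (z + b) = G (z + a0)" for z
      by (rule autonomous_solution_unique[OF G G]) (use at_pole that in auto)
    hence "G (z + (b - a0)) = G z" for z
      by (metis add.commute add_diff_eq diff_add_cancel)
    thus ?thesis
      unfolding perG[symmetric] by (simp add: period_group_def)
  qed
  have "a' - a \<notin> period_group F"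
  proof
    assume "a' - a \<in> period_group F"
    hence "G (1 * z + (a' - a)) = G z" for z
      unfolding perG[symmetric] by (simp add: period_group_def)
    hence "deriv G a = deriv G a'"
      using autonomous_solution_affine(3)[OF G, of 1 a "a' - a"] at_pole(1)[OF pa'] by simp
    with da' at_pole(3)[OF pa'] show False by simp
  qed
  obtain m n :: int where mn: "a + of_int m * w1 + of_int n * w2 \<in> period_parallelogram w1 w2"
    using period_parallelogram_repr[OF w(3,4)] .
  obtain m' n' :: int where mn': "a' + of_int m' * w1 + of_int n' * w2 \<in> period_parallelogram w1 w2"
    using period_parallelogram_repr[OF w(3,4)] .
  define v v' where "v = of_int m * w1 + of_int n * w2" and "v' = of_int m' * w1 + of_int n' * w2"
  have v: "v \<in> period_group F" "v' \<in> period_group F"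
    using period_group_of_int[OF w(1)] period_group_of_int[OF w(2)]
    by (simp_all add: v_def v'_def period_group_def add.assoc[symmetric])
  define par where "par = period_parallelogram w1 w2"
  have in_par: "a + v \<in> par" "a' + v' \<in> par"
    using mn mn' by (simp_all add: v_def v'_def par_def add.assoc)
  have poles: "is_pole F (a + v)" "is_pole F (a' + v')"
    using pa pa' v by (simp_all add: period_group_is_pole)
  have neg: "- y \<in> period_group F" if "y \<in> period_group F" for y
    using period_group_diff[of 0 F y] that by (simp add: period_group_def)
  have add: "y + y' \<in> period_group F" if "y \<in> period_group F" "y' \<in> period_group F" for y y'
    using period_group_diff[OF that(1) neg[OF that(2)]] by simp
  have distinct: "a + v \<noteq> a' + v'"
  proof
    assume "a + v = a' + v'"
    hence "a' - a = v - v'" by (simp add: algebra_simps)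
    with period_group_diff[OF v] \<open>a' - a \<notin> period_group F\<close> show False by simp
  qed
  \<comment> \<open>Congruent points of the half-open parallelogram coincide. This requires w1 and
    w2 to generate all periods, not merely a sublattice, in which case poles would be counted
    repeatedly.\<close>
  have same: "z = b + u" if u: "z \<in> par" "b + u \<in> par" "z - b \<in> period_group F" "u \<in> period_group F" for z b u
  proof -
    obtain k l :: int where "z - b - u = of_int k * w1 + of_int l * w2"
      using w(5)[OF period_group_diff[OF u(3,4)]] by blast
    hence "z = (b + u) + of_int k * w1 + of_int l * w2"
      by (simp add: algebra_simps)
    thus ?thesis
      using period_parallelogram_unique[OF w(3,4)] u(1,2) unfolding par_def by blast
  qed
  have S: "{z \<in> par. is_pole F z} = {a + v, a' + v'}"
  proof (intro equalityI subsetI)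
    fix z assume "z \<in> {z \<in> par. is_pole F z}"
    hence z: "z \<in> par" "is_pole F z" by auto
    have "(deriv G z)\<^sup>2 = (deriv G a)\<^sup>2"
      using at_pole(4)[OF z(2)] at_pole(4)[OF pa] by simp
    hence "deriv G z = deriv G a \<or> deriv G z = deriv G a'"
      using da' by (auto simp: power2_eq_iff)
    thus "z \<in> {a + v, a' + v'}"
      using same[OF z(1) in_par(1) period[OF z(2) pa] v(1)] same[OF z(1) in_par(2) period[OF z(2) pa'] v(2)] by blast
  qed (use in_par poles in auto)
  show "elliptic_order_two F"
    unfolding elliptic_order_two_def
  proof (intro conjI exI)
    show "\<forall>z. F (z + w1) = F z \<and> F (z + w2) = F z"
      using w(1,2) by (simp add: period_group_def)
    show "finite {z \<in> period_parallelogram w1 w2. is_pole F z}"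
      using S by (simp add: par_def)
    show "(\<Sum>z \<in> {z \<in> period_parallelogram w1 w2. is_pole F z}. - zorder F z) = 2"
      using S distinct at_pole(5) poles by (simp add: par_def)
  qed (use nice w in auto)
qed

section \<open>Real solutions\<close>

lemma poly_map_poly_of_real: "poly (map_poly complex_of_real p) (of_real x) = of_real (poly p x)"
  by (induction p) (simp_all add: map_poly_pCons)

lemma pderiv_map_poly_of_real: "pderiv (map_poly complex_of_real p) = map_poly of_real (pderiv p)"
  by (rule poly_eqI) (simp add: coeff_pderiv coeff_map_poly)

lemma poly_quartic_factored:
  "poly (smult a ([:- e1, 1:] * [:- e2, 1:] * [:- e3, 1:] * [:- e4, 1:])) z =
    a * ((z - e1) * (z - e2) * (z - e3) * (z - e4))" for z :: "'a::comm_ring_1"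
  by (simp add: algebra_simps)

lemma nondegenerate_quartic_factors:
  assumes "nondegenerate_quartic P"
  obtains a e1 e2 e3 e4 where "a \<noteq> 0" "distinct [e1, e2, e3, e4]"
    "map_poly complex_of_real P = smult a ([:- e1, 1:] * [:- e2, 1:] * [:- e3, 1:] * [:- e4, 1:])"
proof -
  define Q where "Q = map_poly complex_of_real P"
  have deg: "degree Q = 4" and card: "card {z. poly Q z = 0} = 4"
    using assms by (simp_all add: nondegenerate_quartic_def Q_def degree_map_poly)
  obtain r where r: "smult (lead_coeff Q) (\<Prod>i<degree Q. [:- r i, 1:]) = Q"
    using complex_poly_decompose' .
  have Q: "Q = smult (lead_coeff Q) ([:- r 0, 1:] * [:- r 1, 1:] * [:- r 2, 1:] * [:- r 3, 1:])"
    by (subst r[symmetric]) (simp add: deg eval_nat_numeral lessThan_Suc mult_ac)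
  have "Q \<noteq> 0"
    using deg by auto
  hence a: "lead_coeff Q \<noteq> 0"
    by simp
  have "poly Q z = lead_coeff Q * ((z - r 0) * (z - r 1) * (z - r 2) * (z - r 3))" for z
    using arg_cong[OF Q, of "\<lambda>q. poly q z"] unfolding poly_quartic_factored .
  hence "{z. poly Q z = 0} = set [r 0, r 1, r 2, r 3]"
    using a by auto
  hence "card (set [r 0, r 1, r 2, r 3]) = length [r 0, r 1, r 2, r 3]"
    using card by simp
  hence "distinct [r 0, r 1, r 2, r 3]"
    by (rule card_distinct)
  thus ?thesis
    using that a Q unfolding Q_def by blast
qed

text \<open>Over the complex numbers P splits into four distinct linear factors, so no root, real or
  not, is shared with P'.\<close>

lemma nondegenerate_quartic_simple_root:
  assumes P: "nondegenerate_quartic P" and x: "poly P x = 0"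
  shows "poly (pderiv P) x \<noteq> 0"
proof
  assume "poly (pderiv P) x = 0"
  obtain a e1 e2 e3 e4 where a: "a \<noteq> 0" and e: "distinct [e1, e2, e3, e4]"
    and Q: "map_poly complex_of_real P = smult a ([:- e1, 1:] * [:- e2, 1:] * [:- e3, 1:] * [:- e4, 1:])"
    using nondegenerate_quartic_factors[OF P] .
  define z where "z = complex_of_real x"
  have "poly (map_poly of_real P) z = 0" "poly (pderiv (map_poly of_real P)) z = 0"
    unfolding z_def pderiv_map_poly_of_real poly_map_poly_of_real using x \<open>poly (pderiv P) x = 0\<close> by auto
  hence "(z - e1) * (z - e2) * (z - e3) * (z - e4) = 0"
    "(z - e1) * (z - e2) * (z - e3) + (z - e4) * ((z - e1) * (z - e2) + (z - e3) * ((z - e1) + (z - e2))) = 0"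
    unfolding Q using a by (simp_all add: pderiv_smult pderiv_mult pderiv_pCons del: mult_pCons_left mult_pCons_right)
  thus False
    using e by auto
qed

lemma elliptic_solution_initial_value:
  assumes P: "nondegenerate_quartic P" and y0: "y0\<^sup>2 = poly (map_poly complex_of_real P) x0"
  obtains f where "autonomous_solution (map_poly complex_of_real P) f" "elliptic_order_two f"
    "\<not> is_pole f t0" "f t0 = x0" "deriv f t0 = y0"
proof -
  obtain a e1 e2 e3 e4 where a: "a \<noteq> 0" and e: "distinct [e1, e2, e3, e4]"
    and Q: "map_poly complex_of_real P = smult a ([:- e1, 1:] * [:- e2, 1:] * [:- e3, 1:] * [:- e4, 1:])"
    using nondegenerate_quartic_factors[OF P] .
  define R where "R = map_poly complex_of_real P"
  have deg: "degree R = 4"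
    using P by (simp add: R_def nondegenerate_quartic_def degree_map_poly)
  obtain F x1 x2 x4 where F: "autonomous_solution R F"
    and x: "\<not> is_pole F x1" "F x1 = e1" "\<not> is_pole F x2" "F x2 = e2" "\<not> is_pole F x4" "F x4 = e4"
    unfolding R_def Q using quartic_solution_exists[OF a e] by metis
  have root: "poly R e1 = 0" "poly R e2 = 0" "poly R e4 = 0"
    by (simp_all add: R_def Q poly_quartic_factored del: mult_pCons_left mult_pCons_right)
  \<comment> \<open>Stated for an arbitrary solution attaining the three roots, so that it applies
    again after the change of time without transporting the lattice.\<close>
  have ell: "elliptic_order_two f \<and> (\<exists>z. \<not> is_pole f z \<and> f z = v)"
    if f: "autonomous_solution R f" and "\<not> is_pole f u1" "f u1 = e1" "\<not> is_pole f u2" "f u2 = e2" "\<not> is_pole f u4" "f u4 = e4"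
    for f u1 u2 u4 v
    using quartic_solution_elliptic(1)[OF f deg, of u1 u2 u4] quartic_solution_elliptic(2)[OF f deg, of u1 u2 u4 v]
      that root e by auto
  obtain z0 where z0: "\<not> is_pole F z0" "F z0 = x0"
    using ell[OF F x] by blast
  have "(deriv F z0)\<^sup>2 = y0\<^sup>2"
    using F z0 y0 by (simp add: autonomous_solution_def R_def)
  \<comment> \<open>c is 1 or -1: reversing time if necessary gives the derivative its prescribed
    sign and leaves the equation unchanged.\<close>
  then obtain c :: complex where c: "c * deriv F z0 = y0" "c\<^sup>2 = 1"
    by (metis minus_minus mult_1 mult_minus1 power2_eq_iff power2_minus power_one)
  have c0: "c \<noteq> 0" using c by auto
  define b where "b = z0 - c * t0"
  define f where "f z = F (c * z + b)" for z
  have f: "autonomous_solution R f" "is_pole f z \<longleftrightarrow> is_pole F (c * z + b)"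
    "\<not> is_pole F (c * z + b) \<Longrightarrow> deriv f z = c * deriv F (c * z + b)" for z
    using autonomous_solution_affine[OF F c0, of b] autonomous_solution_affine(3)[OF F c0, of z b] c
    unfolding f_def[abs_def] by auto
  have t0: "c * t0 + b = z0"
    by (simp add: b_def)
  have inv: "c * ((u - b) / c) + b = u" for u
    using c0 by simp
  have "elliptic_order_two f"
    by (rule ell[THEN conjunct1, OF f(1), of "(x1 - b) / c" "(x2 - b) / c" "(x4 - b) / c"])
       (simp_all only: f(2) f_def inv x simp_thms)
  moreover have "\<not> is_pole f t0" "f t0 = x0" "deriv f t0 = y0"
    using z0 c f(2)[of t0] f(3)[of t0] by (simp_all add: t0 f_def)
  ultimately show ?thesis
    using that f(1) unfolding R_def by blast
qed

lemma islimpt_isCont_eq_zero: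
  fixes h :: "'a::t2_space \<Rightarrow> 'b::real_normed_vector"
  assumes "t islimpt S" "isCont h t" "\<And>s. s \<in> S \<Longrightarrow> h s = 0"
  shows "h t = 0"
proof (rule ccontr)
  assume "h t \<noteq> 0"
  hence "\<forall>\<^sub>F s in at t. h s \<noteq> 0"
    using assms(2) by (auto simp: isCont_def intro: tendsto_imp_eventually_ne)
  hence "\<forall>\<^sub>F s in at t. s \<notin> S"
    by eventually_elim (use assms(3) in auto)
  with assms(1) show False
    by (simp add: islimpt_conv_frequently_at frequently_def)
qed

text \<open>A solution of the first-order equation could rest at a root of \<open>P\<close> for a while; since the
  roots are simple, this would make the second derivative jump.\<close>

lemma real_second_order_from_first_order:
  fixes x :: "real \<Rightarrow> real"
  assumes I: "open I" "is_interval I"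
    and x': "\<And>t. t \<in> I \<Longrightarrow> (x has_real_derivative x' t) (at t)"
    and x'': "\<And>t. t \<in> I \<Longrightarrow> (x' has_real_derivative x'' t) (at t)"
    and cont: "\<And>t. t \<in> I \<Longrightarrow> isCont x'' t"
    and ode: "\<And>t. t \<in> I \<Longrightarrow> (x' t)\<^sup>2 = poly P (x t)"
    and simple: "\<And>v. poly P v = 0 \<Longrightarrow> poly (pderiv P) v \<noteq> 0"
    and nc: "\<not> x constant_on I" and t: "t \<in> I"
  shows "2 * x'' t = poly (pderiv P) (x t)"
proof -
  define k where "k t = 2 * x'' t - poly (pderiv P) (x t)" for t
  define N where "N = {t \<in> I. k t \<noteq> 0}"
  have contx: "isCont x t" "isCont x' t" if "t \<in> I" for t
    using x'[OF that] x''[OF that] by (auto intro: DERIV_isCont)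
  have contk: "isCont k t" if "t \<in> I" for t
    unfolding k_def[abs_def] using cont[OF that] contx[OF that] by (auto intro!: continuous_intros)
  have prod: "x' t * k t = 0" if t: "t \<in> I" for t
  proof -
    have "((\<lambda>t. poly P (x t)) has_real_derivative poly (pderiv P) (x t) * x' t) (at t)"
      by (rule DERIV_chain2[OF poly_DERIV x'[OF t]])
    hence "((\<lambda>t. (x' t)\<^sup>2) has_real_derivative poly (pderiv P) (x t) * x' t) (at t)"
      by (rule has_field_derivative_transform_within_open[OF _ I(1) t]) (simp add: ode)
    moreover have "((\<lambda>t. (x' t)\<^sup>2) has_real_derivative 2 * x' t * x'' t) (at t)"
      by (auto intro!: derivative_eq_intros x''[OF t])
    ultimately have "poly (pderiv P) (x t) * x' t = 2 * x' t * x'' t"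
      using DERIV_unique by blast
    thus ?thesis by (auto simp: k_def algebra_simps)
  qed
  have "continuous_on I k"
    using contk by (simp add: continuous_at_imp_continuous_on)
  hence openN: "open N"
    using continuous_open_preimage[OF _ I(1) open_Compl[OF closed_singleton], of k 0]
    by (simp add: N_def vimage_def Int_def)
  have x'0: "x' t = 0" if "t \<in> N" for t
    using prod[of t] that by (auto simp: N_def)
  have x''0: "x'' t = 0" if t: "t \<in> N" for t
  proof -
    have "((\<lambda>_. 0) has_real_derivative x'' t) (at t)"
      by (rule has_field_derivative_transform_within_open[OF x'' openN t])
         (use t x'0 in \<open>auto simp: N_def\<close>)
    thus ?thesis
      using DERIV_unique[OF DERIV_const] by metis
  qed
  \<comment> \<open>On \<open>N\<close> both x' and x'' vanish, hence also at its limit points.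
    There x(t) is a root of P, and its simplicity gives k(t) = -P'(x(t)), which is nonzero. So
    \<open>N\<close> is clopen, and \<open>N = I\<close> would make x constant.\<close>
  have closedN: "t \<in> N" if t: "t islimpt N" "t \<in> I" for t
  proof -
    have "x' t = 0" "x'' t = 0"
      using islimpt_isCont_eq_zero[OF t(1) contx(2)[OF t(2)] x'0] islimpt_isCont_eq_zero[OF t(1) cont[OF t(2)] x''0]
      by auto
    moreover from this have "poly (pderiv P) (x t) \<noteq> 0"
      using ode[OF t(2)] by (intro simple) simp
    ultimately show ?thesis
      using t by (simp add: N_def k_def)
  qed
  have "connected I"
    using I(2) by (simp add: is_interval_connected)
  moreover have "openin (top_of_set I) N" "closedin (top_of_set I) N"
    using openN closedN by (auto simp: openin_open_eq[OF I(1)] closedin_limpt N_def)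
  ultimately have "N = {} \<or> N = I"
    unfolding connected_clopen by blast
  moreover have "N \<noteq> I"
  proof
    assume "N = I"
    hence "(x has_real_derivative 0) (at t)" if "t \<in> I" for t
      using x'[OF that] x'0 that by simp
    hence "x constant_on I"
      using \<open>connected I\<close> I(1) by (intro has_field_derivative_0_imp_constant_on)
    with nc show False ..
  qed
  ultimately show ?thesis
    using t by (auto simp: N_def k_def)
qed

text \<open>An elliptic solution with the same initial data at one time is followed along the
  interval: the times of agreement in value and derivative form a set that is open by uniqueness and
  closed by continuity.\<close>

lemma real_solution_elliptic:
  fixes x :: "real \<Rightarrow> real"
  assumes I: "open I" "is_interval I"
    and x': "\<And>t. t \<in> I \<Longrightarrow> (x has_real_derivative x' t) (at t)"
    and x'': "\<And>t. t \<in> I \<Longrightarrow> (x' has_real_derivative x'' t) (at t)"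
    and cont: "\<And>t. t \<in> I \<Longrightarrow> isCont x'' t"
    and ode: "\<And>t. t \<in> I \<Longrightarrow> (x' t)\<^sup>2 = poly P (x t)"
    and P: "nondegenerate_quartic P" and nc: "\<not> x constant_on I"
  shows "restriction_of_elliptic_order_two I x"
proof -
  define R where "R = map_poly complex_of_real P"
  obtain t0 where t0: "t0 \<in> I"
    using nc by (auto simp: constant_on_def)
  have "(complex_of_real (x' t0))\<^sup>2 = poly R (of_real (x t0))"
    using ode[OF t0] unfolding R_def poly_map_poly_of_real by (metis of_real_power)
  then obtain f where f: "autonomous_solution R f" "elliptic_order_two f"
    and f0: "\<not> is_pole f (of_real t0)" "f (of_real t0) = of_real (x t0)" "deriv f (of_real t0) = of_real (x' t0)"
    unfolding R_def using elliptic_solution_initial_value[OF P] by metis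
  have nice: "f nicely_meromorphic_on UNIV"
    using f by (simp add: autonomous_solution_def)
  note reg = nicely_meromorphic_regular_set[OF nice]
  have an: "f analytic_on {z}" if "\<not> is_pole f z" for z
    using nicely_meromorphic_on_imp_analytic_at[OF nice UNIV_I that] .
  define p where "p = smult (1 / 2) (pderiv R)"
  have xode: "of_real (x'' t) = poly p (of_real (x t))" if "t \<in> I" for t
  proof -
    have "2 * x'' t = poly (pderiv P) (x t)"
      using I x' x'' cont ode nondegenerate_quartic_simple_root[OF P] nc that
      by (rule real_second_order_from_first_order)
    hence "of_real (2 * x'' t) = poly (pderiv R) (of_real (x t))"
      unfolding R_def pderiv_map_poly_of_real poly_map_poly_of_real by simp
    thus ?thesis
      by (simp add: p_def mult.commute)
  qed
  define T where "T = {t \<in> I. \<not> is_pole f (of_real t) \<and> f (of_real t) = of_real (x t) \<and> deriv f (of_real t) = of_real (x' t)}"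
  have openT: "\<exists>d>0. ball t d \<subseteq> T" if t: "t \<in> T" for t
  proof -
    have tI: "t \<in> I" and tp: "of_real t \<in> {z. \<not> is_pole f z}"
      using t by (auto simp: T_def)
    obtain d1 where d1: "d1 > 0" "ball t d1 \<subseteq> I"
      using I(1) tI openE by blast
    obtain d2 where d2: "d2 > 0" "ball (complex_of_real t) d2 \<subseteq> {z. \<not> is_pole f z}"
      using reg(1) tp openE by blast
    \<comment> \<open>Halving keeps the closed interval around \<open>t\<close>, on which uniqueness
      is applied, inside both open balls.\<close>
    define d where "d = min d1 d2 / 2"
    have d: "d > 0" using d1 d2 by (simp add: d_def)
    have inI: "s \<in> I" and np: "\<not> is_pole f (of_real s)" if "s \<in> {t - d..t + d}" for s
    proof -
      have "dist t s \<le> d" using that by (auto simp: dist_real_def)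
      hence "dist t s < d1" "dist t s < d2" using d1 d2 by (auto simp: d_def)
      moreover have "dist (complex_of_real t) (of_real s) = dist t s"
        by (simp add: dist_norm dist_real_def flip: of_real_diff)
      ultimately show "s \<in> I" "\<not> is_pole f (of_real s)"
        using d1(2) d2(2) by (auto simp: subset_iff)
    qed
    have match: "of_real (x s) = f (of_real s) \<and> of_real (x' s) = deriv f (of_real s)" if s: "s \<in> {t - d..t + d}" for s
    proof (rule second_order_ode_unique[of "t - d" "t + d" "\<lambda>s. complex_of_real (x s)" "\<lambda>s. of_real (x' s)" p
        "\<lambda>s. f (of_real s)" "\<lambda>s. deriv f (of_real s)" t s])
      fix s assume s: "s \<in> {t - d..t + d}"
      note D = autonomous_solution_derivs[OF f(1) an[OF np[OF s]]]
      show "((\<lambda>s. complex_of_real (x s)) has_vector_derivative of_real (x' s)) (at s)"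
        using x'[OF inI[OF s]] by (simp add: has_vector_derivative_of_real)
      show "((\<lambda>s. complex_of_real (x' s)) has_vector_derivative poly p (of_real (x s))) (at s)"
        using x''[OF inI[OF s]] xode[OF inI[OF s]] has_vector_derivative_of_real by metis
      show "((\<lambda>s. f (of_real s)) has_vector_derivative deriv f (of_real s)) (at s)"
        by (rule has_vector_derivative_real_field[OF D(1)])
      show "((\<lambda>s. deriv f (of_real s)) has_vector_derivative poly p (f (of_real s))) (at s)"
        using has_vector_derivative_real_field[OF D(2)] by (simp add: p_def)
    next
      show "complex_of_real (x t) = f (of_real t)" "complex_of_real (x' t) = deriv f (of_real t)"
        using t unfolding T_def by simp_all
      show "t \<in> {t - d..t + d}" "s \<in> {t - d..t + d}"
        using d s by simp_all
    qed
    have "ball t d \<subseteq> T"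
    proof
      fix s assume "s \<in> ball t d"
      hence s: "s \<in> {t - d..t + d}"
        by (auto simp: dist_real_def)
      show "s \<in> T"
        using inI[OF s] np[OF s] match[OF s] by (simp add: T_def)
    qed
    thus ?thesis using d by blast
  qed
  have closedT: "t \<in> T" if t: "t islimpt T" "t \<in> I" for t
  proof -
    have lim: "filterlim complex_of_real (at (of_real t)) (at t)"
      by (rule filterlim_atI) (auto intro!: tendsto_intros simp: eventually_at_filter)
    have contx: "isCont x t" "isCont x' t"
      using x'[OF t(2)] x''[OF t(2)] by (auto intro: DERIV_isCont)
    \<comment> \<open>On \<open>T\<close> the values of f are those of x, which stay bounded near
      \<open>t\<close>; at a pole they would tend to infinity.\<close>
    have np: "\<not> is_pole f (of_real t)"
    proof
      assume "is_pole f (of_real t)"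
      hence "filterlim (\<lambda>s. f (of_real s)) at_infinity (at t)"
        unfolding is_pole_def by (rule filterlim_compose[OF _ lim])
      hence "\<forall>\<^sub>F s in at t. norm (f (of_real s)) \<ge> \<bar>x t\<bar> + 1"
        unfolding filterlim_at_infinity[OF order_refl] by (auto dest!: spec[of _ "\<bar>x t\<bar> + 1"])
      moreover have "((\<lambda>s. \<bar>x s\<bar>) \<longlongrightarrow> \<bar>x t\<bar>) (at t)"
        using contx(1) by (intro tendsto_intros) (simp add: isCont_def)
      hence "\<forall>\<^sub>F s in at t. \<bar>x s\<bar> < \<bar>x t\<bar> + 1"
        by (rule order_tendstoD) simp
      ultimately have "\<forall>\<^sub>F s in at t. s \<notin> T"
        by eventually_elim (auto simp: T_def)
      with t(1) show False
        by (simp add: islimpt_conv_frequently_at frequently_def)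
    qed
    have c1: "isCont f (of_real t)" and c2: "isCont (deriv f) (of_real t)"
      using an[OF np] analytic_deriv[OF an[OF np]] by (auto intro: analytic_at_imp_isCont)
    have c: "isCont (\<lambda>s. f (of_real s) - of_real (x s)) t" "isCont (\<lambda>s. deriv f (of_real s) - of_real (x' s)) t"
      by (intro continuous_intros contx isCont_o2[where f = of_real and g = f]
          isCont_o2[where f = of_real and g = "deriv f"] c1 c2)+
    have "f (of_real t) - of_real (x t) = 0" "deriv f (of_real t) - of_real (x' t) = 0"
      by (rule islimpt_isCont_eq_zero[OF t(1) c(1)], simp add: T_def)
         (rule islimpt_isCont_eq_zero[OF t(1) c(2)], simp add: T_def)
    thus ?thesis
      using np t by (simp add: T_def)
  qed
  have "open T"
    using openT by (meson openI open_contains_ball)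
  moreover have "T \<subseteq> I"
    by (auto simp: T_def)
  ultimately have "openin (top_of_set I) T" "closedin (top_of_set I) T"
    using closedT by (simp_all add: openin_open_eq[OF I(1)]) (auto simp: closedin_limpt)
  moreover have "connected I"
    using I(2) by (simp add: is_interval_connected)
  moreover have "t0 \<in> T"
    using t0 f0 by (simp add: T_def)
  ultimately have "T = I"
    unfolding connected_clopen by blast
  thus ?thesis
    unfolding restriction_of_elliptic_order_two_def using f(2) by (intro exI[of _ f]) (auto simp: T_def)
qed

section \<open>The Heun Hamiltonian\<close>

lemma Ck_on_cong:
  assumes "open S" "\<And>x. x \<in> S \<Longrightarrow> f x = g x"
  shows "Ck_on k f S \<longleftrightarrow> Ck_on k g S"
  using assms(2)
proof (induction k arbitrary: f g)
  case 0
  thus ?case by (simp cong: continuous_on_cong)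
next
  case (Suc k)
  have "v differentiable at x" if "u differentiable at x" "\<And>x. x \<in> S \<Longrightarrow> u x = v x" "x \<in> S" for u v :: "'a \<Rightarrow> 'b" and x
  proof -
    from that(1) obtain D where "(u has_derivative D) (at x)"
      unfolding differentiable_def by blast
    hence "(v has_derivative D) (at x)"
      by (rule has_derivative_transform_within_open[OF _ assms(1) that(3)]) (rule that(2))
    thus ?thesis
      unfolding differentiable_def by blast
  qed
  note tr = this
  have d: "f differentiable at x \<longleftrightarrow> g differentiable at x" if "x \<in> S" for x
    using tr[of f x g] tr[of g x f] Suc.prems that by metis
  have "frechet_derivative f (at x) = frechet_derivative g (at x)" if "x \<in> S" "f differentiable at x" for x
    by (rule frechet_derivative_transform_within_open[OF that(2) assms(1) that(1)]) (rule Suc.prems)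
  hence "Ck_on k (\<lambda>x. frechet_derivative f (at x) v) S = Ck_on k (\<lambda>x. frechet_derivative g (at x) v) S"
    if "\<forall>x\<in>S. f differentiable at x" for v
    using that by (intro Suc.IH) simp
  thus ?case
    using d unfolding Ck_on.simps by blast
qed

lemma Ck_on_Suc_imp: "Ck_on (Suc k) f S \<Longrightarrow> Ck_on k f S"
proof (induction k arbitrary: f)
  case 0
  thus ?case
    by (auto intro!: continuous_at_imp_continuous_on differentiable_imp_continuous_within)
next
  case (Suc k)
  thus ?case
    by (subst Ck_on.simps) (use Suc.prems in \<open>auto simp del: Ck_on.simps(2) intro: Suc.IH simp: Ck_on.simps(2)[of "Suc k"]\<close>)
qed

lemma Ck_on_const: "Ck_on k (\<lambda>_. c) S"
  by (induction k arbitrary: c) (auto simp: frechet_derivative_const)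

lemma Ck_on_add:
  assumes S: "open S" and "Ck_on k f S" "Ck_on k g S"
  shows "Ck_on k (\<lambda>x. f x + g x) S"
  using assms(2,3)
proof (induction k arbitrary: f g)
  case 0
  thus ?case by (auto intro: continuous_on_add)
next
  case (Suc k)
  have d: "f differentiable at x" "g differentiable at x" if "x \<in> S" for x
    using Suc.prems that by auto
  have "Ck_on k (\<lambda>x. frechet_derivative (\<lambda>x. f x + g x) (at x) v) S" for v
  proof -
    have "Ck_on k (\<lambda>x. frechet_derivative f (at x) v + frechet_derivative g (at x) v) S"
      using Suc by auto
    moreover have "frechet_derivative (\<lambda>x. f x + g x) (at x) v =
        frechet_derivative f (at x) v + frechet_derivative g (at x) v" if "x \<in> S" for x
    proof -
      have "((\<lambda>x. f x + g x) has_derivative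
          (\<lambda>v. frechet_derivative f (at x) v + frechet_derivative g (at x) v)) (at x)"
        using d[OF that] by (intro has_derivative_add) (simp_all add: frechet_derivative_works)
      from frechet_derivative_at[OF this] show ?thesis by metis
    qed
    ultimately show ?thesis
      using Ck_on_cong[OF S, of "\<lambda>x. frechet_derivative (\<lambda>x. f x + g x) (at x) v"] by simp
  qed
  thus ?case using d by auto
qed

lemma Ck_on_mult:
  fixes f g :: "'a::real_normed_vector \<Rightarrow> real"
  assumes S: "open S" and "Ck_on k f S" "Ck_on k g S"
  shows "Ck_on k (\<lambda>x. f x * g x) S"
  using assms(2,3)
proof (induction k arbitrary: f g)
  case 0
  thus ?case by (auto intro: continuous_on_mult)
next
  case (Suc k)
  have d: "f differentiable at x" "g differentiable at x" if "x \<in> S" for x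
    using Suc.prems that by auto
  have "Ck_on k (\<lambda>x. frechet_derivative (\<lambda>x. f x * g x) (at x) v) S" for v
  proof -
    \<comment> \<open>The product rule contains undifferentiated factors, so the induction also
      needs \<open>f\<close> and \<open>g\<close> themselves to be C^k, one order below what is
      assumed.\<close>
    have "Ck_on k (\<lambda>x. f x * frechet_derivative g (at x) v + frechet_derivative f (at x) v * g x) S"
      using Suc.prems Ck_on_Suc_imp[OF Suc.prems(1)] Ck_on_Suc_imp[OF Suc.prems(2)]
      by (intro Ck_on_add[OF S] Suc.IH) simp_all
    moreover have "frechet_derivative (\<lambda>x. f x * g x) (at x) v =
        f x * frechet_derivative g (at x) v + frechet_derivative f (at x) v * g x" if "x \<in> S" for x
    proof -
      have "((\<lambda>x. f x * g x) has_derivative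
          (\<lambda>v. f x * frechet_derivative g (at x) v + frechet_derivative f (at x) v * g x)) (at x)"
        using d[OF that] by (intro has_derivative_mult) (simp_all add: frechet_derivative_works)
      from frechet_derivative_at[OF this] show ?thesis by metis
    qed
    ultimately show ?thesis
      using Ck_on_cong[OF S, of "\<lambda>x. frechet_derivative (\<lambda>x. f x * g x) (at x) v"] by simp
  qed
  thus ?case using d by auto
qed

section \<open>Smooth functions and brackets with the Heun observable\<close>

context
  fixes M :: "'m topology" and \<A> :: "('m set \<times> ('m \<Rightarrow> 'e::euclidean_space)) set"
  assumes M: "smooth_manifold M \<A>"
begin

lemma smooth_manifold_chart_open: "(U, \<phi>) \<in> \<A> \<Longrightarrow> open (\<phi> ` U)"
  using M by (auto simp: smooth_manifold_def is_chart_def)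

lemma smooth_function_const: "smooth_function \<A> (\<lambda>_. c)"
  by (auto simp: smooth_function_def smooth_on_def o_def Ck_on_const)

lemma smooth_function_add:
  "smooth_function \<A> F \<Longrightarrow> smooth_function \<A> G \<Longrightarrow> smooth_function \<A> (\<lambda>x. F x + G x)"
  using smooth_manifold_chart_open
  by (fastforce simp: smooth_function_def smooth_on_def o_def intro: Ck_on_add)

lemma smooth_function_mult:
  "smooth_function \<A> F \<Longrightarrow> smooth_function \<A> G \<Longrightarrow> smooth_function \<A> (\<lambda>x. F x * G x)"
  using smooth_manifold_chart_open
  by (fastforce simp: smooth_function_def smooth_on_def o_def intro: Ck_on_mult)

end

lemma heun_observable_brackets:
  assumes ps: "phase_space M \<A> br" and lp: "classical_leonard_pair M \<A> br \<alpha> X Y"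
    and W_def: "W = heun_observable br \<tau>0 \<tau>1 \<tau>2 \<tau>3 \<tau>4 X Y"
  defines "Z \<equiv> br X Y"
  shows "smooth_function \<A> W"
    "\<And>m. m \<in> topspace M \<Longrightarrow>
      br X W m = (\<tau>1 * X m + \<tau>4) * Z m + \<tau>2 * (1 / 2 * Phi_Y \<alpha> (X m) (Y m))"
    "\<And>m. m \<in> topspace M \<Longrightarrow>
      br Y W m = - ((\<tau>1 * Y m + \<tau>3) * Z m + \<tau>2 * (1 / 2 * Phi_X \<alpha> (X m) (Y m)))"
proof -
  have M: "smooth_manifold M \<A>" and pb: "poisson_bracket M \<A> br"
    using ps by (auto simp: phase_space_def)
  have X: "smooth_function \<A> X" and Y: "smooth_function \<A> Y"
    and rel: "\<And>m. m \<in> topspace M \<Longrightarrow> br X Z m = 1 / 2 * Phi_Y \<alpha> (X m) (Y m) \<and> br Z Y m = 1 / 2 * Phi_X \<alpha> (X m) (Y m)"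
    using lp by (auto simp: classical_leonard_pair_def Z_def Let_def)
  have smooth: "smooth_function \<A> F \<Longrightarrow> smooth_function \<A> G \<Longrightarrow> smooth_function \<A> (br F G)" for F G
    by (rule pb[unfolded poisson_bracket_def, THEN conjunct2, THEN conjunct1, rule_format])
  have anti: "br F G m = - br G F m"
    if "smooth_function \<A> F" "smooth_function \<A> G" "m \<in> topspace M" for F G m
    by (rule pb[unfolded poisson_bracket_def, THEN conjunct2, THEN conjunct2, THEN conjunct1, rule_format, OF that])
  have lin: "br (\<lambda>x. a * F x + b * G x) H m = a * br F H m + b * br G H m"
    if "smooth_function \<A> F" "smooth_function \<A> G" "smooth_function \<A> H" "m \<in> topspace M" for F G H a b m
    by (rule pb[unfolded poisson_bracket_def, THEN conjunct2, THEN conjunct2, THEN conjunct2, THEN conjunct1, rule_format, OF that])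
  have leib: "br (\<lambda>x. F x * G x) H m = F m * br G H m + br F H m * G m"
    if "smooth_function \<A> F" "smooth_function \<A> G" "smooth_function \<A> H" "m \<in> topspace M" for F G H m
    by (rule pb[unfolded poisson_bracket_def, THEN conjunct2, THEN conjunct2, THEN conjunct2, THEN conjunct2, THEN conjunct1, rule_format, OF that])
  have Z: "smooth_function \<A> Z"
    unfolding Z_def by (rule smooth[OF X Y])
  show W: "smooth_function \<A> W"
    unfolding W_def heun_observable_def Z_def[symmetric]
    by (intro smooth_function_const[OF M] smooth_function_add[OF M] smooth_function_mult[OF M] X Y Z)
  \<comment> \<open>The Leibniz rule for 1 = 1 * 1 makes the bracket equal to twice itself.\<close>
  have one: "br (\<lambda>_. 1) H m = 0" if "smooth_function \<A> H" "m \<in> topspace M" for H m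
    using leib[of "\<lambda>_. 1" "\<lambda>_. 1" H m] that smooth_function_const[OF M, of 1] by simp
  have brW: "br W H m = \<tau>1 * (X m * br Y H m + br X H m * Y m) + \<tau>2 * br Z H m + \<tau>3 * br X H m + \<tau>4 * br Y H m"
    if H: "smooth_function \<A> H" and m: "m \<in> topspace M" for H m
  proof -
    \<comment> \<open>Linearity is available for combinations of two functions, hence the nested
      splitting; \<tau>0 enters as a multiple of the constant function 1.\<close>
    define A where "A x = X x * Y x" for x
    define B where "B x = \<tau>1 * A x + \<tau>2 * Z x" for x
    define C where "C x = \<tau>3 * X x + \<tau>4 * Y x" for x
    define D where "D x = 1 * B x + 1 * C x" for x
    have s: "smooth_function \<A> A" "smooth_function \<A> B" "smooth_function \<A> C" "smooth_function \<A> D"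
      unfolding A_def B_def C_def D_def
      by (intro smooth_function_const[OF M] smooth_function_add[OF M] smooth_function_mult[OF M] X Y Z)+
    have "W = (\<lambda>x. 1 * D x + \<tau>0 * 1)"
      by (simp add: W_def heun_observable_def A_def B_def C_def D_def Z_def fun_eq_iff)
    hence "br W H m = br D H m"
      using lin[OF s(4) smooth_function_const[OF M] H m, of 1 \<tau>0 1] one[OF H m] by simp
    also have "\<dots> = br B H m + br C H m"
      using lin[OF s(2) s(3) H m, of 1 1] unfolding D_def[abs_def] by simp
    also have "br B H m = \<tau>1 * br A H m + \<tau>2 * br Z H m"
      using lin[OF s(1) Z H m] unfolding B_def[abs_def] by simp
    also have "br C H m = \<tau>3 * br X H m + \<tau>4 * br Y H m"
      using lin[OF X Y H m] unfolding C_def[abs_def] by simp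
    also have "br A H m = X m * br Y H m + br X H m * Y m"
      using leib[OF X Y H m] unfolding A_def[abs_def] by simp
    finally show ?thesis by simp
  qed
  fix m assume m: "m \<in> topspace M"
  have "br X X m = 0" "br Y Y m = 0"
    using anti[OF X X m] anti[OF Y Y m] by auto
  moreover have "br Y X m = - Z m"
    using anti[OF Y X m] by (simp add: Z_def)
  moreover have "br Z X m = - br X Z m"
    by (rule anti[OF Z X m])
  ultimately show "br X W m = (\<tau>1 * X m + \<tau>4) * Z m + \<tau>2 * (1 / 2 * Phi_Y \<alpha> (X m) (Y m))"
    "br Y W m = - ((\<tau>1 * Y m + \<tau>3) * Z m + \<tau>2 * (1 / 2 * Phi_X \<alpha> (X m) (Y m)))"
    using anti[OF X W m] anti[OF Y W m] brW[OF X m] brW[OF Y m] rel[OF m]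
    by (simp_all add: Z_def[symmetric] algebra_simps)
qed

section \<open>Elimination of one Leonard observable and of Z\<close>

lemma Phi_transpose: "Phi \<alpha> x y = Phi (\<lambda>i j. \<alpha> j i) y x"
  unfolding Phi_def by (subst sum.swap) (simp add: mult_ac)

lemma Phi_X_transpose: "Phi_X \<alpha> x y = Phi_Y (\<lambda>i j. \<alpha> j i) y x"
  unfolding Phi_X_def Phi_Y_def by (simp add: Phi_transpose[of \<alpha>])

definition Phi_coeff :: "(nat \<Rightarrow> nat \<Rightarrow> real) \<Rightarrow> nat \<Rightarrow> real poly" where
  "Phi_coeff \<alpha> j = [:\<alpha> 0 j, \<alpha> 1 j, \<alpha> 2 j:]"

lemma Phi_eq_quadratic:
  "Phi \<alpha> x y = poly (Phi_coeff \<alpha> 2) x * y\<^sup>2 + poly (Phi_coeff \<alpha> 1) x * y + poly (Phi_coeff \<alpha> 0) x"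
  by (simp add: Phi_def Phi_coeff_def numeral_2_eq_2 power2_eq_square algebra_simps)

lemma Phi_Y_eq: "1 / 2 * Phi_Y \<alpha> x y = poly (Phi_coeff \<alpha> 2) x * y + poly (Phi_coeff \<alpha> 1) x / 2"
proof -
  have "((\<lambda>u. Phi \<alpha> x u) has_real_derivative (2 * poly (Phi_coeff \<alpha> 2) x * y + poly (Phi_coeff \<alpha> 1) x)) (at y)"
    unfolding Phi_eq_quadratic by (auto intro!: derivative_eq_intros)
  thus ?thesis
    by (simp add: Phi_Y_def DERIV_imp_deriv)
qed

text \<open>If \<open>z\<^sup>2 = A y\<^sup>2 + B y + C\<close> and \<open>K = L y + \<tau> z\<close>, this is \<open>(L z + \<tau> (A y + B / 2))\<^sup>2\<close>
  with \<open>y\<close> and \<open>z\<close> eliminated.\<close>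

definition heun_quartic ::
  "(nat \<Rightarrow> nat \<Rightarrow> real) \<Rightarrow> real \<Rightarrow> real poly \<Rightarrow> real poly \<Rightarrow> real poly" where
  "heun_quartic \<alpha> \<tau> K L = (let A = Phi_coeff \<alpha> 2; B = Phi_coeff \<alpha> 1; C = Phi_coeff \<alpha> 0 in
     A * K\<^sup>2 + L * B * K + L\<^sup>2 * C + smult (\<tau>\<^sup>2 / 4) (B\<^sup>2 - smult 4 (A * C)))"

lemma degree_heun_quartic:
  assumes "degree K \<le> 1" "degree L \<le> 1"
  shows "degree (heun_quartic \<alpha> \<tau> K L) \<le> 4"
proof -
  have c: "degree (Phi_coeff \<alpha> j) \<le> 2" for j
    by (simp add: Phi_coeff_def)
  have m: "degree (p * q) \<le> a + b" if "degree p \<le> a" "degree q \<le> b" for p q :: "real poly" and a b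
    using degree_mult_le[of p q] that by linarith
  have "degree (Phi_coeff \<alpha> 2 * (K * K)) \<le> 2 + (1 + 1)" "degree (L * Phi_coeff \<alpha> 1 * K) \<le> (1 + 2) + 1"
    "degree (L * L * Phi_coeff \<alpha> 0) \<le> (1 + 1) + 2" "degree (Phi_coeff \<alpha> 1 * Phi_coeff \<alpha> 1) \<le> 2 + 2"
    "degree (smult 4 (Phi_coeff \<alpha> 2 * Phi_coeff \<alpha> 0)) \<le> 2 + 2"
    by (intro m assms c order.trans[OF degree_smult_le])+
  thus ?thesis
    unfolding heun_quartic_def Let_def power2_eq_square
    by (intro degree_add_le order.trans[OF degree_smult_le] degree_diff_le) simp_all
qed

text \<open>Completing the square in y gives (A y + B/2)^2 = A z^2 + (B^2 - 4AC)/4. Together with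
  L^2 z^2 = L^2 (A y^2 + B y + C), the terms in y and z then assemble into A K^2 + L B K.\<close>

lemma poly_heun_quartic:
  assumes Z: "z\<^sup>2 = Phi \<alpha> x y" and K: "poly K x = poly L x * y + \<tau> * z"
  shows "(poly L x * z + \<tau> * (1 / 2 * Phi_Y \<alpha> x y))\<^sup>2 = poly (heun_quartic \<alpha> \<tau> K L) x"
proof -
  define a b c l where "a = poly (Phi_coeff \<alpha> 2) x" and "b = poly (Phi_coeff \<alpha> 1) x"
    and "c = poly (Phi_coeff \<alpha> 0) x" and "l = poly L x"
  have z2: "z\<^sup>2 = a * y\<^sup>2 + b * y + c"
    using Z by (simp add: Phi_eq_quadratic a_def b_def c_def)
  have "(l * z + \<tau> * (a * y + b / 2))\<^sup>2 = l\<^sup>2 * z\<^sup>2 + 2 * l * \<tau> * z * (a * y + b / 2) + \<tau>\<^sup>2 * (a * y + b / 2)\<^sup>2"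
    by (simp add: power2_eq_square algebra_simps)
  also have "\<dots> = a * (l\<^sup>2 * y\<^sup>2 + 2 * l * y * \<tau> * z + \<tau>\<^sup>2 * (a * y\<^sup>2 + b * y + c)) + l * b * (l * y + \<tau> * z) + l\<^sup>2 * c
      + \<tau>\<^sup>2 / 4 * (b\<^sup>2 - 4 * (a * c))"
    unfolding z2 by (simp add: power2_eq_square field_simps)
  also have "l\<^sup>2 * y\<^sup>2 + 2 * l * y * \<tau> * z + \<tau>\<^sup>2 * (a * y\<^sup>2 + b * y + c) = (l * y + \<tau> * z)\<^sup>2"
    unfolding z2[symmetric] by (simp add: power2_eq_square algebra_simps)
  finally show ?thesis
    unfolding Phi_Y_eq by (simp add: heun_quartic_def Let_def K l_def a_def b_def c_def)
qed

text \<open>Brackets with W stay smooth, so every observable is twice continuously differentiable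
  along a trajectory. This is the regularity that keeps a nonconstant solution from resting at a
  root.\<close>

lemma trajectory_bracket_derivatives:
  assumes ps: "phase_space M \<A> br" and W: "smooth_function \<A> W" and F: "smooth_function \<A> F"
    and tr: "trajectory M \<A> br W I \<gamma>" and t: "t \<in> I"
  shows "((\<lambda>s. F (\<gamma> s)) has_real_derivative br F W (\<gamma> t)) (at t)"
    "((\<lambda>s. br F W (\<gamma> s)) has_real_derivative br (br F W) W (\<gamma> t)) (at t)"
    "isCont (\<lambda>s. br (br F W) W (\<gamma> s)) t"
proof -
  have smooth: "smooth_function \<A> (br G W)" if "smooth_function \<A> G" for G
    using ps[unfolded phase_space_def poisson_bracket_def, THEN conjunct2, THEN conjunct2, THEN conjunct1, rule_format, OF that W] .
  have D: "((\<lambda>s. G (\<gamma> s)) has_real_derivative br G W (\<gamma> t)) (at t)" if "smooth_function \<A> G" for G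
    using tr[unfolded trajectory_def, THEN conjunct2, THEN conjunct2, THEN conjunct2, rule_format, OF that t] .
  show "((\<lambda>s. F (\<gamma> s)) has_real_derivative br F W (\<gamma> t)) (at t)"
    "((\<lambda>s. br F W (\<gamma> s)) has_real_derivative br (br F W) W (\<gamma> t)) (at t)"
    "isCont (\<lambda>s. br (br F W) W (\<gamma> s)) t"
    by (rule D F smooth DERIV_isCont)+
qed

lemma trajectory_in_topspace:
  assumes "trajectory M \<A> br W I \<gamma>" "t \<in> I"
  shows "\<gamma> t \<in> topspace M"
  using assms by (auto simp: trajectory_def smooth_curve_def continuous_map_def)

theorem theorem2p2:
  fixes M :: "'m topology"
    and \<A> :: "('m set \<times> ('m \<Rightarrow> 'e::euclidean_space)) set"
    and br :: "('m \<Rightarrow> real) \<Rightarrow> ('m \<Rightarrow> real) \<Rightarrow> ('m \<Rightarrow> real)"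
    and \<alpha> :: "nat \<Rightarrow> nat \<Rightarrow> real"
    and X Y W :: "'m \<Rightarrow> real"
    and \<tau>0 \<tau>1 \<tau>2 \<tau>3 \<tau>4 :: real
  assumes "phase_space M \<A> br"
    and "classical_leonard_pair M \<A> br \<alpha> X Y"
    and "W = heun_observable br \<tau>0 \<tau>1 \<tau>2 \<tau>3 \<tau>4 X Y"
  shows
    "(\<forall>w::real. \<exists>P Q :: real poly. degree P \<le> 4 \<and> degree Q \<le> 4 \<and>
        (\<forall>I \<gamma>. trajectory M \<A> br W I \<gamma> \<longrightarrow> (\<forall>t\<in>I. W (\<gamma> t) = w) \<longrightarrow>
           (\<forall>t\<in>I. (deriv (\<lambda>s. X (\<gamma> s)) t)\<^sup>2 = poly P (X (\<gamma> t)) \<and>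
                   (deriv (\<lambda>s. Y (\<gamma> s)) t)\<^sup>2 = poly Q (Y (\<gamma> t)))))
     \<and>
     (\<forall>I \<gamma>. \<forall>P Q :: real poly.
        trajectory M \<A> br W I \<gamma> \<longrightarrow>
        (\<forall>t\<in>I. (deriv (\<lambda>s. X (\<gamma> s)) t)\<^sup>2 = poly P (X (\<gamma> t)) \<and>
                (deriv (\<lambda>s. Y (\<gamma> s)) t)\<^sup>2 = poly Q (Y (\<gamma> t))) \<longrightarrow>
        nondegenerate_quartic P \<longrightarrow> nondegenerate_quartic Q \<longrightarrow>
        \<not> (\<lambda>t. X (\<gamma> t)) constant_on I \<longrightarrow> \<not> (\<lambda>t. Y (\<gamma> t)) constant_on I \<longrightarrow>
        restriction_of_elliptic_order_two I (\<lambda>t. X (\<gamma> t)) \<and>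
        restriction_of_elliptic_order_two I (\<lambda>t. Y (\<gamma> t)))"

proof (intro conjI allI impI)
  note ps = assms(1) and lp = assms(2)
  note br = heun_observable_brackets[OF assms]
  have X: "smooth_function \<A> X" and Y: "smooth_function \<A> Y"
    using lp by (auto simp: classical_leonard_pair_def Let_def)
  have Z: "(br X Y m)\<^sup>2 = Phi \<alpha> (X m) (Y m)" if "m \<in> topspace M" for m
    using lp that by (simp add: classical_leonard_pair_def Let_def)
  note DX = trajectory_bracket_derivatives[OF ps br(1) X]
  note DY = trajectory_bracket_derivatives[OF ps br(1) Y]
  {
    fix w :: real
    \<comment> \<open>On the energy surface (\<tau>1 X + \<tau>4) Y + \<tau>2 Z = w - \<tau>0 -
      \<tau>3 X; the two linear polynomials are this right-hand side and the coefficient of Y. They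
      depend on \<open>w\<close> but not on the trajectory.\<close>
    define P where "P = heun_quartic \<alpha> \<tau>2 [:w - \<tau>0, - \<tau>3:] [:\<tau>4, \<tau>1:]"
    \<comment> \<open>Exchanging X and Y transposes \<alpha> and swaps \<tau>3 with \<tau>4. Formula
      (3) of \<open>br\<close> carries an overall minus sign, which disappears on squaring.\<close>
    define Q where "Q = heun_quartic (\<lambda>i j. \<alpha> j i) \<tau>2 [:w - \<tau>0, - \<tau>4:] [:\<tau>3, \<tau>1:]"
    have deg: "degree P \<le> 4" "degree Q \<le> 4"
      unfolding P_def Q_def by (rule degree_heun_quartic; simp)+
    have "(deriv (\<lambda>s. X (\<gamma> s)) t)\<^sup>2 = poly P (X (\<gamma> t)) \<and> (deriv (\<lambda>s. Y (\<gamma> s)) t)\<^sup>2 = poly Q (Y (\<gamma> t))"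
      if tr: "trajectory M \<A> br W I \<gamma>" and energy: "\<forall>t\<in>I. W (\<gamma> t) = w" and t: "t \<in> I" for I \<gamma> t
    proof -
      define m where "m = \<gamma> t"
      have m: "m \<in> topspace M"
        unfolding m_def by (rule trajectory_in_topspace[OF tr t])
      have dX: "deriv (\<lambda>s. X (\<gamma> s)) t = br X W m" and dY: "deriv (\<lambda>s. Y (\<gamma> s)) t = br Y W m"
        unfolding m_def by (rule DERIV_imp_deriv, rule DX(1)[OF tr t] DY(1)[OF tr t])+
      have Wm: "\<tau>1 * (X m * Y m) + \<tau>2 * br X Y m + \<tau>3 * X m + \<tau>4 * Y m + \<tau>0 = w"
        using energy t assms(3) by (simp add: m_def heun_observable_def)
      have "(poly [:\<tau>4, \<tau>1:] (X m) * br X Y m + \<tau>2 * (1 / 2 * Phi_Y \<alpha> (X m) (Y m)))\<^sup>2 = poly P (X m)"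
        unfolding P_def by (rule poly_heun_quartic[OF Z[OF m]]) (use Wm in \<open>simp add: algebra_simps\<close>)
      hence "(br X W m)\<^sup>2 = poly P (X m)"
        unfolding br(2)[OF m] by (simp add: algebra_simps)
      moreover have "(poly [:\<tau>3, \<tau>1:] (Y m) * br X Y m + \<tau>2 * (1 / 2 * Phi_Y (\<lambda>i j. \<alpha> j i) (Y m) (X m)))\<^sup>2 = poly Q (Y m)"
        unfolding Q_def
        by (rule poly_heun_quartic[OF Z[OF m, unfolded Phi_transpose[of \<alpha>]]]) (use Wm in \<open>simp add: algebra_simps\<close>)
      hence "(br Y W m)\<^sup>2 = poly Q (Y m)"
        unfolding br(3)[OF m] Phi_X_transpose power2_minus by (simp add: algebra_simps)
      ultimately show ?thesis
        unfolding dX dY by (simp add: m_def)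
    qed
    with deg show "\<exists>P Q :: real poly. degree P \<le> 4 \<and> degree Q \<le> 4 \<and>
        (\<forall>I \<gamma>. trajectory M \<A> br W I \<gamma> \<longrightarrow> (\<forall>t\<in>I. W (\<gamma> t) = w) \<longrightarrow>
           (\<forall>t\<in>I. (deriv (\<lambda>s. X (\<gamma> s)) t)\<^sup>2 = poly P (X (\<gamma> t)) \<and>
                   (deriv (\<lambda>s. Y (\<gamma> s)) t)\<^sup>2 = poly Q (Y (\<gamma> t))))"
      by blast
  }
  fix I \<gamma> and P Q :: "real poly"
  assume tr: "trajectory M \<A> br W I \<gamma>"
    and ode: "\<forall>t\<in>I. (deriv (\<lambda>s. X (\<gamma> s)) t)\<^sup>2 = poly P (X (\<gamma> t)) \<and>
                (deriv (\<lambda>s. Y (\<gamma> s)) t)\<^sup>2 = poly Q (Y (\<gamma> t))"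
    and P: "nondegenerate_quartic P" and Q: "nondegenerate_quartic Q"
    and nc: "\<not> (\<lambda>t. X (\<gamma> t)) constant_on I" "\<not> (\<lambda>t. Y (\<gamma> t)) constant_on I"
  have I: "open I" "is_interval I"
    using tr by (auto simp: trajectory_def)
  show "restriction_of_elliptic_order_two I (\<lambda>t. X (\<gamma> t))"
    by (rule real_solution_elliptic[OF I DX[OF tr] _ P nc(1)])
       (use ode DERIV_imp_deriv[OF DX(1)[OF tr]] in auto)
  show "restriction_of_elliptic_order_two I (\<lambda>t. Y (\<gamma> t))"
    by (rule real_solution_elliptic[OF I DY[OF tr] _ Q nc(2)])
       (use ode DERIV_imp_deriv[OF DY(1)[OF tr]] in auto)
qed

end
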